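(* Let $S$ be a soup can or a conical cup and let $A,B$ be distinct points of $S$. Every minimal path on $S$ from $A$ to $B$ is a geodesic.
   Context: Surfaces. A soup can of height $h>0$ is the closed surface $S\subset\mathbb{R}^3$ which in cylindrical coordinates $[r,\vartheta,z]$ is the union of the side $\{r=1,\ 0\le z\le h\}$, the lid $U_1=\{r\le 1,\ z=h\}$ and the base $U_2=\{r\le 1,\ z=0\}$; its rims are the circles $T_1=\partial U_1$ and $T_2=\partial U_2$. A conical cup with cone angle $\phi\in(0,\pi/2)$ and slant height $s=\csc\phi>1$ is the closed surface consisting of the side $\{r=z\tan\phi,\ 0\le z\le h\}$ and the lid $U=\{r\le 1,\ z=h\}$, where $h=\cot\phi$; its rim is $T=\partial U$ and its cone point is the origin. Paths. A path on $S$ from $A$ to $B$ is a continuous map $\gamma:[a,b]\to S$ with $\gamma(a)=A$, $\gamma(b)=B$. It is minimal if $\mathrm{length}(\gamma)\le \mathrm{length}(\beta)$ for every path $\beta$ on $S$ from $A$ to $B$. Minimal paths are taken to be parametrized with constant speed. Flat models. A flat model of $S$ is a pair $(\mathfrak F,q)$, where $\mathfrak F$ is a family of compact simply connected plane regions with piecewise smooth boundaries into which $S$ is isometrically decomposed, and $q:\mathfrak F\to S$ is the arc-length-preserving quotient map that glues the regions along their boundaries to form $S$. For a conical cup, $\mathfrak F$ consists of a closed unit disk (the lid) tangent to the arc of a circular sector of radius $s$ and angle $2\pi/s$ (the side, cut open along a ruling), the point of tangency representing a single point of the rim. For a soup can, $\mathfrak F$ consists of a $2\pi\times h$ rectangle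 (the side, cut open along a ruling) and two closed unit disks (lid and base) tangent to the two opposite edges of length $2\pi$, each point of tangency representing a single point of the corresponding rim. The ruling along which the side is cut and the points of tangency may vary from one flat model to another. Geodesics. A path $\gamma:[a,b]\to S$ is a geodesic if for each $t\in(a,b)$ there is a flat model $(\mathfrak F_t,q_t)$ of $S$ such that for every $\epsilon>0$ there are a $\delta>0$ and a line segment $\ell\subset\mathfrak F_t$ of length $\delta$ with midpoint $q_t^{-1}(\gamma(t))$ such that $\ell\subset q_t^{-1}[\gamma((t-\epsilon,t+\epsilon)\cap[a,b])]$. *)

theory Defs
  imports "HOL-Analysis.Analysis"
begin

section \<open>Surfaces\<close>

definition cyl :: "real \<Rightarrow> real \<Rightarrow> real \<Rightarrow> real^3" where
  "cyl r \<theta> z = vector [r * cos \<theta>, r * sin \<theta>, z]"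

definition horizontal_disk :: "real \<Rightarrow> (real^3) set" where
  "horizontal_disk z = {cyl r \<theta> z | r \<theta>. 0 \<le> r \<and> r \<le> 1}"

definition can_side :: "real \<Rightarrow> (real^3) set" where
  "can_side h = {cyl 1 \<theta> z | \<theta> z. 0 \<le> z \<and> z \<le> h}"

definition soup_can :: "real \<Rightarrow> (real^3) set" where
  "soup_can h = can_side h \<union> horizontal_disk h \<union> horizontal_disk 0"

definition cup_side :: "real \<Rightarrow> (real^3) set" where
  "cup_side \<phi> = {cyl (z * tan \<phi>) \<theta> z | \<theta> z. 0 \<le> z \<and> z \<le> cot \<phi>}"

definition conical_cup :: "real \<Rightarrow> (real^3) set" where
  "conical_cup \<phi> = cup_side \<phi> \<union> horizontal_disk (cot \<phi>)"

definition slant_height :: "real \<Rightarrow> real" where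
  "slant_height \<phi> = 1 / sin \<phi>"


section \<open>Paths and their length\<close>

definition path_on ::
    "'a::metric_space set \<Rightarrow> (real \<Rightarrow> 'a) \<Rightarrow> real \<Rightarrow> real \<Rightarrow> bool" where
  "path_on S \<gamma> a b \<longleftrightarrow> a < b \<and> continuous_on {a..b} \<gamma> \<and> \<gamma> ` {a..b} \<subseteq> S"

definition partitions :: "real \<Rightarrow> real \<Rightarrow> (nat \<times> (nat \<Rightarrow> real)) set" where
  "partitions a b = {(n, t). t 0 = a \<and> t n = b \<and> mono_on {..n} t}"

text \<open>The supremum of the lengths of inscribed polygons; it is infinite for a nonrectifiable path.\<close>
definition arc_length :: "(real \<Rightarrow> 'a::metric_space) \<Rightarrow> real \<Rightarrow> real \<Rightarrow> ennreal" where
  "arc_length \<gamma> a b =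
     (SUP (n, t) \<in> partitions a b. ennreal (\<Sum>i<n. dist (\<gamma> (t i)) (\<gamma> (t (Suc i)))))"

definition minimal_path ::
    "'a::metric_space set \<Rightarrow> (real \<Rightarrow> 'a) \<Rightarrow> real \<Rightarrow> real \<Rightarrow> bool" where
  "minimal_path S \<gamma> a b \<longleftrightarrow>
     path_on S \<gamma> a b \<and>
     (\<forall>\<beta> c d. path_on S \<beta> c d \<and> \<beta> c = \<gamma> a \<and> \<beta> d = \<gamma> b \<longrightarrow>
        arc_length \<gamma> a b \<le> arc_length \<beta> c d)"

definition constant_speed :: "(real \<Rightarrow> 'a::metric_space) \<Rightarrow> real \<Rightarrow> real \<Rightarrow> bool" where
  "constant_speed \<gamma> a b \<longleftrightarrow>
     (\<exists>c\<ge>0. \<forall>u v. a \<le> u \<and> u \<le> v \<and> v \<le> b \<longrightarrow>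
        arc_length \<gamma> u v = ennreal (c * (v - u)))"


section \<open>Flat models\<close>

text \<open>The plane is the type \<^typ>\<open>complex\<close>.\<close>

definition plane_region :: "complex set \<Rightarrow> bool" where
  "plane_region R \<longleftrightarrow>
     compact R \<and> simply_connected R \<and>
     (\<exists>g. valid_path g \<and> simple_path g \<and> pathfinish g = pathstart g \<and>
          path_image g = frontier R)"

text \<open>
  Regions of the family may touch in the plane, so the quotient map is a function on their
  union: a point shared by two regions represents a single point of the surface. The last
  clause says that points are identified only along the boundaries of the regions.
\<close>
definition flat_decomposition ::
    "(real^3) set \<Rightarrow> complex set set \<Rightarrow> (complex \<Rightarrow> real^3) \<Rightarrow> bool" where
  "flat_decomposition S F q \<longleftrightarrow>
     finite F \<and> (\<forall>R\<in>F. plane_region R) \<and>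
     quotient_map (top_of_set (\<Union>F)) (top_of_set S) q \<and>
     (\<forall>R\<in>F. \<forall>\<gamma> a b. path_on R \<gamma> a b \<longrightarrow> arc_length (q \<circ> \<gamma>) a b = arc_length \<gamma> a b) \<and>
     (\<forall>R\<in>F. \<forall>x\<in>interior R. \<forall>y\<in>\<Union>F. q y = q x \<longrightarrow> y = x)"

definition plane_isometry :: "(complex \<Rightarrow> complex) \<Rightarrow> bool" where
  "plane_isometry M \<longleftrightarrow> (\<forall>x y. dist (M x) (M y) = dist x y)"

definition rectangle :: "real \<Rightarrow> complex set" where
  "rectangle h = {w. 0 \<le> Re w \<and> Re w \<le> 2 * pi \<and> 0 \<le> Im w \<and> Im w \<le> h}"

text \<open>
  Up to a plane isometry, the side of the can is \<^term>\<open>rectangle h\<close>, the lid is the unit disk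
  tangent to its top edge at \<^term>\<open>Complex u h\<close>, and the base is the unit disk tangent to its
  bottom edge at \<^term>\<open>Complex v 0\<close>. The last three clauses spell out the gluing: the two edges
  at the cut are identified, and each disk is rolled without slipping along its edge, starting
  at the point of tangency. In particular the gluing respects the orientation of the plane;
  arc-length preservation alone would also allow a disk to be glued in after a reflection that
  fixes the point of tangency.
\<close>
definition can_layout ::
    "real \<Rightarrow> complex set set \<Rightarrow> (complex \<Rightarrow> real^3) \<Rightarrow> bool" where
  "can_layout h F q \<longleftrightarrow>
     (\<exists>M u v. plane_isometry M \<and> u \<in> {0..2*pi} \<and> v \<in> {0..2*pi} \<and>
        (let side = M ` rectangle h;
             lid = M ` cball (Complex u (h + 1)) 1;
             base = M ` cball (Complex v (- 1)) 1
         in F = {side, lid, base} \<and>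
            q ` side = can_side h \<and>
            q ` lid = horizontal_disk h \<and>
            q ` base = horizontal_disk 0) \<and>
        (\<forall>y\<in>{0..h}. q (M (Complex 0 y)) = q (M (Complex (2 * pi) y))) \<and>
        (\<forall>x\<in>{0..2*pi}. q (M (Complex x h)) =
            q (M (Complex u (h + 1) + Complex (sin (x - u)) (- cos (x - u))))) \<and>
        (\<forall>x\<in>{0..2*pi}. q (M (Complex x 0)) =
            q (M (Complex v (- 1) + Complex (sin (x - v)) (cos (x - v))))))"

definition sector :: "real \<Rightarrow> real \<Rightarrow> complex set" where
  "sector s \<alpha> = {of_real r * cis t | r t. 0 \<le> r \<and> r \<le> s \<and> 0 \<le> t \<and> t \<le> \<alpha>}"

text \<open>
  Here the lid is tangent to the arc of the sector, from outside, at \<open>s * cis \<tau>\<close>. The point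
  \<open>s * cis t\<close> of the arc is at signed arc length \<open>s * (t - \<tau>)\<close> from the point of tangency and
  is identified with the point of the unit circle at the same signed arc length.
\<close>
definition cup_layout ::
    "real \<Rightarrow> complex set set \<Rightarrow> (complex \<Rightarrow> real^3) \<Rightarrow> bool" where
  "cup_layout \<phi> F q \<longleftrightarrow>
     (let s = slant_height \<phi>; \<alpha> = 2 * pi / s in
      \<exists>M \<tau>. plane_isometry M \<and> \<tau> \<in> {0..\<alpha>} \<and>
        (let side = M ` sector s \<alpha>;
             lid = M ` cball (of_real (s + 1) * cis \<tau>) 1
         in F = {side, lid} \<and>
            q ` side = cup_side \<phi> \<and>
            q ` lid = horizontal_disk (cot \<phi>)) \<and>
        (\<forall>r\<in>{0..s}. q (M (of_real r)) = q (M (of_real r * cis \<alpha>))) \<and>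
        (\<forall>t\<in>{0..\<alpha>}. q (M (of_real s * cis t)) =
            q (M (of_real (s + 1) * cis \<tau> - cis (\<tau> - s * (t - \<tau>))))))"

definition flat_model ::
    "(real^3) set \<Rightarrow> complex set set \<Rightarrow> (complex \<Rightarrow> real^3) \<Rightarrow> bool" where
  "flat_model S F q \<longleftrightarrow>
     flat_decomposition S F q \<and>
     ((\<exists>h>0. S = soup_can h \<and> can_layout h F q) \<or>
      (\<exists>\<phi>. 0 < \<phi> \<and> \<phi> < pi / 2 \<and> S = conical_cup \<phi> \<and> cup_layout \<phi> F q))"


section \<open>Geodesics\<close>

text \<open>
  The surface point \<open>\<gamma> t\<close> is required to have exactly one preimage \<open>m\<close> in the flat model,
  which is the midpoint of the segments.
\<close>
definition geodesic :: "(real^3) set \<Rightarrow> (real \<Rightarrow> real^3) \<Rightarrow> real \<Rightarrow> real \<Rightarrow> bool" where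
  "geodesic S \<gamma> a b \<longleftrightarrow>
     path_on S \<gamma> a b \<and>
     (\<forall>t\<in>{a<..<b}. \<exists>F q m. flat_model S F q \<and> \<Union>F \<inter> q -` {\<gamma> t} = {m} \<and>
        (\<forall>\<epsilon>>0. \<exists>\<delta>>0. \<exists>x y. dist x y = \<delta> \<and> midpoint x y = m \<and>
           closed_segment x y \<subseteq> \<Union>F \<inter> q -` (\<gamma> ` ({t - \<epsilon><..<t + \<epsilon>} \<inter> {a..b}))))"

end

(*
  A path of constant speed c is c-Lipschitz, and if it is minimal, then no 1-Lipschitz path on the
  surface that joins two of its points is shorter than the arc between them. Hence wherever the
  path can be lifted to a convex part of a face of a flat model, the lift traverses a segment,
  because arc length is preserved.

  The lid and the base are convex in space, so the path meets each of them in a single segment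
  whose inner points are not on the rim. A rim point that is passed at an interior time therefore
  separates a segment in the side from a segment in the disk (both neighbouring pieces in the side
  is impossible, since the side lies strictly on one side of the tangent in the flat model). Rolled
  out at that point, the two segments are opposite: the length of the competing broken paths that
  cross the rim nearby has a local minimum there, so its derivative vanishes. Finally, a minimal
  path does not pass through the cone point, because the points at equal distance before and after
  it are joined by a chord of a sector of angle less than pi, which is shorter.
*)

theory Submission
  imports Defs "HOL-Complex_Analysis.Contour_Integration"
begin

section \<open>Arc length\<close>

lemma partitions_mem:
  assumes "(n, t) \<in> partitions a b" "i \<le> n"
  shows "t i \<in> {a..b}"
  using assms by (auto simp: partitions_def mono_on_def)

lemma partitions_step:
  assumes "(n, t) \<in> partitions a b" "i < n"
  shows "t i \<le> t (Suc i)"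
  using assms by (auto simp: partitions_def mono_on_def)

lemma polygon_le_arc_length:
  assumes "(n, t) \<in> partitions a b"
  shows "ennreal (\<Sum>i<n. dist (\<gamma> (t i)) (\<gamma> (t (Suc i)))) \<le> arc_length \<gamma> a b"
  unfolding arc_length_def by (rule SUP_upper2[OF assms]) simp

lemma arc_length_le:
  assumes "\<And>n t. (n, t) \<in> partitions a b \<Longrightarrow>
             ennreal (\<Sum>i<n. dist (\<gamma> (t i)) (\<gamma> (t (Suc i)))) \<le> L"
  shows "arc_length \<gamma> a b \<le> L"
  unfolding arc_length_def by (rule SUP_least) (auto intro: assms)

lemma partitions_append:
  assumes "(n, t) \<in> partitions a b" "(m, s) \<in> partitions b c"
  shows "(n + m, \<lambda>i. if i \<le> n then t i else s (i - n)) \<in> partitions a c"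
proof -
  have t: "t 0 = a" "t n = b" "mono_on {..n} t" and s: "s 0 = b" "s m = c" "mono_on {..m} s"
    using assms by (auto simp: partitions_def)
  have "(if i \<le> n then t i else s (i - n)) \<le> (if j \<le> n then t j else s (j - n))"
    if "i \<le> j" "j \<le> n + m" for i j
  proof (cases "j \<le> n \<or> n < i")
    case True
    moreover have "t i \<le> t j" if "j \<le> n"
      using that \<open>i \<le> j\<close> by (intro mono_onD[OF t(3)]) auto
    moreover have "s (i - n) \<le> s (j - n)" if "n < i"
      using that \<open>i \<le> j\<close> \<open>j \<le> n + m\<close> by (intro mono_onD[OF s(3)]) auto
    ultimately show ?thesis
      using \<open>i \<le> j\<close> by auto
  next
    case False
    then have "t i \<le> t n" "s 0 \<le> s (j - n)"
      using that by (auto intro!: mono_onD[OF t(3)] mono_onD[OF s(3)])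
    then show ?thesis using False t s by auto
  qed
  then show ?thesis
    using t s unfolding partitions_def mono_on_def by auto
qed

lemma partitions_pair: "a \<le> b \<Longrightarrow> (1, \<lambda>i. if i = 0 then a else b) \<in> partitions a b"
  by (auto simp: partitions_def mono_on_def)

lemma dist_le_arc_length:
  assumes "a \<le> b"
  shows "ennreal (dist (\<gamma> a) (\<gamma> b)) \<le> arc_length \<gamma> a b"
  using polygon_le_arc_length[OF partitions_pair[OF assms], of \<gamma>] by simp

lemma arc_length_superadditive:
  assumes "a \<le> b" "b \<le> c"
  shows "arc_length \<gamma> a b + arc_length \<gamma> b c \<le> arc_length \<gamma> a c"
proof -
  let ?f = "\<lambda>(n, t). ennreal (\<Sum>i<n. dist (\<gamma> (t i)) (\<gamma> (t (Suc i))))"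
  have ne: "partitions a b \<noteq> {}" "partitions b c \<noteq> {}"
    using partitions_pair assms by blast+
  have *: "?f p + ?f r \<le> arc_length \<gamma> a c"
    if p: "p \<in> partitions a b" and r: "r \<in> partitions b c" for p r
  proof -
    obtain n t m s where [simp]: "p = (n, t)" "r = (m, s)" by (cases p, cases r)
    let ?w = "\<lambda>i. if i \<le> n then t i else s (i - n)"
    have ts: "t n = b" "s 0 = b"
      using p r by (auto simp: partitions_def)
    have "(\<Sum>i<n + m. dist (\<gamma> (?w i)) (\<gamma> (?w (Suc i)))) =
          (\<Sum>i<n. dist (\<gamma> (?w i)) (\<gamma> (?w (Suc i)))) +
          (\<Sum>i<m. dist (\<gamma> (?w (n + i))) (\<gamma> (?w (Suc (n + i)))))"
      by (induction m) (auto simp: add.assoc)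
    also have "\<dots> = (\<Sum>i<n. dist (\<gamma> (t i)) (\<gamma> (t (Suc i)))) +
          (\<Sum>i<m. dist (\<gamma> (s i)) (\<gamma> (s (Suc i))))"
      using ts by (intro arg_cong2[where f = "(+)"] sum.cong) (auto simp: Suc_diff_le)
    finally show ?thesis
      using polygon_le_arc_length[OF partitions_append[OF p[simplified] r[simplified]], of \<gamma>]
      by (simp add: ennreal_plus sum_nonneg)
  qed
  have "?f p + arc_length \<gamma> b c \<le> arc_length \<gamma> a c" if "p \<in> partitions a b" for p
  proof -
    have "?f p + arc_length \<gamma> b c = (SUP r\<in>partitions b c. ?f p + ?f r)"
      unfolding arc_length_def by (rule ennreal_SUP_add_right) (use ne in auto)
    also have "\<dots> \<le> arc_length \<gamma> a c"
      by (rule SUP_least) (rule *[OF that])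
    finally show ?thesis .
  qed
  then have "(SUP p\<in>partitions a b. ?f p + arc_length \<gamma> b c) \<le> arc_length \<gamma> a c"
    by (intro SUP_least)
  moreover have "arc_length \<gamma> a b + arc_length \<gamma> b c =
      (SUP p\<in>partitions a b. ?f p + arc_length \<gamma> b c)"
    unfolding arc_length_def[of \<gamma> a b]
    by (rule ennreal_SUP_add_left[symmetric]) (use ne in auto)
  ultimately show ?thesis by simp
qed

lemma arc_length_le_lipschitz:
  assumes lip: "\<And>u v. a \<le> u \<Longrightarrow> u \<le> v \<Longrightarrow> v \<le> b \<Longrightarrow> dist (\<gamma> u) (\<gamma> v) \<le> K * (v - u)"
  shows "arc_length \<gamma> a b \<le> ennreal (K * (b - a))"
proof (rule arc_length_le)
  fix n t assume p: "(n, t) \<in> partitions a b"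
  have "(\<Sum>i<n. dist (\<gamma> (t i)) (\<gamma> (t (Suc i)))) \<le> (\<Sum>i<n. K * (t (Suc i) - t i))"
    using partitions_mem[OF p] partitions_step[OF p] by (intro sum_mono lip) auto
  also have "\<dots> = K * (b - a)"
    using p by (simp add: sum_lessThan_telescope partitions_def flip: sum_distrib_left)
  finally show "ennreal (\<Sum>i<n. dist (\<gamma> (t i)) (\<gamma> (t (Suc i)))) \<le> ennreal (K * (b - a))"
    by (rule ennreal_leI)
qed

definition short_on :: "'a::metric_space set \<Rightarrow> ('a \<Rightarrow> 'b::metric_space) \<Rightarrow> bool" where
  "short_on R q \<longleftrightarrow> (\<forall>x\<in>R. \<forall>y\<in>R. dist (q x) (q y) \<le> dist x y)"

lemma short_onI:
  "(\<And>x y. x \<in> R \<Longrightarrow> y \<in> R \<Longrightarrow> dist (q x) (q y) \<le> dist x y) \<Longrightarrow> short_on R q"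
  by (simp add: short_on_def)

lemma short_onD: "short_on R q \<Longrightarrow> x \<in> R \<Longrightarrow> y \<in> R \<Longrightarrow> dist (q x) (q y) \<le> dist x y"
  by (simp add: short_on_def)

lemma short_on_subset: "short_on R q \<Longrightarrow> R' \<subseteq> R \<Longrightarrow> short_on R' q"
  by (auto simp: short_on_def)

lemma short_on_continuous: "short_on R q \<Longrightarrow> continuous_on R q"
  unfolding short_on_def continuous_on_iff by (metis order_le_less_trans)

lemma arc_length_short_on:
  assumes "short_on R q" "\<gamma> ` {a..b} \<subseteq> R"
  shows "arc_length (q \<circ> \<gamma>) a b \<le> arc_length \<gamma> a b"
proof (rule arc_length_le)
  fix n t assume p: "(n, t) \<in> partitions a b"
  have "(\<Sum>i<n. dist ((q \<circ> \<gamma>) (t i)) ((q \<circ> \<gamma>) (t (Suc i)))) \<le>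
        (\<Sum>i<n. dist (\<gamma> (t i)) (\<gamma> (t (Suc i))))"
    using partitions_mem[OF p] assms by (intro sum_mono) (auto intro!: short_onD[OF assms(1)])
  then show "ennreal (\<Sum>i<n. dist ((q \<circ> \<gamma>) (t i)) ((q \<circ> \<gamma>) (t (Suc i)))) \<le> arc_length \<gamma> a b"
    using polygon_le_arc_length[OF p, of \<gamma>] by (rule order_trans[OF ennreal_leI])
qed

definition nearly_isometric_at ::
    "'a::metric_space set \<Rightarrow> ('a \<Rightarrow> 'b::metric_space) \<Rightarrow> 'a \<Rightarrow> bool" where
  "nearly_isometric_at R q x \<longleftrightarrow>
     (\<forall>k<1. \<exists>\<delta>>0. \<forall>y\<in>R \<inter> ball x \<delta>. \<forall>z\<in>R \<inter> ball x \<delta>. k * dist y z \<le> dist (q y) (q z))"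

lemma nearly_isometric_at_subset:
  "nearly_isometric_at R q x \<Longrightarrow> R' \<subseteq> R \<Longrightarrow> nearly_isometric_at R' q x"
  unfolding nearly_isometric_at_def by blast

lemma nearly_isometric_at_cong:
  assumes "\<And>y. y \<in> R \<Longrightarrow> q y = q' y" "nearly_isometric_at UNIV q' x"
  shows "nearly_isometric_at R q x"
  unfolding nearly_isometric_at_def
proof (intro allI impI)
  fix k :: real assume "k < 1"
  then obtain \<delta> where \<delta>: "\<delta> > 0"
    "\<And>y z. y \<in> ball x \<delta> \<Longrightarrow> z \<in> ball x \<delta> \<Longrightarrow> k * dist y z \<le> dist (q' y) (q' z)"
    using assms(2) unfolding nearly_isometric_at_def by (metis UNIV_I Int_UNIV_left)
  then show "\<exists>\<delta>>0. \<forall>y\<in>R \<inter> ball x \<delta>. \<forall>z\<in>R \<inter> ball x \<delta>. k * dist y z \<le> dist (q y) (q z)"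
    using assms(1) by (intro exI[of _ \<delta>]) auto
qed

lemma nearly_isometric_at_isometry:
  assumes "\<And>y z. y \<in> R \<Longrightarrow> z \<in> R \<Longrightarrow> dist (q y) (q z) = dist y z"
  shows "nearly_isometric_at R q x"
proof -
  have "k * dist y z \<le> dist y z" if "k < 1" for k and y z :: 'a
    using that mult_right_mono[of k 1 "dist y z"] by auto
  then show ?thesis
    unfolding nearly_isometric_at_def using assms by (auto intro!: exI[of _ "1::real"])
qed

lemma arc_length_cong:
  assumes "\<And>u. u \<in> {a..b} \<Longrightarrow> f u = g u"
  shows "arc_length f a b = arc_length g a b"
  unfolding arc_length_def
proof (rule SUP_cong[OF refl])
  fix p assume p: "p \<in> partitions a b"
  obtain n t where [simp]: "p = (n, t)" by (cases p)
  have "f (t i) = g (t i)" if "i \<le> n" for i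
    using partitions_mem[of n t a b i] p that by (auto intro: assms)
  then have "(\<Sum>i<n. dist (f (t i)) (f (t (Suc i)))) = (\<Sum>i<n. dist (g (t i)) (g (t (Suc i))))"
    by (intro sum.cong) auto
  then show "(case p of (n, t) \<Rightarrow> ennreal (\<Sum>i<n. dist (f (t i)) (f (t (Suc i))))) =
      (case p of (n, t) \<Rightarrow> ennreal (\<Sum>i<n. dist (g (t i)) (g (t (Suc i)))))"
    by simp
qed


lemma dist_le_arc_length_nearly_isometric:
  assumes "a \<le> b" "continuous_on {a..b} \<gamma>" "\<gamma> ` {a..b} \<subseteq> R"
    and near: "\<And>t. t \<in> {a..b} \<Longrightarrow> nearly_isometric_at R q (\<gamma> t)"
  shows "ennreal (dist (\<gamma> a) (\<gamma> b)) \<le> arc_length (q \<circ> \<gamma>) a b"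
proof -
  have k: "ennreal (k * dist (\<gamma> a) (\<gamma> b)) \<le> arc_length (q \<circ> \<gamma>) a b" if "k < 1" "0 < k" for k
  proof -
    define P where "P = (\<lambda>u v. a \<le> u \<longrightarrow> v \<le> b \<longrightarrow>
      ennreal (k * dist (\<gamma> u) (\<gamma> v)) \<le> arc_length (q \<circ> \<gamma>) u v)"
    have "P a b"
      using \<open>a \<le> b\<close>
    proof (induction rule: Bolzano)
      case (trans u v w)
      show ?case
        unfolding P_def
      proof (intro impI)
        assume uw: "a \<le> u" "w \<le> b"
        have "ennreal (k * dist (\<gamma> u) (\<gamma> w)) \<le> ennreal (k * dist (\<gamma> u) (\<gamma> v) + k * dist (\<gamma> v) (\<gamma> w))"
          using dist_triangle[of "\<gamma> u" "\<gamma> w" "\<gamma> v"] that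
          by (intro ennreal_leI) (simp flip: distrib_left)
        also have "\<dots> = ennreal (k * dist (\<gamma> u) (\<gamma> v)) + ennreal (k * dist (\<gamma> v) (\<gamma> w))"
          using that by (intro ennreal_plus) auto
        also have "\<dots> \<le> arc_length (q \<circ> \<gamma>) u v + arc_length (q \<circ> \<gamma>) v w"
          using trans uw by (intro add_mono) (auto simp: P_def)
        also have "\<dots> \<le> arc_length (q \<circ> \<gamma>) u w"
          using trans by (intro arc_length_superadditive)
        finally show "ennreal (k * dist (\<gamma> u) (\<gamma> w)) \<le> arc_length (q \<circ> \<gamma>) u w" .
      qed
    next
      case (local x)
      obtain \<delta> where \<delta>: "\<delta> > 0"
        "\<And>y z. y \<in> R \<inter> ball (\<gamma> x) \<delta> \<Longrightarrow> z \<in> R \<inter> ball (\<gamma> x) \<delta> \<Longrightarrow> k * dist y z \<le> dist (q y) (q z)"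
        using near[of x] local \<open>k < 1\<close> unfolding nearly_isometric_at_def by (metis atLeastAtMost_iff)
      obtain d where d: "d > 0" "\<And>y. y \<in> {a..b} \<Longrightarrow> dist y x < d \<Longrightarrow> dist (\<gamma> y) (\<gamma> x) < \<delta>"
        using assms(2) local \<delta>(1) unfolding continuous_on_iff by (metis atLeastAtMost_iff)
      have "P u v" if uv: "u \<le> x" "x \<le> v" "v - u < d" for u v
        unfolding P_def
      proof (intro impI)
        assume "a \<le> u" "v \<le> b"
        then have "\<gamma> u \<in> R \<inter> ball (\<gamma> x) \<delta>" "\<gamma> v \<in> R \<inter> ball (\<gamma> x) \<delta>"
          using d(2)[of u] d(2)[of v] uv assms(3) by (auto simp: dist_real_def dist_commute)
        then have "ennreal (k * dist (\<gamma> u) (\<gamma> v)) \<le> ennreal (dist ((q \<circ> \<gamma>) u) ((q \<circ> \<gamma>) v))"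
          by (auto intro!: ennreal_leI \<delta>)
        also have "\<dots> \<le> arc_length (q \<circ> \<gamma>) u v"
          using uv by (intro dist_le_arc_length) auto
        finally show "ennreal (k * dist (\<gamma> u) (\<gamma> v)) \<le> arc_length (q \<circ> \<gamma>) u v" .
      qed
      then show ?case using d(1) by blast
    qed
    then show ?thesis by (simp add: P_def)
  qed
  have "((\<lambda>k. ennreal (k * dist (\<gamma> a) (\<gamma> b))) \<longlongrightarrow> ennreal (1 * dist (\<gamma> a) (\<gamma> b))) (at_left 1)"
    by (intro tendsto_intros)
  moreover have "\<forall>\<^sub>F k in at_left 1. ennreal (k * dist (\<gamma> a) (\<gamma> b)) \<le> arc_length (q \<circ> \<gamma>) a b"
    using eventually_at_left_real[of 0 "1::real"] by (auto elim!: eventually_mono intro!: k)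
  ultimately have "ennreal (1 * dist (\<gamma> a) (\<gamma> b)) \<le> arc_length (q \<circ> \<gamma>) a b"
    by (rule tendsto_upperbound) simp
  then show ?thesis by simp
qed

text \<open>
  The point \<open>p\<close> accommodates the apex of a cone, where angles are distorted but distances
  to the apex are not.
\<close>
lemma arc_length_nearly_isometric:
  assumes \<gamma>: "path_on R \<gamma> a b" and "short_on R q"
    and near: "\<And>x. x \<in> R \<Longrightarrow> x \<noteq> p \<Longrightarrow> nearly_isometric_at R q x"
    and radial: "\<And>x. x \<in> R \<Longrightarrow> p \<in> R \<Longrightarrow> dist (q x) (q p) = dist x p"
  shows "arc_length (q \<circ> \<gamma>) a b = arc_length \<gamma> a b"
proof (rule antisym)
  have cont: "continuous_on {a..b} \<gamma>" and im: "\<gamma> ` {a..b} \<subseteq> R" and "a < b"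
    using \<gamma> by (auto simp: path_on_def)
  show "arc_length (q \<circ> \<gamma>) a b \<le> arc_length \<gamma> a b"
    using assms(2) im by (rule arc_length_short_on)
  have seg: "ennreal (dist (\<gamma> u) (\<gamma> v)) \<le> arc_length (q \<circ> \<gamma>) u v"
    if "a \<le> u" "u \<le> v" "v \<le> b" for u v
  proof (cases "p \<in> \<gamma> ` {u..v}")
    case False
    then show ?thesis
      using that im continuous_on_subset[OF cont, of "{u..v}"]
      by (intro dist_le_arc_length_nearly_isometric[where R = R] near) auto
  next
    case True
    then obtain w where w: "u \<le> w" "w \<le> v" "\<gamma> w = p" by auto
    have R: "\<gamma> u \<in> R" "\<gamma> v \<in> R" "p \<in> R"
      using im that w by auto
    have "ennreal (dist (\<gamma> u) (\<gamma> v)) \<le> ennreal (dist (\<gamma> u) p + dist (\<gamma> v) p)"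
      by (intro ennreal_leI dist_triangle2)
    also have "\<dots> = ennreal (dist ((q \<circ> \<gamma>) u) ((q \<circ> \<gamma>) w)) + ennreal (dist ((q \<circ> \<gamma>) w) ((q \<circ> \<gamma>) v))"
      using R radial[OF R(1,3)] radial[OF R(2,3)] by (simp add: w ennreal_plus dist_commute)
    also have "\<dots> \<le> arc_length (q \<circ> \<gamma>) u w + arc_length (q \<circ> \<gamma>) w v"
      using w by (intro add_mono dist_le_arc_length)
    also have "\<dots> \<le> arc_length (q \<circ> \<gamma>) u v"
      using w by (intro arc_length_superadditive)
    finally show ?thesis .
  qed
  show "arc_length \<gamma> a b \<le> arc_length (q \<circ> \<gamma>) a b"
  proof (rule arc_length_le)
    fix n t assume p: "(n, t) \<in> partitions a b"
    have "ennreal (\<Sum>i<m. dist (\<gamma> (t i)) (\<gamma> (t (Suc i)))) \<le> arc_length (q \<circ> \<gamma>) (t 0) (t m)"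
      if "m \<le> n" for m
      using that
    proof (induction m)
      case (Suc m)
      have m: "t m \<le> t (Suc m)" "a \<le> t m" "t (Suc m) \<le> b" "t 0 \<le> t m"
        using partitions_step[OF p, of m] partitions_mem[OF p, of m] partitions_mem[OF p, of "Suc m"]
          Suc.prems p by (auto simp: partitions_def)
      have "ennreal (\<Sum>i<Suc m. dist (\<gamma> (t i)) (\<gamma> (t (Suc i)))) =
          ennreal (\<Sum>i<m. dist (\<gamma> (t i)) (\<gamma> (t (Suc i)))) + ennreal (dist (\<gamma> (t m)) (\<gamma> (t (Suc m))))"
        by (simp add: sum_nonneg ennreal_plus)
      also have "\<dots> \<le> arc_length (q \<circ> \<gamma>) (t 0) (t m) + arc_length (q \<circ> \<gamma>) (t m) (t (Suc m))"
        using Suc.prems m by (intro add_mono seg Suc.IH) auto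
      also have "\<dots> \<le> arc_length (q \<circ> \<gamma>) (t 0) (t (Suc m))"
        using m by (intro arc_length_superadditive)
      finally show ?case .
    qed simp
    from this[of n] show "ennreal (\<Sum>i<n. dist (\<gamma> (t i)) (\<gamma> (t (Suc i)))) \<le> arc_length (q \<circ> \<gamma>) a b"
      using p by (simp add: partitions_def)
  qed
qed

section \<open>Shortest paths\<close>

definition joinable :: "'a::metric_space set \<Rightarrow> 'a \<Rightarrow> 'a \<Rightarrow> real \<Rightarrow> bool" where
  "joinable S p r L \<longleftrightarrow> 0 \<le> L \<and> (\<exists>\<beta>. \<beta> 0 = p \<and> \<beta> L = r \<and> \<beta> ` {0..L} \<subseteq> S \<and>
     (\<forall>u v. 0 \<le> u \<and> u \<le> v \<and> v \<le> L \<longrightarrow> dist (\<beta> u) (\<beta> v) \<le> v - u))"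

lemma joinable_sym:
  assumes "joinable S p r L"
  shows "joinable S r p L"
proof -
  obtain \<beta> where \<beta>: "0 \<le> L" "\<beta> 0 = p" "\<beta> L = r" "\<beta> ` {0..L} \<subseteq> S"
    "\<And>u v. 0 \<le> u \<Longrightarrow> u \<le> v \<Longrightarrow> v \<le> L \<Longrightarrow> dist (\<beta> u) (\<beta> v) \<le> v - u"
    using assms unfolding joinable_def by blast
  have "dist (\<beta> (L - u)) (\<beta> (L - v)) \<le> v - u" if "0 \<le> u" "u \<le> v" "v \<le> L" for u v
    using \<beta>(5)[of "L - v" "L - u"] that by (simp add: dist_commute)
  then show ?thesis
    unfolding joinable_def using \<beta> by (intro conjI exI[of _ "\<lambda>u. \<beta> (L - u)"]) auto
qed

lemma joinable_trans:
  assumes "joinable S p r L" "joinable S r s L'"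
  shows "joinable S p s (L + L')"
proof -
  obtain f where f: "0 \<le> L" "f 0 = p" "f L = r" "f ` {0..L} \<subseteq> S"
    "\<And>u v. 0 \<le> u \<Longrightarrow> u \<le> v \<Longrightarrow> v \<le> L \<Longrightarrow> dist (f u) (f v) \<le> v - u"
    using assms(1) unfolding joinable_def by blast
  obtain g where g: "0 \<le> L'" "g 0 = r" "g L' = s" "g ` {0..L'} \<subseteq> S"
    "\<And>u v. 0 \<le> u \<Longrightarrow> u \<le> v \<Longrightarrow> v \<le> L' \<Longrightarrow> dist (g u) (g v) \<le> v - u"
    using assms(2) unfolding joinable_def by blast
  define h where "h = (\<lambda>u. if u \<le> L then f u else g (u - L))"
  have "dist (h u) (h v) \<le> v - u" if "0 \<le> u" "u \<le> v" "v \<le> L + L'" for u v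
  proof (cases "u \<le> L \<and> L < v")
    case True
    have "dist (f u) (f L) \<le> L - u" "dist (g 0) (g (v - L)) \<le> v - L"
      using f(5)[of u L] g(5)[of 0 "v - L"] that True by auto
    then show ?thesis
      using True dist_triangle[of "f u" "g (v - L)" r] f(3) g(2) by (auto simp: h_def)
  next
    case False
    then show ?thesis
      using f(5)[of u v] g(5)[of "u - L" "v - L"] that by (auto simp: h_def)
  qed
  moreover have "h (L + L') = s"
    using f g by (cases "L' = 0") (auto simp: h_def)
  ultimately show ?thesis
    unfolding joinable_def using f g by (intro conjI exI[of _ h]) (auto simp: h_def)
qed

lemma joinable_dist_le: "joinable S p r L \<Longrightarrow> dist p r \<le> L"
  unfolding joinable_def by (metis diff_zero order_refl)

lemma joinable_segment:
  fixes q :: "'a::real_normed_vector \<Rightarrow> 'b::metric_space"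
  assumes "short_on R q" "closed_segment x y \<subseteq> R" "q ` R \<subseteq> S"
  shows "joinable S (q x) (q y) (dist x y)"
proof (cases "x = y")
  case True
  then show ?thesis
    unfolding joinable_def using assms(2,3) by (intro conjI exI[of _ "\<lambda>_. q x"]) auto
next
  case False
  define L where "L = dist x y"
  define \<beta> where "\<beta> = (\<lambda>u. x + (u / L) *\<^sub>R (y - x))"
  have L: "L > 0" using False by (simp add: L_def)
  have R: "\<beta> u \<in> R" if "u \<in> {0..L}" for u
  proof -
    have "\<beta> u = (1 - u / L) *\<^sub>R x + (u / L) *\<^sub>R y"
      by (simp add: \<beta>_def algebra_simps)
    then have "\<beta> u \<in> closed_segment x y"
      unfolding closed_segment_def using that L by (auto intro!: exI[of _ "u / L"])
    then show ?thesis using assms(2) by blast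
  qed
  have "dist (q (\<beta> u)) (q (\<beta> v)) \<le> v - u" if "0 \<le> u" "u \<le> v" "v \<le> L" for u v
  proof -
    have "\<beta> u - \<beta> v = ((u - v) / L) *\<^sub>R (y - x)"
      by (simp add: \<beta>_def diff_divide_distrib scaleR_left_diff_distrib)
    then have "dist (\<beta> u) (\<beta> v) = \<bar>u - v\<bar> / L * norm (y - x)"
      using L by (simp add: dist_norm)
    also have "\<dots> = v - u"
      using L that by (simp add: L_def dist_norm norm_minus_commute)
    finally show ?thesis
      using short_onD[OF assms(1) R[of u] R[of v]] that by auto
  qed
  moreover have "\<beta> 0 = x" "\<beta> L = y"
    using L by (auto simp: \<beta>_def)
  ultimately show ?thesis
    unfolding joinable_def L_def[symmetric] using L R assms(3)
    by (intro conjI exI[of _ "q \<circ> \<beta>"]) auto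
qed

lemma extremal_lipschitz_affine:
  fixes f :: "real \<Rightarrow> 'a::euclidean_space"
  assumes iso: "\<And>s t. u \<le> s \<Longrightarrow> s \<le> t \<Longrightarrow> t \<le> v \<Longrightarrow> dist (f s) (f t) \<le> c * (t - s)"
    and ends: "dist (f u) (f v) = c * (v - u)" and "c > 0" "u \<le> w" "w \<le> v"
  shows "(v - u) *\<^sub>R f w = (v - w) *\<^sub>R f u + (w - u) *\<^sub>R f v"
proof -
  have 1: "dist (f u) (f w) \<le> c * (w - u)" "dist (f w) (f v) \<le> c * (v - w)"
    using assms by (auto intro: iso)
  moreover have "c * (w - u) + c * (v - w) = dist (f u) (f v)"
    using ends by (simp add: algebra_simps)
  ultimately have 2: "dist (f u) (f w) = c * (w - u)" "dist (f w) (f v) = c * (v - w)"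
    using dist_triangle[of "f u" "f v" "f w"] by linarith+
  then have "dist (f u) (f v) = dist (f u) (f w) + dist (f w) (f v)"
    using ends by (simp add: algebra_simps)
  then have "(c * (w - u)) *\<^sub>R (f w - f v) = (c * (v - w)) *\<^sub>R (f u - f w)"
    unfolding dist_triangle_eq using 2 by (simp add: dist_norm)
  then have "c *\<^sub>R ((w - u) *\<^sub>R (f w - f v)) = c *\<^sub>R ((v - w) *\<^sub>R (f u - f w))"
    by simp
  then have "(w - u) *\<^sub>R (f w - f v) = (v - w) *\<^sub>R (f u - f w)"
    using \<open>c > 0\<close> by (metis less_irrefl scaleR_cancel_left)
  then show ?thesis by (simp add: algebra_simps)
qed

lemma extremal_lipschitz_image:
  fixes f :: "real \<Rightarrow> 'a::euclidean_space"
  assumes iso: "\<And>s t. u \<le> s \<Longrightarrow> s \<le> t \<Longrightarrow> t \<le> v \<Longrightarrow> dist (f s) (f t) \<le> c * (t - s)"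
    and ends: "dist (f u) (f v) = c * (v - u)" and "c > 0" "u \<le> v"
  shows "f ` {u..v} = closed_segment (f u) (f v)"
proof (cases "u = v")
  case False
  then have uv: "u < v" using assms by auto
  have w: "f w = (1 - (w - u) / (v - u)) *\<^sub>R f u + ((w - u) / (v - u)) *\<^sub>R f v"
    if "u \<le> w" "w \<le> v" for w
  proof -
    have "(v - u) * (1 - (w - u) / (v - u)) = v - w" "(v - u) * ((w - u) / (v - u)) = w - u"
      using uv by (auto simp: field_simps)
    then have "(v - u) *\<^sub>R f w = (v - u) *\<^sub>R ((1 - (w - u) / (v - u)) *\<^sub>R f u + ((w - u) / (v - u)) *\<^sub>R f v)"
      using extremal_lipschitz_affine[of u v f c w] assms that
      by (simp only: scaleR_add_right scaleR_scaleR)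
    then show ?thesis using uv by (metis eq_iff_diff_eq_0 less_irrefl scaleR_cancel_left)
  qed
  have "\<exists>z\<in>{u..v}. x = f z" if "x \<in> closed_segment (f u) (f v)" for x
  proof -
    obtain k where k: "0 \<le> k" "k \<le> 1" "x = (1 - k) *\<^sub>R f u + k *\<^sub>R f v"
      using \<open>x \<in> _\<close> by (auto simp: closed_segment_def)
    have "u + k * (v - u) \<le> u + 1 * (v - u)"
      using k uv by (intro add_left_mono mult_right_mono) auto
    then have "u \<le> u + k * (v - u)" "u + k * (v - u) \<le> v"
      using k uv by simp_all
    then show ?thesis
      using w[of "u + k * (v - u)"] k uv by (intro bexI[of _ "u + k * (v - u)"]) auto
  qed
  moreover have "f w \<in> closed_segment (f u) (f v)" if "u \<le> w" "w \<le> v" for w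
    unfolding w[OF that] closed_segment_def using uv that
    by (auto intro!: exI[of _ "(w - u) / (v - u)"])
  ultimately show ?thesis by auto
qed auto

definition straight_at ::
    "complex set set \<Rightarrow> (complex \<Rightarrow> 'a) \<Rightarrow> (real \<Rightarrow> 'a) \<Rightarrow> real \<Rightarrow> real \<Rightarrow> real \<Rightarrow> complex \<Rightarrow> bool" where
  "straight_at F q \<gamma> a b t m \<longleftrightarrow>
     (\<forall>\<epsilon>>0. \<exists>\<delta>>0. \<exists>x y. dist x y = \<delta> \<and> midpoint x y = m \<and>
           closed_segment x y \<subseteq> \<Union>F \<inter> q -` (\<gamma> ` ({t - \<epsilon><..<t + \<epsilon>} \<inter> {a..b})))"

lemma straight_atI:
  assumes "0 < d" "a \<le> t - d" "t + d \<le> b" "c > 0"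
    and lift: "\<And>w. w \<in> {t - d..t + d} \<Longrightarrow> \<sigma> w \<in> \<Union>F \<and> q (\<sigma> w) = \<gamma> w"
    and left: "\<And>u v. t - d \<le> u \<Longrightarrow> u \<le> v \<Longrightarrow> v \<le> t \<Longrightarrow> dist (\<sigma> u) (\<sigma> v) = c * (v - u)"
    and right: "\<And>u v. t \<le> u \<Longrightarrow> u \<le> v \<Longrightarrow> v \<le> t + d \<Longrightarrow> dist (\<sigma> u) (\<sigma> v) = c * (v - u)"
    and mid: "\<And>e. 0 < e \<Longrightarrow> e \<le> d \<Longrightarrow> midpoint (\<sigma> (t - e)) (\<sigma> (t + e)) = \<sigma> t"
  shows "straight_at F q \<gamma> a b t (\<sigma> t)"
  unfolding straight_at_def
proof (intro allI impI)
  fix \<epsilon> :: real assume "\<epsilon> > 0"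
  define e where "e = min d (\<epsilon> / 2)"
  have e: "0 < e" "e \<le> d" "e < \<epsilon>"
    using \<open>\<epsilon> > 0\<close> \<open>0 < d\<close> by (auto simp: e_def min_def)
  let ?x = "\<sigma> (t - e)" and ?y = "\<sigma> (t + e)"
  have m: "midpoint ?x ?y = \<sigma> t" by (rule mid) (use e in auto)
  have "closed_segment ?x ?y = closed_segment ?x (\<sigma> t) \<union> closed_segment (\<sigma> t) ?y"
    by (rule Un_closed_segment[symmetric]) (metis m midpoint_in_closed_segment)
  also have "closed_segment ?x (\<sigma> t) = \<sigma> ` {t - e..t}"
    by (rule extremal_lipschitz_image[symmetric, where c = c]) (use e \<open>c > 0\<close> in \<open>auto simp: left\<close>)
  also have "closed_segment (\<sigma> t) ?y = \<sigma> ` {t..t + e}"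
    by (rule extremal_lipschitz_image[symmetric, where c = c]) (use e \<open>c > 0\<close> in \<open>auto simp: right\<close>)
  finally have "closed_segment ?x ?y = \<sigma> ` ({t - e..t} \<union> {t..t + e})"
    by (simp add: image_Un)
  also have "\<dots> \<subseteq> \<Union>F \<inter> q -` (\<gamma> ` ({t - \<epsilon><..<t + \<epsilon>} \<inter> {a..b}))"
    using lift e assms(1-3) by fastforce
  finally have seg: "closed_segment ?x ?y \<subseteq> \<Union>F \<inter> q -` (\<gamma> ` ({t - \<epsilon><..<t + \<epsilon>} \<inter> {a..b}))" .
  have "dist ?x (\<sigma> t) = c * e"
    using left[of "t - e" t] e by simp
  then have "?x \<noteq> ?y"
    using m e \<open>c > 0\<close> by auto
  then show "\<exists>\<delta>>0. \<exists>x y. dist x y = \<delta> \<and> midpoint x y = \<sigma> t \<and>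
           closed_segment x y \<subseteq> \<Union>F \<inter> q -` (\<gamma> ` ({t - \<epsilon><..<t + \<epsilon>} \<inter> {a..b}))"
    using seg m by (metis zero_less_dist_iff)
qed

locale shortest_path =
  fixes S :: "(real^3) set" and \<gamma> :: "real \<Rightarrow> real^3" and a b c :: real
  assumes minimal: "minimal_path S \<gamma> a b" and distinct: "\<gamma> a \<noteq> \<gamma> b"
    and speed: "\<And>u v. a \<le> u \<Longrightarrow> u \<le> v \<Longrightarrow> v \<le> b \<Longrightarrow> arc_length \<gamma> u v = ennreal (c * (v - u))"
    and c_nonneg: "0 \<le> c"
begin

lemma ab: "a < b" and continuous: "continuous_on {a..b} \<gamma>" and in_S: "\<gamma> ` {a..b} \<subseteq> S"
  using minimal by (auto simp: minimal_path_def path_on_def)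

lemma lipschitz: "a \<le> u \<Longrightarrow> u \<le> v \<Longrightarrow> v \<le> b \<Longrightarrow> dist (\<gamma> u) (\<gamma> v) \<le> c * (v - u)"
  using dist_le_arc_length[of u v \<gamma>] c_nonneg by (simp add: speed ennreal_le_iff)

lemma c_pos: "0 < c"
  using lipschitz[of a b] ab distinct c_nonneg by (cases "c = 0") auto

lemma joinable_self:
  assumes "a \<le> u" "u \<le> v" "v \<le> b"
  shows "joinable S (\<gamma> u) (\<gamma> v) (c * (v - u))"
proof -
  have w: "u + x / c \<in> {a..b}" if "0 \<le> x" "x \<le> c * (v - u)" for x
  proof -
    have "0 \<le> x / c" "x / c \<le> v - u"
      using c_pos that by (auto simp: field_simps)
    then show ?thesis using assms by auto
  qed
  have "dist (\<gamma> (u + x / c)) (\<gamma> (u + y / c)) \<le> y - x" if "0 \<le> x" "x \<le> y" "y \<le> c * (v - u)" for x y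
  proof -
    have "u + x / c \<le> u + y / c" "c * ((u + y / c) - (u + x / c)) = y - x"
      using that c_pos by (auto simp: divide_right_mono right_diff_distrib)
    then show ?thesis
      using lipschitz[of "u + x / c" "u + y / c"] w[of x] w[of y] that by auto
  qed
  then show ?thesis
    unfolding joinable_def using assms c_pos w in_S
    by (intro conjI exI[of _ "\<lambda>x. \<gamma> (u + x / c)"]) auto
qed

lemma shortest:
  assumes "a \<le> u" "u \<le> v" "v \<le> b" "joinable S (\<gamma> u) (\<gamma> v) L"
  shows "c * (v - u) \<le> L"
proof -
  define T where "T = c * (u - a) + L + c * (b - v)"
  have J: "joinable S (\<gamma> a) (\<gamma> b) T"
    unfolding T_def using assms
    by (intro joinable_trans[OF joinable_trans[OF joinable_self assms(4)] joinable_self]) auto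
  then obtain \<beta> where \<beta>: "\<beta> 0 = \<gamma> a" "\<beta> T = \<gamma> b" "\<beta> ` {0..T} \<subseteq> S"
    and lip: "\<And>x y. 0 \<le> x \<Longrightarrow> x \<le> y \<Longrightarrow> y \<le> T \<Longrightarrow> dist (\<beta> x) (\<beta> y) \<le> y - x"
    unfolding joinable_def by blast
  have "0 < dist (\<gamma> a) (\<gamma> b)" using distinct by simp
  then have "T > 0" using joinable_dist_le[OF J] by linarith
  have "dist (\<beta> x) (\<beta> y) \<le> dist x y" if "x \<in> {0..T}" "y \<in> {0..T}" for x y
    using lip[of x y] lip[of y x] that by (cases x y rule: le_cases) (auto simp: dist_real_def dist_commute)
  then have "short_on {0..T} \<beta>" by (simp add: short_on_def)
  then have "path_on S \<beta> 0 T"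
    using short_on_continuous \<open>T > 0\<close> \<beta>(3) by (auto simp: path_on_def)
  then have "arc_length \<gamma> a b \<le> arc_length \<beta> 0 T"
    using minimal \<beta> unfolding minimal_path_def by blast
  also have "\<dots> \<le> ennreal (1 * (T - 0))"
    by (rule arc_length_le_lipschitz) (use lip in auto)
  finally have "c * (b - a) \<le> T"
    using speed[of a b] ab \<open>T > 0\<close> c_pos by (simp add: ennreal_le_iff)
  then show ?thesis by (simp add: T_def algebra_simps)
qed

lemma lift_isometric:
  fixes C :: "complex set"
  assumes t: "a \<le> t\<^sub>1" "t\<^sub>2 \<le> b"
    and C: "convex C" "short_on C q" "q ` C \<subseteq> S" "\<And>x. x \<in> C \<Longrightarrow> nearly_isometric_at C q x"
    and \<sigma>: "continuous_on {t\<^sub>1..t\<^sub>2} \<sigma>" "\<And>w. w \<in> {t\<^sub>1..t\<^sub>2} \<Longrightarrow> \<sigma> w \<in> C \<and> q (\<sigma> w) = \<gamma> w"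
    and uv: "t\<^sub>1 \<le> u" "u \<le> v" "v \<le> t\<^sub>2"
  shows "dist (\<sigma> u) (\<sigma> v) = c * (v - u)"
proof (rule antisym)
  have "ennreal (dist (\<sigma> u) (\<sigma> v)) \<le> arc_length (q \<circ> \<sigma>) u v"
    using continuous_on_subset[OF \<sigma>(1), of "{u..v}"] uv \<sigma>(2) C(4)
    by (intro dist_le_arc_length_nearly_isometric[where R = C]) auto
  also have "\<dots> = arc_length \<gamma> u v"
    by (rule arc_length_cong) (use uv \<sigma>(2) in auto)
  finally show "dist (\<sigma> u) (\<sigma> v) \<le> c * (v - u)"
    using speed[of u v] t uv c_nonneg by (simp add: ennreal_le_iff)
  have "joinable S (q (\<sigma> u)) (q (\<sigma> v)) (dist (\<sigma> u) (\<sigma> v))"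
    using \<sigma>(2) uv C by (intro joinable_segment[where R = C] closed_segment_subset) auto
  then show "c * (v - u) \<le> dist (\<sigma> u) (\<sigma> v)"
    using shortest[of u v] t uv \<sigma>(2)[of u] \<sigma>(2)[of v] by auto
qed

lemma near_time:
  assumes "t \<in> {a<..<b}" "0 < \<rho>"
  obtains d where "0 < d" "a \<le> t - d" "t + d \<le> b" "\<And>w. w \<in> {t - d..t + d} \<Longrightarrow> \<gamma> w \<in> S \<inter> ball (\<gamma> t) \<rho>"
proof -
  define d where "d = min (min (t - a) (b - t)) (\<rho> / (2 * c))"
  have d: "0 < d" "a \<le> t - d" "t + d \<le> b" "c * d < \<rho>"
  proof -
    have "c * d \<le> c * (\<rho> / (2 * c))"
      using c_pos by (intro mult_left_mono) (auto simp: d_def)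
    also have "\<dots> < \<rho>" using c_pos assms by simp
    finally show "c * d < \<rho>" .
  qed (use assms c_pos in \<open>auto simp: d_def\<close>)
  have "\<gamma> w \<in> S \<inter> ball (\<gamma> t) \<rho>" if w: "w \<in> {t - d..t + d}" for w
  proof -
    have "dist (\<gamma> t) (\<gamma> w) \<le> c * \<bar>w - t\<bar>"
      using lipschitz[of t w] lipschitz[of w t] w d assms(1)
      by (cases "t \<le> w") (auto simp: dist_commute)
    also have "\<dots> \<le> c * d" using w c_pos by (intro mult_left_mono) auto
    finally show ?thesis using d w in_S by auto
  qed
  with d show ?thesis using that by blast
qed

lemma straight_at_regular_point:
  assumes t: "t \<in> {a<..<b}" and "\<rho> > 0"
    and C: "convex C" "short_on C q" "q ` C \<subseteq> S" "\<And>x. x \<in> C \<Longrightarrow> nearly_isometric_at C q x"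
    and "C \<subseteq> \<Union>F"
    and \<kappa>: "continuous_on (S \<inter> ball (\<gamma> t) \<rho>) \<kappa>" "\<And>p. p \<in> S \<inter> ball (\<gamma> t) \<rho> \<Longrightarrow> \<kappa> p \<in> C \<and> q (\<kappa> p) = p"
  shows "straight_at F q \<gamma> a b t (\<kappa> (\<gamma> t))"
proof -
  obtain d where d: "0 < d" "a \<le> t - d" "t + d \<le> b" "\<And>w. w \<in> {t - d..t + d} \<Longrightarrow> \<gamma> w \<in> S \<inter> ball (\<gamma> t) \<rho>"
    using near_time[OF t \<open>\<rho> > 0\<close>] by blast
  have cont: "continuous_on {t - d..t + d} (\<kappa> \<circ> \<gamma>)"
    using continuous_on_subset[OF continuous, of "{t - d..t + d}"] d \<kappa>(1)
    by (intro continuous_on_compose continuous_on_subset[OF \<kappa>(1)]) auto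
  have iso: "dist ((\<kappa> \<circ> \<gamma>) u) ((\<kappa> \<circ> \<gamma>) v) = c * (v - u)"
    if "t - d \<le> u" "u \<le> v" "v \<le> t + d" for u v
    by (rule lift_isometric[OF d(2,3) C cont]) (use \<kappa>(2) d(4) that in auto)
  have lift: "(\<kappa> \<circ> \<gamma>) w \<in> \<Union>F \<and> q ((\<kappa> \<circ> \<gamma>) w) = \<gamma> w" if "w \<in> {t - d..t + d}" for w
    using \<kappa>(2)[OF d(4)[OF that]] \<open>C \<subseteq> \<Union>F\<close> by auto
  have "straight_at F q \<gamma> a b t ((\<kappa> \<circ> \<gamma>) t)"
  proof (rule straight_atI[where d = d and c = c])
    fix e assume e: "0 < e" "e \<le> d"
    have "(2 * e) *\<^sub>R (\<kappa> \<circ> \<gamma>) t = e *\<^sub>R (\<kappa> \<circ> \<gamma>) (t - e) + e *\<^sub>R (\<kappa> \<circ> \<gamma>) (t + e)"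
      using extremal_lipschitz_affine[of "t - e" "t + e" "\<kappa> \<circ> \<gamma>" c t] iso e c_pos by auto
    then have "e *\<^sub>R (2 *\<^sub>R (\<kappa> \<circ> \<gamma>) t) = e *\<^sub>R ((\<kappa> \<circ> \<gamma>) (t - e) + (\<kappa> \<circ> \<gamma>) (t + e))"
      by (simp add: scaleR_add_right mult.commute)
    then have "2 *\<^sub>R (\<kappa> \<circ> \<gamma>) t = (\<kappa> \<circ> \<gamma>) (t - e) + (\<kappa> \<circ> \<gamma>) (t + e)"
      using e by (metis less_irrefl scaleR_cancel_left)
    then show "midpoint ((\<kappa> \<circ> \<gamma>) (t - e)) ((\<kappa> \<circ> \<gamma>) (t + e)) = (\<kappa> \<circ> \<gamma>) t"
      unfolding midpoint_def by (metis inverse_eq_divide divideR_right zero_neq_numeral)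
  qed (use d lift iso c_pos in auto)
  then show ?thesis by simp
qed

end

section \<open>Crossing a rim\<close>

text \<open>
  The functions \<open>d\<^sub>1\<close> and \<open>d\<^sub>2\<close> follow the rim in the two regions, so the length of the competing
  path through the rim point at arc length \<open>\<epsilon>\<close> has a local minimum at \<open>\<epsilon> = 0\<close>.
\<close>
lemma snell:
  fixes x y m n :: complex
  assumes n: "norm n = 1" and X: "(x - m) \<bullet> n < 0" and Y: "(y - m) \<bullet> n > 0"
    and eq: "dist x m = dist y m"
    and rim: "(d\<^sub>1 has_vector_derivative \<i> * n) (at (0::real))" "d\<^sub>1 0 = m"
      "(d\<^sub>2 has_vector_derivative \<i> * n) (at 0)" "d\<^sub>2 0 = m"
    and "0 < e"
    and minimal: "\<And>\<epsilon>. \<bar>\<epsilon>\<bar> < e \<Longrightarrow> dist x m + dist y m \<le> dist x (d\<^sub>1 \<epsilon>) + dist y (d\<^sub>2 \<epsilon>)"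
  shows "midpoint x y = m"
proof -
  have ne: "d\<^sub>1 0 - x \<noteq> 0" "d\<^sub>2 0 - y \<noteq> 0"
    using X Y rim by auto
  define f where "f = (\<lambda>\<epsilon>. norm (d\<^sub>1 \<epsilon> - x) + norm (d\<^sub>2 \<epsilon> - y))"
  define D where "D = (\<i> * n) \<bullet> sgn (d\<^sub>1 0 - x) + (\<i> * n) \<bullet> sgn (d\<^sub>2 0 - y)"
  have norm_deriv: "((\<lambda>\<epsilon>. norm (g \<epsilon> - z)) has_derivative (\<lambda>h. (h *\<^sub>R (\<i> * n)) \<bullet> sgn (g 0 - z))) (at 0)"
    if "(g has_vector_derivative \<i> * n) (at 0)" "g 0 - z \<noteq> 0" for g z
  proof -
    have "((\<lambda>\<epsilon>. g \<epsilon> - z) has_derivative (\<lambda>h. h *\<^sub>R (\<i> * n))) (at 0)"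
      using that(1) unfolding has_vector_derivative_def by (auto intro!: derivative_eq_intros)
    from has_derivative_compose[OF this has_derivative_norm[OF that(2)]] show ?thesis
      by (simp add: inner_commute)
  qed
  have "(f has_derivative (\<lambda>h. (h *\<^sub>R (\<i> * n)) \<bullet> sgn (d\<^sub>1 0 - x) + (h *\<^sub>R (\<i> * n)) \<bullet> sgn (d\<^sub>2 0 - y))) (at 0)"
    unfolding f_def by (intro has_derivative_add norm_deriv rim ne)
  moreover have "(\<lambda>h. (h *\<^sub>R (\<i> * n)) \<bullet> sgn (d\<^sub>1 0 - x) + (h *\<^sub>R (\<i> * n)) \<bullet> sgn (d\<^sub>2 0 - y)) = (*) D"
    by (auto simp: D_def algebra_simps)
  ultimately have "DERIV f 0 :> D"
    by (simp add: has_field_derivative_def)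
  moreover have "\<forall>\<epsilon>. \<bar>0 - \<epsilon>\<bar> < e \<longrightarrow> f 0 \<le> f \<epsilon>"
    using minimal rim by (auto simp: f_def dist_norm norm_minus_commute)
  ultimately have "D = 0"
    using \<open>0 < e\<close> by (intro DERIV_local_min)
  moreover have "D = - ((\<i> * n) \<bullet> (x - m) + (\<i> * n) \<bullet> (y - m)) / dist x m"
    using eq rim unfolding D_def sgn_div_norm
    by (simp add: dist_norm norm_minus_commute inner_diff_right divide_inverse algebra_simps)
  ultimately have T: "(\<i> * n) \<bullet> (x - m) + (\<i> * n) \<bullet> (y - m) = 0"
    using ne rim by auto
  define p q u v where "p = Re n" "q = Im n" "u = x - m" "v = y - m"
  have n1: "p\<^sup>2 + q\<^sup>2 = 1"
    using n unfolding p_q_u_v_def cmod_def by simp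
  have "(Re u)\<^sup>2 + (Im u)\<^sup>2 = (Re v)\<^sup>2 + (Im v)\<^sup>2"
    using eq unfolding p_q_u_v_def dist_norm cmod_def by simp
  moreover have "(Re w)\<^sup>2 + (Im w)\<^sup>2 = (Re w * p + Im w * q)\<^sup>2 + (Im w * p - Re w * q)\<^sup>2" for w
  proof -
    have "(Re w * p + Im w * q)\<^sup>2 + (Im w * p - Re w * q)\<^sup>2 = ((Re w)\<^sup>2 + (Im w)\<^sup>2) * (p\<^sup>2 + q\<^sup>2)"
      by (simp add: power2_eq_square algebra_simps)
    then show ?thesis using n1 by simp
  qed
  moreover have t: "Im u * p - Re u * q = - (Im v * p - Re v * q)"
    using T by (simp add: inner_complex_def p_q_u_v_def algebra_simps)
  ultimately have "(Re u * p + Im u * q)\<^sup>2 = (Re v * p + Im v * q)\<^sup>2"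
    by (simp add: power2_commute[of "Im v * p"])
  moreover have s: "Re u * p + Im u * q < 0" "Re v * p + Im v * q > 0"
    using X Y by (simp_all add: inner_complex_def p_q_u_v_def)
  ultimately have r: "Re u * p + Im u * q = - (Re v * p + Im v * q)"
    by (auto simp: power2_eq_iff)
  have "Re (u + v) * (p\<^sup>2 + q\<^sup>2) = (Re u * p + Im u * q + (Re v * p + Im v * q)) * p -
      (Im u * p - Re u * q + (Im v * p - Re v * q)) * q"
    by (simp add: power2_eq_square algebra_simps)
  moreover have "Im (u + v) * (p\<^sup>2 + q\<^sup>2) = (Re u * p + Im u * q + (Re v * p + Im v * q)) * q +
      (Im u * p - Re u * q + (Im v * p - Re v * q)) * p"
    by (simp add: power2_eq_square algebra_simps)
  ultimately have "u + v = 0"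
    using r t n1 by (simp add: complex_eq_iff)
  then have "x + y = 2 * m"
    by (simp add: p_q_u_v_def algebra_simps)
  then show ?thesis
    by (simp add: midpoint_def scaleR_conv_of_real)
qed

lemma rim_derivatives:
  fixes c d :: complex
  shows "((\<lambda>\<epsilon>. c + of_real \<epsilon> * d) has_vector_derivative d) (at 0)"
    and "((\<lambda>\<epsilon>. c + d * cis (k * \<epsilon>)) has_vector_derivative of_real k * \<i> * d) (at 0)"
  unfolding has_vector_derivative_def
  by (auto intro!: derivative_eq_intros simp: scaleR_conv_of_real algebra_simps)

context shortest_path
begin

lemma joinable_isometric_image:
  fixes D :: "complex set"
  assumes D: "convex D" "q ` D \<subseteq> S" and iso: "\<And>x y. x \<in> D \<Longrightarrow> y \<in> D \<Longrightarrow> dist (q x) (q y) = dist x y"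
    and xy: "x \<in> D" "y \<in> D"
  shows "joinable S (q x) (q y) (dist x y)"
  using D xy iso by (intro joinable_segment[of D] closed_segment_subset) (auto simp: short_on_def)

lemma isometric_chord:
  fixes D :: "complex set"
  assumes D: "convex D" "q ` D \<subseteq> S" "convex (q ` D)"
    and iso: "\<And>x y. x \<in> D \<Longrightarrow> y \<in> D \<Longrightarrow> dist (q x) (q y) = dist x y"
    and uv: "a \<le> u" "u \<le> v" "v \<le> b" "\<gamma> u \<in> q ` D" "\<gamma> v \<in> q ` D"
  shows "dist (\<gamma> u) (\<gamma> v) = c * (v - u)" and "\<gamma> ` {u..v} \<subseteq> q ` D"
proof -
  obtain x y where xy: "x \<in> D" "y \<in> D" "\<gamma> u = q x" "\<gamma> v = q y"
    using uv by auto
  have "c * (v - u) \<le> dist x y"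
    using joinable_isometric_image[OF D(1,2) iso xy(1,2)] xy uv by (intro shortest) auto
  then show eq: "dist (\<gamma> u) (\<gamma> v) = c * (v - u)"
    using lipschitz[of u v] uv xy iso[of x y] by auto
  have "\<gamma> ` {u..v} = closed_segment (\<gamma> u) (\<gamma> v)"
    using uv eq c_pos lipschitz by (intro extremal_lipschitz_image) auto
  then show "\<gamma> ` {u..v} \<subseteq> q ` D"
    using closed_segment_subset[OF uv(4,5) D(3)] by simp
qed

text \<open>
  The set \<open>C\<close> is the part near the rim of the side, and the disk \<open>D\<close> is tangent to \<open>C\<close> at \<open>m\<close>.
  Since \<open>q ` D\<close> is convex in space, the times at which the path is in the lid form an interval.
\<close>
lemma straight_at_rim_point:
  fixes C D :: "complex set" and q :: "complex \<Rightarrow> real^3"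
  assumes t: "t \<in> {a<..<b}" and "\<rho> > 0" and n: "norm n = 1" and m: "\<gamma> t = q m"
    and C: "convex C" "short_on C q" "q ` C \<subseteq> S" "\<And>x. x \<in> C \<Longrightarrow> nearly_isometric_at C q x"
      "C \<subseteq> \<Union>F" "m \<in> C" "\<And>x. x \<in> C \<Longrightarrow> q x \<notin> q ` D \<Longrightarrow> (x - m) \<bullet> n < 0"
    and D: "convex D" "q ` D \<subseteq> S" "convex (q ` D)"
      "D \<subseteq> \<Union>F" "m \<in> D" "\<And>x. x \<in> D \<Longrightarrow> x \<noteq> m \<Longrightarrow> (x - m) \<bullet> n > 0"
    and D_iso: "\<And>x y. x \<in> D \<Longrightarrow> y \<in> D \<Longrightarrow> dist (q x) (q y) = dist x y"
    and N: "S \<inter> ball (\<gamma> t) \<rho> - q ` D \<subseteq> N" "\<gamma> t \<in> N"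
    and \<kappa>: "continuous_on N \<kappa>" "\<And>p. p \<in> N \<Longrightarrow> \<kappa> p \<in> C \<and> q (\<kappa> p) = p" "\<kappa> (\<gamma> t) = m"
    and rim: "(d\<^sub>1 has_vector_derivative \<i> * n) (at (0::real))" "d\<^sub>1 0 = m"
      "(d\<^sub>2 has_vector_derivative \<i> * n) (at 0)" "d\<^sub>2 0 = m"
    and "0 < e\<^sub>0"
    and glue: "\<And>\<epsilon>. \<bar>\<epsilon>\<bar> < e\<^sub>0 \<Longrightarrow> d\<^sub>1 \<epsilon> \<in> C \<and> d\<^sub>2 \<epsilon> \<in> D \<and> q (d\<^sub>1 \<epsilon>) = q (d\<^sub>2 \<epsilon>)"
  shows "straight_at F q \<gamma> a b t m"
proof -
  obtain d where d: "0 < d" "a \<le> t - d" "t + d \<le> b" "\<And>w. w \<in> {t - d..t + d} \<Longrightarrow> \<gamma> w \<in> S \<inter> ball (\<gamma> t) \<rho>"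
    using near_time[OF t \<open>\<rho> > 0\<close>] by blast
  note chord = isometric_chord[OF D(1-3) D_iso]
  have P: "\<gamma> t \<in> q ` D" using m D by auto
  define \<iota> where "\<iota> = inv_into D q"
  have \<iota>: "\<iota> p \<in> D" "q (\<iota> p) = p" if "p \<in> q ` D" for p
    using that by (auto simp: \<iota>_def inv_into_into f_inv_into_f)
  have inj: "x = y" if "x \<in> D" "y \<in> D" "q x = q y" for x y
    using D_iso[OF that(1,2)] that(3) by simp
  have \<iota>m: "\<iota> (\<gamma> t) = m"
    using inj[of "\<iota> (\<gamma> t)" m] \<iota>[OF P] m D by auto
  have \<iota>_iso: "dist (\<iota> (\<gamma> u)) (\<iota> (\<gamma> v)) = c * (v - u)"
    if "a \<le> u" "u \<le> v" "v \<le> b" "\<gamma> u \<in> q ` D" "\<gamma> v \<in> q ` D" for u v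
    using chord(1)[OF _ _ that] D_iso[OF \<iota>(1)[OF that(4)] \<iota>(1)[OF that(5)]] \<iota>(2) that by auto
  have \<kappa>_iso: "dist (\<kappa> (\<gamma> u)) (\<kappa> (\<gamma> v)) = c * (v - u)"
    if "a \<le> t\<^sub>1" "t\<^sub>2 \<le> b" "\<gamma> ` {t\<^sub>1..t\<^sub>2} \<subseteq> N" "t\<^sub>1 \<le> u" "u \<le> v" "v \<le> t\<^sub>2" for t\<^sub>1 t\<^sub>2 u v
  proof -
    have cont: "continuous_on {t\<^sub>1..t\<^sub>2} (\<kappa> \<circ> \<gamma>)"
      using continuous_on_subset[OF continuous, of "{t\<^sub>1..t\<^sub>2}"] that \<kappa>(1)
      by (intro continuous_on_compose continuous_on_subset[OF \<kappa>(1)]) auto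
    have lift: "(\<kappa> \<circ> \<gamma>) w \<in> C \<and> q ((\<kappa> \<circ> \<gamma>) w) = \<gamma> w" if "w \<in> {t\<^sub>1..t\<^sub>2}" for w
      using \<kappa>(2)[of "\<gamma> w"] \<open>\<gamma> ` {t\<^sub>1..t\<^sub>2} \<subseteq> N\<close> that by (auto simp: image_subset_iff)
    show ?thesis
      using lift_isometric[OF that(1,2) C(1-4) cont lift that(4-6)] by simp
  qed
  have cross: "midpoint x y = m"
    if xy: "x \<in> C" "y \<in> D" "dist x m = c * e" "dist y m = c * e" "q x \<notin> q ` D" "0 < e" "e \<le> d"
      and ends: "{\<gamma> (t - e), \<gamma> (t + e)} = {q x, q y}" for x y e
  proof (rule snell[OF n _ _ _ rim \<open>0 < e\<^sub>0\<close>])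
    show "(x - m) \<bullet> n < 0" by (rule C(7)) (use that in auto)
    show "(y - m) \<bullet> n > 0" by (rule D(6)) (use that c_pos in auto)
    show "dist x m = dist y m" using xy by simp
    fix \<epsilon> :: real assume \<epsilon>: "\<bar>\<epsilon>\<bar> < e\<^sub>0"
    have "joinable S (q x) (q (d\<^sub>1 \<epsilon>)) (dist x (d\<^sub>1 \<epsilon>))"
      using glue[OF \<epsilon>] xy C by (intro joinable_segment[of C] closed_segment_subset) auto
    moreover have "joinable S (q (d\<^sub>1 \<epsilon>)) (q y) (dist (d\<^sub>2 \<epsilon>) y)"
      using joinable_isometric_image[OF D(1,2) D_iso, of "d\<^sub>2 \<epsilon>" y] glue[OF \<epsilon>] xy by simp
    ultimately have "joinable S (q x) (q y) (dist x (d\<^sub>1 \<epsilon>) + dist y (d\<^sub>2 \<epsilon>))"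
      using joinable_trans by (fastforce simp: dist_commute)
    then have "joinable S (\<gamma> (t - e)) (\<gamma> (t + e)) (dist x (d\<^sub>1 \<epsilon>) + dist y (d\<^sub>2 \<epsilon>))"
      using ends joinable_sym by (fastforce simp: doubleton_eq_iff)
    then have "c * (t + e - (t - e)) \<le> dist x (d\<^sub>1 \<epsilon>) + dist y (d\<^sub>2 \<epsilon>)"
      using d xy by (intro shortest) auto
    then show "dist x m + dist y m \<le> dist x (d\<^sub>1 \<epsilon>) + dist y (d\<^sub>2 \<epsilon>)"
      using xy by (simp add: algebra_simps)
  qed
  define A where "A \<longleftrightarrow> (\<exists>u. a \<le> u \<and> u < t \<and> \<gamma> u \<in> q ` D)"
  define B where "B \<longleftrightarrow> (\<exists>v. t < v \<and> v \<le> b \<and> \<gamma> v \<in> q ` D)"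
  have N_left: "\<gamma> ` {t - d..t} \<subseteq> N" if "\<not> A"
  proof
    fix p assume "p \<in> \<gamma> ` {t - d..t}"
    then obtain w where w: "w \<in> {t - d..t}" "p = \<gamma> w" by auto
    then have "p \<in> S \<inter> ball (\<gamma> t) \<rho>" "w \<noteq> t \<Longrightarrow> p \<notin> q ` D"
      using that d unfolding A_def by auto
    then show "p \<in> N" using N w(2) by (cases "w = t") blast+
  qed
  have N_right: "\<gamma> ` {t..t + d} \<subseteq> N" if "\<not> B"
  proof
    fix p assume "p \<in> \<gamma> ` {t..t + d}"
    then obtain w where w: "w \<in> {t..t + d}" "p = \<gamma> w" by auto
    then have "p \<in> S \<inter> ball (\<gamma> t) \<rho>" "w \<noteq> t \<Longrightarrow> p \<notin> q ` D"
      using that d unfolding B_def by auto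
    then show "p \<in> N" using N w(2) by (cases "w = t") blast+
  qed
  consider "A" "B" | "A" "\<not> B" | "\<not> A" "B" | "\<not> A" "\<not> B" by blast
  then show ?thesis
  proof cases
    case 1
    then obtain u v where uv: "a \<le> u" "u < t" "\<gamma> u \<in> q ` D" "t < v" "v \<le> b" "\<gamma> v \<in> q ` D"
      unfolding A_def B_def by blast
    have "\<iota> (\<gamma> u) \<noteq> m" "\<iota> (\<gamma> v) \<noteq> m"
      using \<iota>_iso[of u t] \<iota>_iso[of t v] uv P \<iota>m c_pos by auto
    then have pos: "(\<iota> (\<gamma> u) - m) \<bullet> n > 0" "(\<iota> (\<gamma> v) - m) \<bullet> n > 0"
      using D(6) \<iota> uv by auto
    have in_D: "\<gamma> w \<in> q ` D" if "u \<le> w" "w \<le> v" for w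
      using chord(2)[of u v] uv that by auto
    have "(v - u) *\<^sub>R \<iota> (\<gamma> t) = (v - t) *\<^sub>R \<iota> (\<gamma> u) + (t - u) *\<^sub>R \<iota> (\<gamma> v)"
      using uv \<iota>_iso in_D c_pos by (intro extremal_lipschitz_affine) auto
    then have "((v - u) *\<^sub>R m) \<bullet> n = ((v - t) *\<^sub>R \<iota> (\<gamma> u) + (t - u) *\<^sub>R \<iota> (\<gamma> v)) \<bullet> n"
      unfolding \<iota>m by simp
    then have "(v - t) * ((\<iota> (\<gamma> u) - m) \<bullet> n) + (t - u) * ((\<iota> (\<gamma> v) - m) \<bullet> n) = 0"
      by (simp add: inner_add_left inner_diff_left algebra_simps)
    moreover have "(v - t) * ((\<iota> (\<gamma> u) - m) \<bullet> n) > 0" "(t - u) * ((\<iota> (\<gamma> v) - m) \<bullet> n) > 0"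
      using uv pos by auto
    ultimately show ?thesis by linarith
  next
    case 2
    then obtain u where u: "a \<le> u" "u < t" "\<gamma> u \<in> q ` D"
      unfolding A_def by blast
    define d' where "d' = min d (t - u)"
    have d': "0 < d'" "d' \<le> d" "u \<le> t - d'" using d u by (auto simp: d'_def)
    have L: "\<gamma> w \<in> q ` D" if "u \<le> w" "w \<le> t" for w
      using chord(2)[of u t] u t P that by auto
    define \<sigma> where "\<sigma> w = (if w \<le> t then \<iota> (\<gamma> w) else \<kappa> (\<gamma> w))" for w
    have \<sigma>: "\<sigma> w = \<iota> (\<gamma> w)" if "w \<le> t" for w using that by (simp add: \<sigma>_def)
    have \<sigma>': "\<sigma> w = \<kappa> (\<gamma> w)" if "t \<le> w" for w using that \<iota>m \<kappa>(3) by (auto simp: \<sigma>_def)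
    have R: "\<gamma> w \<in> N" if "t \<le> w" "w \<le> t + d" for w
      using N_right[OF 2(2)] that by auto
    have "straight_at F q \<gamma> a b t (\<sigma> t)"
    proof (rule straight_atI[where d = d' and c = c])
      fix e assume e: "0 < e" "e \<le> d'"
      have "midpoint (\<sigma> (t + e)) (\<sigma> (t - e)) = m"
      proof (rule cross[where e = e])
        show "dist (\<sigma> (t + e)) m = c * e"
          using \<kappa>_iso[of t "t + d" t "t + e"] N_right[OF 2(2)] t d d' e \<kappa>(3)
          by (simp add: \<sigma>' dist_commute)
        show "dist (\<sigma> (t - e)) m = c * e"
          using \<iota>_iso[of "t - e" t] L[of "t - e"] P t u d' e \<iota>m by (simp add: \<sigma>)
        show "q (\<sigma> (t + e)) \<notin> q ` D"
          using 2(2) \<kappa>(2)[OF R[of "t + e"]] d d' e unfolding B_def by (auto simp: \<sigma>')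
        show "{\<gamma> (t - e), \<gamma> (t + e)} = {q (\<sigma> (t + e)), q (\<sigma> (t - e))}"
          using \<iota>(2)[OF L[of "t - e"]] \<kappa>(2)[OF R[of "t + e"]] e d' by (auto simp: \<sigma> \<sigma>')
        show "\<sigma> (t + e) \<in> C" "\<sigma> (t - e) \<in> D"
          using \<iota>(1)[OF L[of "t - e"]] \<kappa>(2)[OF R[of "t + e"]] e d' by (auto simp: \<sigma> \<sigma>')
      qed (use e d' in auto)
      then show "midpoint (\<sigma> (t - e)) (\<sigma> (t + e)) = \<sigma> t"
        by (simp add: \<sigma> \<iota>m midpoint_sym)
    next
      fix w assume "w \<in> {t - d'..t + d'}"
      then show "\<sigma> w \<in> \<Union>F \<and> q (\<sigma> w) = \<gamma> w"
        using \<iota>[OF L[of w]] \<kappa>(2)[OF R[of w]] d' C(5) D(4) by (cases "w \<le> t") (auto simp: \<sigma> \<sigma>')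
    next
      fix v w assume "t - d' \<le> v" "v \<le> w" "w \<le> t"
      then show "dist (\<sigma> v) (\<sigma> w) = c * (w - v)"
        using \<iota>_iso[of v w] L[of v] L[of w] d' u t by (simp add: \<sigma>)
    next
      fix v w assume "t \<le> v" "v \<le> w" "w \<le> t + d'"
      then show "dist (\<sigma> v) (\<sigma> w) = c * (w - v)"
        using \<kappa>_iso[of t "t + d" v w] N_right[OF 2(2)] d' t d by (simp add: \<sigma>')
    qed (use d d' c_pos in auto)
    then show ?thesis by (simp add: \<sigma> \<iota>m)
  next
    case 3
    then obtain u where u: "t < u" "u \<le> b" "\<gamma> u \<in> q ` D"
      unfolding B_def by blast
    define d' where "d' = min d (u - t)"
    have d': "0 < d'" "d' \<le> d" "t + d' \<le> u" using d u by (auto simp: d'_def)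
    have L: "\<gamma> w \<in> q ` D" if "t \<le> w" "w \<le> u" for w
      using chord(2)[of t u] u t P that by auto
    define \<sigma> where "\<sigma> w = (if w \<ge> t then \<iota> (\<gamma> w) else \<kappa> (\<gamma> w))" for w
    have \<sigma>: "\<sigma> w = \<iota> (\<gamma> w)" if "t \<le> w" for w using that by (simp add: \<sigma>_def)
    have \<sigma>': "\<sigma> w = \<kappa> (\<gamma> w)" if "w \<le> t" for w using that \<iota>m \<kappa>(3) by (auto simp: \<sigma>_def)
    have R: "\<gamma> w \<in> N" if "t - d \<le> w" "w \<le> t" for w
      using N_left[OF 3(1)] that by auto
    have "straight_at F q \<gamma> a b t (\<sigma> t)"
    proof (rule straight_atI[where d = d' and c = c])
      fix e assume e: "0 < e" "e \<le> d'"
      have "midpoint (\<sigma> (t - e)) (\<sigma> (t + e)) = m"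
      proof (rule cross[where e = e])
        show "dist (\<sigma> (t - e)) m = c * e"
          using \<kappa>_iso[of "t - d" t "t - e" t] N_left[OF 3(1)] t d d' e \<kappa>(3)
          by (simp add: \<sigma>')
        show "dist (\<sigma> (t + e)) m = c * e"
          using \<iota>_iso[of t "t + e"] L[of "t + e"] P t u d' e \<iota>m by (simp add: \<sigma> dist_commute)
        show "q (\<sigma> (t - e)) \<notin> q ` D"
          using 3(1) \<kappa>(2)[OF R[of "t - e"]] d d' e unfolding A_def by (auto simp: \<sigma>')
        show "{\<gamma> (t - e), \<gamma> (t + e)} = {q (\<sigma> (t - e)), q (\<sigma> (t + e))}"
          using \<iota>(2)[OF L[of "t + e"]] \<kappa>(2)[OF R[of "t - e"]] e d' by (auto simp: \<sigma> \<sigma>')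
        show "\<sigma> (t - e) \<in> C" "\<sigma> (t + e) \<in> D"
          using \<iota>(1)[OF L[of "t + e"]] \<kappa>(2)[OF R[of "t - e"]] e d' by (auto simp: \<sigma> \<sigma>')
      qed (use e d' in auto)
      then show "midpoint (\<sigma> (t - e)) (\<sigma> (t + e)) = \<sigma> t"
        by (simp add: \<sigma> \<iota>m)
    next
      fix w assume "w \<in> {t - d'..t + d'}"
      then show "\<sigma> w \<in> \<Union>F \<and> q (\<sigma> w) = \<gamma> w"
        using \<iota>[OF L[of w]] \<kappa>(2)[OF R[of w]] d' C(5) D(4) by (cases "t \<le> w") (auto simp: \<sigma> \<sigma>')
    next
      fix v w assume "t \<le> v" "v \<le> w" "w \<le> t + d'"
      then show "dist (\<sigma> v) (\<sigma> w) = c * (w - v)"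
        using \<iota>_iso[of v w] L[of v] L[of w] d' u t by (simp add: \<sigma>)
    next
      fix v w assume "t - d' \<le> v" "v \<le> w" "w \<le> t"
      then show "dist (\<sigma> v) (\<sigma> w) = c * (w - v)"
        using \<kappa>_iso[of "t - d" t v w] N_left[OF 3(1)] d' t d by (simp add: \<sigma>')
    qed (use d d' c_pos in auto)
    then show ?thesis by (simp add: \<sigma> \<iota>m)
  next
    case 4
    have "{t - d..t + d} = {t - d..t} \<union> {t..t + d}" using d by auto
    then have N4: "\<gamma> ` {t - d..t + d} \<subseteq> N"
      using N_left[OF 4(1)] N_right[OF 4(2)] by (simp add: image_Un)
    define x y where "x = \<kappa> (\<gamma> (t - d))" "y = \<kappa> (\<gamma> (t + d))"
    have "((t + d) - (t - d)) *\<^sub>R \<kappa> (\<gamma> t) = ((t + d) - t) *\<^sub>R \<kappa> (\<gamma> (t - d)) + (t - (t - d)) *\<^sub>R \<kappa> (\<gamma> (t + d))"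
      using \<kappa>_iso[OF d(2,3) N4] c_pos d(1) by (intro extremal_lipschitz_affine) auto
    then have "d *\<^sub>R (2 *\<^sub>R m) = d *\<^sub>R (x + y)"
      by (simp add: \<kappa>(3) x_y_def scaleR_add_right mult.commute)
    then have "2 *\<^sub>R m = x + y"
      using d(1) by (metis less_irrefl scaleR_cancel_left)
    then have "(x - m) + (y - m) = 0"
      by (simp add: scaleR_2 algebra_simps)
    then have "(x - m) \<bullet> n + (y - m) \<bullet> n = 0"
      by (metis inner_add_left inner_zero_left)
    moreover have "x \<in> C" "q x = \<gamma> (t - d)" "y \<in> C" "q y = \<gamma> (t + d)"
      unfolding x_y_def using \<kappa>(2)[of "\<gamma> (t - d)"] \<kappa>(2)[of "\<gamma> (t + d)"] N4 d(1)
      by (auto simp: image_subset_iff)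
    moreover have "\<gamma> (t - d) \<notin> q ` D" "\<gamma> (t + d) \<notin> q ` D"
      using 4 d unfolding A_def B_def by auto
    ultimately have False
      using C(7)[of x] C(7)[of y] by auto
    then show ?thesis ..
  qed
qed

end

section \<open>The surfaces in complex coordinates\<close>

definition at_height :: "complex \<Rightarrow> real \<Rightarrow> real^3" where
  "at_height \<zeta> z = vector [Re \<zeta>, Im \<zeta>, z]"

definition horiz :: "real^3 \<Rightarrow> complex" where
  "horiz p = Complex (p $ 1) (p $ 2)"

lemma horiz_at_height [simp]: "horiz (at_height \<zeta> z) = \<zeta>"
  and height_at_height [simp]: "at_height \<zeta> z $ 3 = z"
  by (simp_all add: horiz_def at_height_def)

lemma at_height_horiz [simp]: "at_height (horiz p) (p $ 3) = p"
  by (simp add: horiz_def at_height_def vec_eq_iff forall_3)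

lemma at_height_eq_iff [simp]: "at_height \<zeta> z = at_height \<zeta>' z' \<longleftrightarrow> \<zeta> = \<zeta>' \<and> z = z'"
  by (metis horiz_at_height height_at_height)

lemma linear_horiz: "linear horiz"
  by (rule linearI) (simp_all add: horiz_def complex_eq_iff)

lemma continuous_on_horiz [continuous_intros]: "continuous_on A horiz"
  using linear_horiz by (rule linear_continuous_on_compose[OF continuous_on_id, simplified])

lemma cyl_eq_at_height: "cyl r \<theta> z = at_height (rcis r \<theta>) z"
  by (simp add: cyl_def at_height_def)

lemma dist_at_height:
  "dist (at_height \<zeta> z) (at_height \<zeta>' z') = sqrt ((dist \<zeta> \<zeta>')\<^sup>2 + (z - z')\<^sup>2)"
proof -
  have "(\<Sum>i\<in>UNIV. (dist (at_height \<zeta> z $ i) (at_height \<zeta>' z' $ i))\<^sup>2) = (dist \<zeta> \<zeta>')\<^sup>2 + (z - z')\<^sup>2"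
    by (simp add: sum_3 at_height_def dist_real_def dist_norm cmod_power2)
  then show ?thesis by (simp add: dist_vec_def L2_set_def)
qed

lemma rcis_representation: "\<exists>\<theta>. \<zeta> = rcis (norm \<zeta>) \<theta>"
  by (metis rcis_cmod_Arg)

lemma horizontal_disk_eq: "horizontal_disk z = {p. norm (horiz p) \<le> 1 \<and> p $ 3 = z}"
proof safe
  fix p assume "p \<in> horizontal_disk z"
  then show "norm (horiz p) \<le> 1" "p $ 3 = z"
    by (auto simp: horizontal_disk_def cyl_eq_at_height)
next
  fix p :: "real^3" assume "norm (horiz p) \<le> 1" "z = p $ 3"
  moreover obtain \<theta> where "horiz p = rcis (norm (horiz p)) \<theta>"
    using rcis_representation by blast
  then have "p = cyl (norm (horiz p)) \<theta> (p $ 3)"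
    by (metis at_height_horiz cyl_eq_at_height)
  ultimately show "p \<in> horizontal_disk (p $ 3)"
    unfolding horizontal_disk_def by fastforce
qed

lemma can_side_eq: "can_side h = {p. norm (horiz p) = 1 \<and> 0 \<le> p $ 3 \<and> p $ 3 \<le> h}"
proof safe
  fix p assume "p \<in> can_side h"
  then show "norm (horiz p) = 1" "0 \<le> p $ 3" "p $ 3 \<le> h"
    by (auto simp: can_side_def cyl_eq_at_height)
next
  fix p :: "real^3" assume "norm (horiz p) = 1" "0 \<le> p $ 3" "p $ 3 \<le> h"
  moreover obtain \<theta> where "horiz p = rcis (norm (horiz p)) \<theta>"
    using rcis_representation by blast
  then have "p = cyl (norm (horiz p)) \<theta> (p $ 3)"
    by (metis at_height_horiz cyl_eq_at_height)
  ultimately show "p \<in> can_side h"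
    unfolding can_side_def by auto
qed

lemma cup_side_eq:
  assumes "0 < \<phi>" "\<phi> < pi / 2"
  shows "cup_side \<phi> = {p. norm (horiz p) = p $ 3 * tan \<phi> \<and> 0 \<le> p $ 3 \<and> p $ 3 \<le> cot \<phi>}"
proof safe
  have "0 < tan \<phi>" using assms by (intro tan_gt_zero)
  fix p assume "p \<in> cup_side \<phi>"
  then show "norm (horiz p) = p $ 3 * tan \<phi>" "0 \<le> p $ 3" "p $ 3 \<le> cot \<phi>"
    using \<open>0 < tan \<phi>\<close> by (auto simp: cup_side_def cyl_eq_at_height)
next
  fix p :: "real^3" assume "norm (horiz p) = p $ 3 * tan \<phi>" "0 \<le> p $ 3" "p $ 3 \<le> cot \<phi>"
  moreover obtain \<theta> where "horiz p = rcis (norm (horiz p)) \<theta>"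
    using rcis_representation by blast
  then have "p = cyl (norm (horiz p)) \<theta> (p $ 3)"
    by (metis at_height_horiz cyl_eq_at_height)
  ultimately show "p \<in> cup_side \<phi>"
    unfolding cup_side_def by auto
qed

lemma dist_horiz_le: "dist (horiz p) (horiz p') \<le> dist p p'"
  using dist_at_height[of "horiz p" "p $ 3" "horiz p'" "p' $ 3"]
  by (simp add: real_le_rsqrt)

lemma dist_height_le: "\<bar>p $ 3 - p' $ 3\<bar> \<le> dist p (p' :: real^3)"
  using dist_vec_nth_le[of p 3 p'] by (simp add: dist_real_def)

lemma convex_horizontal_disk: "convex (horizontal_disk z)"
proof -
  have "horizontal_disk z = horiz -` cball 0 1 \<inter> (\<lambda>p. p $ 3) -` {z}"
    by (auto simp: horizontal_disk_eq)
  moreover have "linear (\<lambda>p::real^3. p $ 3)"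
    by (rule linearI) auto
  ultimately show ?thesis
    by (simp add: convex_Int convex_linear_vimage linear_horiz)
qed

lemma Arg_rcis_abs: "0 < r \<Longrightarrow> \<bar>t\<bar> < pi \<Longrightarrow> Arg (rcis r t) = t"
  by (intro Arg_rcis) auto

lemma cis_diff_Arg: "\<zeta> * cis (- g) = rcis (norm \<zeta>) (Arg \<zeta> - g)"
  using rcis_cmod_Arg[of \<zeta>] by (metis cis_mult diff_conv_add_uminus mult.assoc rcis_def)

lemma cis_Arg_shift:
  assumes "norm \<zeta> = 1"
  shows "cis (Arg (\<zeta> * cis (- g)) + g) = \<zeta>"
proof -
  have "cis (Arg (\<zeta> * cis (- g))) = \<zeta> * cis (- g)"
    using rcis_cmod_Arg[of "\<zeta> * cis (- g)"] assms by (simp add: norm_mult rcis_def)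
  then show ?thesis
    by (simp add: cis_mult mult.assoc flip: cis_mult[of "Arg _" g])
qed

lemma Re_near_direction:
  assumes "norm (\<zeta> - rcis r g) < r"
  shows "0 < Re (\<zeta> * cis (- g))"
proof -
  have "\<zeta> * cis (- g) - of_real r = (\<zeta> - rcis r g) * cis (- g)"
    by (simp add: algebra_simps rcis_def cis_mult)
  then have "norm (\<zeta> * cis (- g) - of_real r) < r"
    using assms by (simp add: norm_mult)
  then show ?thesis
    using abs_Re_le_cmod[of "\<zeta> * cis (- g) - of_real r"] by auto
qed

lemma norm_rcis_diff:
  "(norm (rcis r \<alpha> - rcis s \<beta>))\<^sup>2 = (r - s)\<^sup>2 + 4 * r * s * (sin ((\<alpha> - \<beta>) / 2))\<^sup>2"
proof -
  have 1: "(cos \<theta>)\<^sup>2 = 1 - (sin \<theta>)\<^sup>2" for \<theta> :: real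
    by (simp add: cos_squared_eq)
  have "2 * ((\<alpha> - \<beta>) / 2) = \<alpha> - \<beta>"
    by (simp add: field_simps)
  then have c: "cos (\<alpha> - \<beta>) = 1 - 2 * (sin ((\<alpha> - \<beta>) / 2))\<^sup>2"
    by (metis cos_double_sin)
  have "(norm (rcis r \<alpha> - rcis s \<beta>))\<^sup>2 = r\<^sup>2 + s\<^sup>2 - 2 * r * s * cos (\<alpha> - \<beta>)"
    unfolding cmod_power2 cos_diff by (simp add: power2_diff power_mult_distrib 1 algebra_simps)
  then show ?thesis
    unfolding c by (simp add: power2_diff algebra_simps)
qed

lemma rcis_segment:
  assumes "0 \<le> r"
  shows "closed_segment 0 (rcis r t) = {rcis u t | u. 0 \<le> u \<and> u \<le> r}"
proof (cases "r = 0")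
  case True
  then show ?thesis by auto
next
  case False
  then have r: "r > 0" using assms by simp
  show ?thesis
  proof (intro equalityI subsetI)
    fix w assume "w \<in> closed_segment 0 (rcis r t)"
    then obtain u where u: "0 \<le> u" "u \<le> 1" "w = rcis (u * r) t"
      by (auto simp: closed_segment_def scaleR_conv_of_real rcis_def mult.assoc)
    then show "w \<in> {rcis u t | u. 0 \<le> u \<and> u \<le> r}"
      using r mult_right_mono[of u 1 r] by auto
  next
    fix w assume "w \<in> {rcis u t | u. 0 \<le> u \<and> u \<le> r}"
    then obtain u where u: "0 \<le> u" "u \<le> r" "w = rcis u t" by auto
    then have "w = (u / r) *\<^sub>R rcis r t" using r by (simp add: rcis_def scaleR_conv_of_real)
    then show "w \<in> closed_segment 0 (rcis r t)"
      unfolding closed_segment_def using u r by (auto intro!: exI[of _ "u / r"])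
  qed
qed

lemma sin_near_zero_ge:
  assumes "k < (1::real)"
  shows "\<exists>\<delta>>0. \<forall>x. \<bar>x\<bar> < \<delta> \<longrightarrow> k * \<bar>x\<bar> \<le> \<bar>sin x\<bar>"
proof -
  have "((\<lambda>h. (sin (0 + h) - sin 0) / h) \<longlongrightarrow> cos (0::real)) (at 0)"
    using DERIV_sin[of "0::real"] unfolding DERIV_def by simp
  then have "\<forall>\<^sub>F x in at (0::real). k < sin x / x"
    using assms by (simp add: order_tendsto_iff)
  then obtain \<delta> where \<delta>: "\<delta> > 0" "\<And>x. x \<noteq> 0 \<Longrightarrow> \<bar>x\<bar> < \<delta> \<Longrightarrow> k < sin x / x"
    unfolding eventually_at by (auto simp: dist_real_def)
  have "k * \<bar>x\<bar> \<le> \<bar>sin x\<bar>" if "\<bar>x\<bar> < \<delta>" for x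
  proof (cases "x = 0")
    case False
    have "k < \<bar>sin x\<bar> / \<bar>x\<bar>"
      using \<delta>(2)[OF False that] abs_ge_self[of "sin x / x"] by (simp add: abs_divide)
    then show ?thesis using False by (simp add: pos_less_divide_eq)
  qed simp
  then show ?thesis using \<delta>(1) by blast
qed

lemma sin_mult_ge:
  assumes k: "0 < k" "k \<le> 1" and x: "0 \<le> x" "x \<le> pi"
  shows "k * sin x \<le> sin (k * x)"
proof -
  define f where "f x = sin (k * x) - k * sin x" for x
  have "f 0 \<le> f x"
  proof (rule DERIV_nonneg_imp_nondecreasing[OF x(1)])
    fix y assume y: "0 \<le> y" "y \<le> x"
    have "(f has_real_derivative k * (cos (k * y) - cos y)) (at y)"
      unfolding f_def by (auto intro!: derivative_eq_intros simp: algebra_simps)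
    moreover have "cos y \<le> cos (k * y)"
      using y k x mult_right_mono[of k 1 y] by (intro cos_monotone_0_pi_le) auto
    ultimately show "\<exists>D. (f has_real_derivative D) (at y) \<and> 0 \<le> D"
      using k by auto
  qed
  then show ?thesis by (simp add: f_def)
qed

lemma cis_eq_imp_eq:
  assumes "cis x = cis y" "\<bar>x - y\<bar> < 2 * pi"
  shows "x = y"
proof -
  have "sin x = sin y \<and> cos x = cos y"
    using assms(1) by (metis cis.sel)
  then obtain n :: int where n: "x = y + 2 * pi * n"
    using sin_cos_eq_iff[of x y] by (auto simp: algebra_simps)
  then have "\<bar>real_of_int n\<bar> < 1"
    using assms(2) by (simp add: abs_mult)
  then show ?thesis using n by simp
qed


lemma tangent_disk:
  fixes m n w :: complex
  assumes "norm n = 1" "dist (m + n) w \<le> 1"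
  shows "(w - m) \<bullet> n \<ge> 0" and "(w - m) \<bullet> n = 0 \<Longrightarrow> w = m"
proof -
  define v where "v = w - m"
  have n: "n \<bullet> n = 1" using assms(1) by (simp add: dot_square_norm)
  have "norm (v - n) \<le> 1"
    using assms(2) by (simp add: v_def dist_norm norm_minus_commute algebra_simps)
  then have "(v - n) \<bullet> (v - n) \<le> 1"
    by (simp add: dot_square_norm power_le_one)
  then have "v \<bullet> v \<le> 2 * (v \<bullet> n)"
    using n by (simp add: inner_diff_left inner_diff_right inner_commute)
  moreover have "0 \<le> v \<bullet> v" "v \<noteq> 0 \<Longrightarrow> 0 < v \<bullet> v"
    by simp_all
  ultimately have "0 \<le> v \<bullet> n" "v \<noteq> 0 \<Longrightarrow> 0 < v \<bullet> n"
    by linarith+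
  then show "(w - m) \<bullet> n \<ge> 0" "(w - m) \<bullet> n = 0 \<Longrightarrow> w = m"
    unfolding v_def by auto
qed


section \<open>Flat decompositions\<close>

lemma flat_decompositionI:
  assumes "finite F" and region: "\<And>R. R \<in> F \<Longrightarrow> plane_region R" and S: "q ` \<Union>F = S"
    and short: "\<And>R. R \<in> F \<Longrightarrow> short_on R q"
    and near: "\<And>R x. R \<in> F \<Longrightarrow> x \<in> R \<Longrightarrow> x \<noteq> p \<Longrightarrow> nearly_isometric_at R q x"
    and radial: "\<And>R x. R \<in> F \<Longrightarrow> x \<in> R \<Longrightarrow> p \<in> R \<Longrightarrow> dist (q x) (q p) = dist x p"
    and inj: "\<And>R x y. R \<in> F \<Longrightarrow> x \<in> interior R \<Longrightarrow> y \<in> \<Union>F \<Longrightarrow> q y = q x \<Longrightarrow> y = x"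
  shows "flat_decomposition S F q"
proof -
  have compact: "compact R" if "R \<in> F" for R
    using region[OF that] by (simp add: plane_region_def)
  have "continuous_on (\<Union>R\<in>F. R) q"
    using \<open>finite F\<close> compact short
    by (intro continuous_on_closed_Union compact_imp_closed short_on_continuous)
  then have cont: "continuous_on (\<Union>F) q" by simp
  have "compact (\<Union>F)"
    using \<open>finite F\<close> compact by (rule compact_Union)
  then have "quotient_map (top_of_set (\<Union>F)) (top_of_set S) q"
    using cont S by (intro T1_Spaces.continuous_imp_quotient_map)
      (auto simp: compact_space_subtopology Hausdorff_space_subtopology)
  moreover have "arc_length (q \<circ> \<gamma>) a b = arc_length \<gamma> a b" if "R \<in> F" "path_on R \<gamma> a b" for R \<gamma> a b
    by (rule arc_length_nearly_isometric[OF that(2) short[OF that(1)] near[OF that(1)] radial[OF that(1)]])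
  ultimately show ?thesis
    unfolding flat_decomposition_def using assms(1) region inj by blast
qed

lemma not_interior_limit:
  fixes f :: "real \<Rightarrow> complex"
  assumes "isCont f 0" "0 < d" "\<And>\<delta>. 0 < \<delta> \<Longrightarrow> \<delta> < d \<Longrightarrow> f \<delta> \<notin> R"
  shows "f 0 \<notin> interior R"
proof
  assume "f 0 \<in> interior R"
  moreover have "(f \<longlongrightarrow> f 0) (at_right 0)"
    using assms(1) by (simp add: isCont_def tendsto_mono[OF at_le[OF subset_UNIV]])
  ultimately have "\<forall>\<^sub>F \<delta> in at_right 0. f \<delta> \<in> interior R"
    by (rule topological_tendstoD[OF _ open_interior, rotated])
  moreover have "\<forall>\<^sub>F \<delta> in at_right 0. \<delta> \<in> {0<..<d}"
    by (rule eventually_at_right_real[OF \<open>0 < d\<close>])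
  ultimately have "\<forall>\<^sub>F \<delta> in at_right (0::real). False"
    by eventually_elim (use assms(3) interior_subset in fastforce)
  then show False by simp
qed

lemma plane_region_cball:
  assumes "r > 0"
  shows "plane_region (cball c r)"
  unfolding plane_region_def
proof (intro conjI exI[of _ "circlepath c r"])
  show "simply_connected (cball c r)"
    by (simp add: convex_imp_simply_connected)
  show "simple_path (circlepath c r)"
    using assms by (simp add: simple_path_circlepath)
qed (use assms in auto)

lemma plane_region_cbox:
  assumes "Re u < Re v" "Im u < Im v"
  shows "plane_region (cbox u v)"
  unfolding plane_region_def
proof (intro conjI exI[of _ "rectpath u v"])
  show "simply_connected (cbox u v)"
    by (intro convex_imp_simply_connected convex_box)
  have "box u v \<noteq> {}"
    using assms by (auto simp: box_eq_empty Basis_complex_def)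
  then show "path_image (rectpath u v) = frontier (cbox u v)"
    using assms by (simp add: path_image_rectpath_cbox_minus_box frontier_cbox)
qed (use assms in auto)


section \<open>The soup can\<close>

definition can_side_map :: "real \<Rightarrow> complex \<Rightarrow> real^3" where
  "can_side_map g w = at_height (cis (Re w + g)) (Im w)"

definition can_lid_map :: "real \<Rightarrow> real \<Rightarrow> complex \<Rightarrow> real^3" where
  "can_lid_map h g w = at_height (\<i> * (w - Complex 0 (h + 1)) * cis g) h"

definition can_base_map :: "real \<Rightarrow> complex \<Rightarrow> real^3" where
  "can_base_map g w = at_height (cnj (- \<i> * (w - Complex 0 (- 1))) * cis g) 0"

text \<open>
  The side is unrolled from the ruling at angle \<open>g\<close> in both directions, and both disks are
  tangent to the rectangle at the ends of that ruling.
\<close>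
definition can_map :: "real \<Rightarrow> real \<Rightarrow> complex \<Rightarrow> real^3" where
  "can_map h g w =
     (if h < Im w then can_lid_map h g w
      else if Im w < 0 then can_base_map g w else can_side_map g w)"

definition can_rect :: "real \<Rightarrow> complex set" where
  "can_rect h = cbox (Complex (- pi) 0) (Complex pi h)"

definition can_lid :: "real \<Rightarrow> complex set" where
  "can_lid h = cball (Complex 0 (h + 1)) 1"

definition can_base :: "complex set" where
  "can_base = cball (Complex 0 (- 1)) 1"

lemma mem_can_rect: "w \<in> can_rect h \<longleftrightarrow> \<bar>Re w\<bar> \<le> pi \<and> 0 \<le> Im w \<and> Im w \<le> h"
  by (auto simp: can_rect_def in_cbox_complex_iff)

lemma dist_can_side_map:
  "dist (can_side_map g x) (can_side_map g y) =
     sqrt (4 * (sin ((Re x - Re y) / 2))\<^sup>2 + (Im x - Im y)\<^sup>2)"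
  using norm_rcis_diff[of 1 "Re x + g" 1 "Re y + g"]
  by (simp add: can_side_map_def dist_at_height dist_norm[where 'a = complex] cis_rcis_eq)

lemma short_can_side_map: "short_on UNIV (can_side_map g)"
  unfolding short_on_def
proof (intro ballI)
  fix x y :: complex
  have "\<bar>sin ((Re x - Re y) / 2)\<bar> \<le> \<bar>(Re x - Re y) / 2\<bar>"
    by (rule abs_sin_x_le_abs_x)
  then have "(sin ((Re x - Re y) / 2))\<^sup>2 \<le> ((Re x - Re y) / 2)\<^sup>2"
    by (simp only: abs_le_square_iff)
  then show "dist (can_side_map g x) (can_side_map g y) \<le> dist x y"
    unfolding dist_can_side_map dist_norm[where 'a = complex] cmod_def
    by (simp add: power_divide)
qed

lemma nearly_isometric_can_side_map: "nearly_isometric_at UNIV (can_side_map g) x"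
  unfolding nearly_isometric_at_def
proof (intro allI impI)
  fix k :: real assume "k < 1"
  define k' where "k' = max k 0"
  have k': "k \<le> k'" "0 \<le> k'" "k' < 1" using \<open>k < 1\<close> by (auto simp: k'_def)
  obtain \<delta> where \<delta>: "\<delta> > 0" "\<And>x. \<bar>x\<bar> < \<delta> \<Longrightarrow> k' * \<bar>x\<bar> \<le> \<bar>sin x\<bar>"
    using sin_near_zero_ge[OF k'(3)] by blast
  have "k * dist y z \<le> dist (can_side_map g y) (can_side_map g z)"
    if "y \<in> ball x \<delta>" "z \<in> ball x \<delta>" for y z
  proof -
    have "dist y z < 2 * \<delta>"
      using that dist_triangle_half_r[of x y "2 * \<delta>" z] by (simp add: dist_commute)
    then have "\<bar>(Re y - Re z) / 2\<bar> < \<delta>"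
      using abs_Re_le_cmod[of "y - z"] by (simp add: dist_norm)
    from \<delta>(2)[OF this] have "(k' * \<bar>(Re y - Re z) / 2\<bar>)\<^sup>2 \<le> \<bar>sin ((Re y - Re z) / 2)\<bar>\<^sup>2"
      using k' by (intro power_mono) auto
    then have "k'\<^sup>2 * (Re y - Re z)\<^sup>2 \<le> 4 * (sin ((Re y - Re z) / 2))\<^sup>2"
      by (simp add: power_mult_distrib power_divide)
    moreover have "k'\<^sup>2 * (Im y - Im z)\<^sup>2 \<le> (Im y - Im z)\<^sup>2"
      using k' by (simp add: mult_left_le_one_le power_le_one)
    ultimately have "k'\<^sup>2 * ((Re y - Re z)\<^sup>2 + (Im y - Im z)\<^sup>2) \<le>
        4 * (sin ((Re y - Re z) / 2))\<^sup>2 + (Im y - Im z)\<^sup>2"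
      by (simp add: distrib_left)
    then have "sqrt (k'\<^sup>2 * ((Re y - Re z)\<^sup>2 + (Im y - Im z)\<^sup>2)) \<le>
        dist (can_side_map g y) (can_side_map g z)"
      unfolding dist_can_side_map by (rule real_sqrt_le_mono)
    then have "k' * dist y z \<le> dist (can_side_map g y) (can_side_map g z)"
      using k' by (simp add: real_sqrt_mult dist_norm cmod_def)
    then show ?thesis
      using k' mult_right_mono[of k k' "dist y z"] by auto
  qed
  then show "\<exists>\<delta>>0. \<forall>y\<in>UNIV \<inter> ball x \<delta>. \<forall>z\<in>UNIV \<inter> ball x \<delta>.
      k * dist y z \<le> dist (can_side_map g y) (can_side_map g z)"
    using \<delta>(1) by auto
qed

lemma dist_can_lid_map: "dist (can_lid_map h g x) (can_lid_map h g y) = dist x y"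
proof -
  have "\<i> * (x - c) * cis g - \<i> * (y - c) * cis g = \<i> * (x - y) * cis g" for c
    by (simp add: algebra_simps)
  then show ?thesis
    by (simp add: can_lid_map_def dist_at_height dist_norm[where 'a = complex] norm_mult)
qed

lemma dist_can_base_map: "dist (can_base_map g x) (can_base_map g y) = dist x y"
proof -
  have "cnj (- \<i> * (x - c)) * cis g - cnj (- \<i> * (y - c)) * cis g = cnj (- \<i> * (x - y)) * cis g" for c
    by (simp add: algebra_simps)
  then show ?thesis
    by (simp only: can_base_map_def dist_at_height dist_norm[where 'a = complex])
      (simp add: norm_mult del: complex_cnj_mult complex_cnj_diff)
qed

lemma can_lid_above:
  assumes "w \<in> can_lid h"
  shows "h \<le> Im w" and "Im w = h \<Longrightarrow> w = Complex 0 h"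
proof -
  have "Complex 0 h + \<i> = Complex 0 (h + 1)" by (simp add: complex_eq_iff)
  then have "dist (Complex 0 h + \<i>) w \<le> 1"
    using assms by (simp add: can_lid_def)
  from tangent_disk[OF _ this] show "h \<le> Im w" "Im w = h \<Longrightarrow> w = Complex 0 h"
    by (auto simp: inner_complex_def)
qed

lemma can_base_below:
  assumes "w \<in> can_base"
  shows "Im w \<le> 0" and "Im w = 0 \<Longrightarrow> w = 0"
proof -
  have "0 + - \<i> = Complex 0 (- 1)" by (simp add: complex_eq_iff)
  then have "dist (0 + - \<i>) w \<le> 1"
    using assms by (metis can_base_def mem_cball)
  from tangent_disk[OF _ this] show "Im w \<le> 0" "Im w = 0 \<Longrightarrow> w = 0"
    by (auto simp: inner_complex_def)
qed

lemma can_map_rect: "w \<in> can_rect h \<Longrightarrow> can_map h g w = can_side_map g w"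
  by (simp add: can_map_def mem_can_rect)

lemma can_map_lid:
  assumes "h > 0" "w \<in> can_lid h"
  shows "can_map h g w = can_lid_map h g w"
proof (cases "Im w = h")
  case True
  with can_lid_above[OF assms(2)] have [simp]: "w = Complex 0 h" by simp
  have "\<i> * (Complex 0 h - Complex 0 (h + 1)) = 1" by (simp add: complex_eq_iff)
  then show ?thesis
    using assms(1) by (simp add: can_map_def can_side_map_def can_lid_map_def)
next
  case False
  with can_lid_above[OF assms(2)] show ?thesis by (simp add: can_map_def)
qed

lemma can_map_base:
  assumes "h > 0" "w \<in> can_base"
  shows "can_map h g w = can_base_map g w"
proof (cases "Im w = 0")
  case True
  with can_base_below[OF assms(2)] have [simp]: "w = 0" by simp
  have "- \<i> * (0 - Complex 0 (- 1)) = 1" by (simp add: complex_eq_iff)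
  then show ?thesis
    using assms(1) by (simp add: can_map_def can_side_map_def can_base_map_def)
next
  case False
  with can_base_below[OF assms(2)] assms(1) show ?thesis by (simp add: can_map_def)
qed

lemma can_map_image_rect:
  "can_map h g ` can_rect h = can_side h"
proof safe
  fix w assume "w \<in> can_rect h"
  then show "can_map h g w \<in> can_side h"
    by (simp add: can_map_rect can_side_map_def can_side_eq) (simp add: mem_can_rect)
next
  fix p assume "p \<in> can_side h"
  then have p: "norm (horiz p) = 1" "0 \<le> p $ 3" "p $ 3 \<le> h"
    by (auto simp: can_side_eq)
  define w where "w = Complex (Arg (horiz p * cis (- g))) (p $ 3)"
  have "w \<in> can_rect h"
    using p Arg_bounded[of "horiz p * cis (- g)"] by (auto simp: w_def mem_can_rect)
  moreover have "can_side_map g w = p"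
    using p by (simp add: can_side_map_def w_def cis_Arg_shift)
  ultimately show "p \<in> can_map h g ` can_rect h"
    by (metis can_map_rect image_eqI)
qed

lemma can_map_image_lid:
  assumes "h > 0"
  shows "can_map h g ` can_lid h = horizontal_disk h"
proof safe
  fix w assume w: "w \<in> can_lid h"
  then show "can_map h g w \<in> horizontal_disk h"
    using assms by (simp add: can_map_lid can_lid_map_def horizontal_disk_eq norm_mult)
      (simp add: can_lid_def dist_norm norm_minus_commute)
next
  fix p assume p: "p \<in> horizontal_disk h"
  define w where "w = Complex 0 (h + 1) - \<i> * horiz p * cis (- g)"
  have "w \<in> can_lid h"
    using p by (simp add: w_def can_lid_def horizontal_disk_eq dist_norm norm_mult)
  moreover have "\<i> * (w - Complex 0 (h + 1)) * cis g = horiz p"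
    by (simp add: w_def algebra_simps cis_mult)
  then have "can_lid_map h g w = p"
    using p by (simp add: can_lid_map_def horizontal_disk_eq) (metis at_height_horiz)
  ultimately show "p \<in> can_map h g ` can_lid h"
    using can_map_lid[OF assms] by (metis image_eqI)
qed

lemma can_map_image_base:
  assumes "h > 0"
  shows "can_map h g ` can_base = horizontal_disk 0"
proof safe
  fix w assume w: "w \<in> can_base"
  then show "can_map h g w \<in> horizontal_disk 0"
    using assms by (simp add: can_map_base can_base_map_def horizontal_disk_eq norm_mult del: complex_cnj_mult complex_cnj_diff)
      (simp add: can_base_def dist_norm norm_minus_commute)
next
  fix p assume p: "p \<in> horizontal_disk 0"
  define w where "w = Complex 0 (- 1) + \<i> * cnj (horiz p * cis (- g))"
  have "w \<in> can_base"
    using p by (simp add: w_def can_base_def horizontal_disk_eq dist_norm norm_mult)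
  moreover have "cnj (- \<i> * (w - Complex 0 (- 1))) * cis g = horiz p"
    by (simp add: w_def algebra_simps cis_mult cis_cnj)
  then have "can_base_map g w = p"
    using p by (simp add: can_base_map_def horizontal_disk_eq) (metis at_height_horiz)
  ultimately show "p \<in> can_map h g ` can_base"
    using can_map_base[OF assms] by (metis image_eqI)
qed

lemma plane_region_can_rect: "h > 0 \<Longrightarrow> plane_region (can_rect h)"
  unfolding can_rect_def by (rule plane_region_cbox) auto

lemma can_map_height:
  assumes "h > 0" "w \<in> can_lid h \<union> can_rect h \<union> can_base"
  shows "can_map h g w $ 3 = max 0 (min h (Im w))"
  using assms(2)
proof (elim UnE)
  assume w: "w \<in> can_lid h"
  then show ?thesis
    using assms(1) can_lid_above[OF w] by (simp add: can_map_lid can_lid_map_def)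
next
  assume w: "w \<in> can_base"
  then show ?thesis
    using assms(1) can_base_below[OF w] by (simp add: can_map_base can_base_map_def)
next
  assume w: "w \<in> can_rect h"
  then show ?thesis
    by (simp add: can_map_rect can_side_map_def) (simp add: mem_can_rect)
qed

lemma can_side_map_inj:
  assumes "can_side_map g y = can_side_map g x" "\<bar>Re x\<bar> < pi" "\<bar>Re y\<bar> \<le> pi"
  shows "y = x"
proof -
  have "cis (Re y + g) = cis (Re x + g)" "Im y = Im x"
    using assms(1) by (auto simp: can_side_map_def)
  with assms(2,3) show ?thesis
    using cis_eq_imp_eq[of "Re y + g" "Re x + g"] by (auto simp: complex_eq_iff)
qed

lemma can_rect_short: "short_on (can_rect h) (can_map h g)"
  using short_can_side_map[of g] by (simp add: short_on_def can_map_rect)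

lemma can_rect_nearly_isometric: "nearly_isometric_at (can_rect h) (can_map h g) x"
  by (rule nearly_isometric_at_cong[OF can_map_rect nearly_isometric_can_side_map])

lemma can_lid_isometric:
  "h > 0 \<Longrightarrow> x \<in> can_lid h \<Longrightarrow> y \<in> can_lid h \<Longrightarrow> dist (can_map h g x) (can_map h g y) = dist x y"
  by (simp add: can_map_lid dist_can_lid_map)

lemma can_base_isometric:
  "h > 0 \<Longrightarrow> x \<in> can_base \<Longrightarrow> y \<in> can_base \<Longrightarrow> dist (can_map h g x) (can_map h g y) = dist x y"
  by (simp add: can_map_base dist_can_base_map)

lemma norm_horiz_can_map:
  shows "w \<in> can_rect h \<Longrightarrow> norm (horiz (can_map h g w)) = 1"
    and "h > 0 \<Longrightarrow> w \<in> can_lid h \<Longrightarrow> norm (horiz (can_map h g w)) = dist (Complex 0 (h + 1)) w"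
    and "h > 0 \<Longrightarrow> w \<in> can_base \<Longrightarrow> norm (horiz (can_map h g w)) = dist (Complex 0 (- 1)) w"
  by (simp_all add: can_map_rect can_side_map_def can_map_lid can_lid_map_def can_map_base
      can_base_map_def norm_mult dist_norm norm_minus_commute del: complex_cnj_mult complex_cnj_diff)

definition can_regions :: "real \<Rightarrow> complex set set" where
  "can_regions h = {can_rect h, can_lid h, can_base}"

lemma Union_can_regions: "\<Union>(can_regions h) = can_lid h \<union> can_rect h \<union> can_base"
  by (auto simp: can_regions_def)

lemma can_tangent_points:
  "h > 0 \<Longrightarrow> Complex 0 h \<in> can_rect h" "h > 0 \<Longrightarrow> Complex 0 h \<in> can_lid h"
  "h > 0 \<Longrightarrow> 0 \<in> can_rect h" "0 \<in> can_base"
proof -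
  show "Complex 0 h \<in> can_lid h" by (simp add: can_lid_def dist_norm cmod_def)
  show "0 \<in> can_base" by (simp add: can_base_def dist_norm cmod_def)
qed (auto simp: mem_can_rect)

lemma can_map_unique:
  assumes h: "h > 0"
    and x: "(x \<in> can_rect h \<and> \<bar>Re x\<bar> < pi \<and> 0 < Im x \<and> Im x < h) \<or>
      x \<in> ball (Complex 0 (h + 1)) 1 \<or> x \<in> ball (Complex 0 (- 1)) 1 \<or> x = Complex 0 h \<or> x = 0"
    and y: "y \<in> \<Union>(can_regions h)" and eq: "can_map h g y = can_map h g x"
  shows "y = x"
proof -
  have height: "max 0 (min h (Im y)) = max 0 (min h (Im x))" if "x \<in> can_lid h \<union> can_rect h \<union> can_base"
    using can_map_height[OF h, of y g] can_map_height[OF h that, of g] y eq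
    by (simp add: Union_can_regions)
  have rect: "y = x" if "x \<in> can_rect h" "y \<in> can_rect h" "\<bar>Re x\<bar> < pi"
    using can_side_map_inj[of g y x] that eq by (simp add: can_map_rect) (simp add: mem_can_rect)
  have lid: "y = x" if "x \<in> can_lid h" "y \<in> can_lid h"
    using can_lid_isometric[OF h that(2,1), of g] eq by simp
  have base: "y = x" if "x \<in> can_base" "y \<in> can_base"
    using can_base_isometric[OF h that(2,1), of g] eq by simp
  have lid_base: False if "x \<in> can_lid h" "y \<in> can_base"
    using height can_lid_above(1)[OF that(1)] can_base_below(1)[OF that(2)] h that(1) by simp
  have base_lid: False if "x \<in> can_base" "y \<in> can_lid h"
    using height can_lid_above(1)[OF that(2)] can_base_below(1)[OF that(1)] h that(1) by simp
  have interior: "y \<notin> can_rect h" if "norm (horiz (can_map h g x)) < 1"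
    using norm_horiz_can_map(1)[of y h g] that eq by auto
  have y: "y \<in> can_rect h \<or> y \<in> can_lid h \<or> y \<in> can_base"
    using y by (auto simp: Union_can_regions)
  from x show ?thesis
  proof (elim disjE conjE)
    assume x: "x \<in> can_rect h" "\<bar>Re x\<bar> < pi" "0 < Im x" "Im x < h"
    have "y \<notin> can_lid h"
    proof
      assume "y \<in> can_lid h"
      from can_lid_above(1)[OF this] height x show False by simp
    qed
    moreover have "y \<notin> can_base"
    proof
      assume "y \<in> can_base"
      from can_base_below(1)[OF this] height x show False by simp
    qed
    ultimately show ?thesis using rect x y by blast
  next
    assume "x \<in> ball (Complex 0 (h + 1)) 1"
    then have "x \<in> can_lid h" "norm (horiz (can_map h g x)) < 1"
      using norm_horiz_can_map(2)[OF h] by (auto simp: can_lid_def)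
    then show ?thesis
      using y interior lid lid_base by blast
  next
    assume "x \<in> ball (Complex 0 (- 1)) 1"
    then have "x \<in> can_base" "norm (horiz (can_map h g x)) < 1"
      using norm_horiz_can_map(3)[OF h] by (auto simp: can_base_def)
    then show ?thesis
      using y interior base base_lid by blast
  next
    assume x: "x = Complex 0 h"
    then have "\<bar>Re x\<bar> < pi" by simp
    with can_tangent_points(1,2)[OF h] show ?thesis
      using y rect lid lid_base x by blast
  next
    assume x: "x = 0"
    then have "\<bar>Re x\<bar> < pi" by simp
    with can_tangent_points(3)[OF h] can_tangent_points(4) show ?thesis
      using y rect base base_lid x by blast
  qed
qed

lemma can_layout_can_map:
  assumes h: "h > 0"
  shows "can_layout h (can_regions h) (can_map h g)"
proof -
  define M where "M = (+) (- complex_of_real pi)"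
  have M: "M (Complex x y) = Complex (x - pi) y" for x y
    by (simp add: M_def complex_eq_iff)
  have side: "M ` rectangle h = can_rect h"
  proof (rule set_eqI)
    fix w
    have "w \<in> M ` rectangle h \<longleftrightarrow> of_real pi + w \<in> rectangle h"
      by (force simp: M_def image_iff)
    then show "w \<in> M ` rectangle h \<longleftrightarrow> w \<in> can_rect h"
      by (auto simp: rectangle_def mem_can_rect)
  qed
  have "- complex_of_real pi + Complex pi y = Complex 0 y" for y
    by (simp add: complex_eq_iff)
  then have lid: "M ` cball (Complex pi (h + 1)) 1 = can_lid h"
    and base: "M ` cball (Complex pi (- 1)) 1 = can_base"
    by (simp_all only: M_def can_lid_def can_base_def cball_translation[symmetric])
  have cut: "can_map h g (M (Complex 0 y)) = can_map h g (M (Complex (2 * pi) y))" if "y \<in> {0..h}" for y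
  proof -
    have "cis (g - pi) = cis (g + pi)"
      by (simp flip: cis_mult cis_divide)
    then show ?thesis
      using that by (simp add: M can_map_rect mem_can_rect can_side_map_def algebra_simps)
  qed
  have glue_lid: "can_map h g (M (Complex x h)) =
      can_map h g (M (Complex pi (h + 1) + Complex (sin (x - pi)) (- cos (x - pi))))"
    if "x \<in> {0..2*pi}" for x
  proof -
    let ?w = "Complex 0 (h + 1) + Complex (sin (x - pi)) (- cos (x - pi))"
    have w: "M (Complex pi (h + 1) + Complex (sin (x - pi)) (- cos (x - pi))) = ?w"
      by (simp add: M_def complex_eq_iff)
    have "?w \<in> can_lid h"
      by (simp add: can_lid_def dist_norm cmod_def)
    moreover have "\<i> * (?w - Complex 0 (h + 1)) = cis (x - pi)"
      by (simp add: complex_eq_iff)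
    moreover have "Complex (x - pi) h \<in> can_rect h"
      using that h by (simp add: mem_can_rect abs_le_iff)
    ultimately show ?thesis
      unfolding w M by (simp only: can_map_lid[OF h] can_map_rect can_lid_map_def can_side_map_def cis_mult complex.sel)
  qed
  have glue_base: "can_map h g (M (Complex x 0)) =
      can_map h g (M (Complex pi (- 1) + Complex (sin (x - pi)) (cos (x - pi))))"
    if "x \<in> {0..2*pi}" for x
  proof -
    let ?w = "Complex 0 (- 1) + Complex (sin (x - pi)) (cos (x - pi))"
    have w: "M (Complex pi (- 1) + Complex (sin (x - pi)) (cos (x - pi))) = ?w"
      by (simp add: M_def complex_eq_iff)
    have "?w \<in> can_base"
      by (simp add: can_base_def dist_norm cmod_def)
    moreover have "cnj (- \<i> * (?w - Complex 0 (- 1))) = cis (x - pi)"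
      by (simp add: complex_eq_iff)
    moreover have "Complex (x - pi) 0 \<in> can_rect h"
      using that h by (simp add: mem_can_rect abs_le_iff)
    ultimately show ?thesis
      unfolding w M by (simp only: can_map_base[OF h] can_map_rect can_base_map_def can_side_map_def cis_mult complex.sel)
  qed
  have "plane_isometry M"
    by (simp add: plane_isometry_def M_def dist_norm)
  then show ?thesis
    unfolding can_layout_def Let_def
    using side lid base cut glue_lid glue_base can_map_image_rect can_map_image_lid[OF h] can_map_image_base[OF h]
    by (intro exI[of _ M] exI[of _ pi] conjI) (auto simp: can_regions_def)
qed

lemma flat_model_can:
  assumes h: "h > 0"
  shows "flat_model (soup_can h) (can_regions h) (can_map h g)"
proof -
  have "flat_decomposition (soup_can h) (can_regions h) (can_map h g)"
  proof (rule flat_decompositionI[where p = "Complex 0 (h + 3)"])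
    show "plane_region R" if "R \<in> can_regions h" for R
      using that h plane_region_can_rect by (auto simp: can_regions_def can_lid_def can_base_def plane_region_cball)
    show "can_map h g ` \<Union>(can_regions h) = soup_can h"
      using h by (simp add: can_regions_def soup_can_def image_Un can_map_image_rect can_map_image_lid can_map_image_base Un_assoc)
    show "short_on R (can_map h g)" if "R \<in> can_regions h" for R
      using that h can_rect_short short_onI[OF order_eq_refl[OF can_lid_isometric[OF h]]]
        short_onI[OF order_eq_refl[OF can_base_isometric[OF h]]]
      by (auto simp: can_regions_def)
    show "nearly_isometric_at R (can_map h g) x" if "R \<in> can_regions h" "x \<in> R" for R x
      using that h can_rect_nearly_isometric[of h g x]
        nearly_isometric_at_isometry[OF can_lid_isometric[OF h, where g = g]]
        nearly_isometric_at_isometry[OF can_base_isometric[OF h, where g = g]]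
      by (auto simp: can_regions_def)
    have "Complex 0 (h + 3) \<notin> R" if "R \<in> can_regions h" for R
    proof -
      have "dist (Complex 0 (h + 1)) (Complex 0 (h + 3)) = 2"
        by (simp add: dist_norm cmod_def)
      then show ?thesis
        using that h can_base_below(1)[of "Complex 0 (h + 3)"]
        by (auto simp: can_regions_def mem_can_rect can_lid_def)
    qed
    then show "dist (can_map h g x) (can_map h g (Complex 0 (h + 3))) = dist x (Complex 0 (h + 3))"
      if "R \<in> can_regions h" "Complex 0 (h + 3) \<in> R" for R x
      using that by blast
    show "y = x" if "R \<in> can_regions h" "x \<in> interior R" "y \<in> \<Union>(can_regions h)" "can_map h g y = can_map h g x" for R x y
      using that(1,2)
      by (intro can_map_unique[OF h _ that(3,4)])
        (auto simp: can_regions_def can_rect_def can_lid_def can_base_def interior_cbox in_box_complex_iff in_cbox_complex_iff)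
  qed (simp add: can_regions_def)
  then show ?thesis
    unfolding flat_model_def using h can_layout_can_map by blast
qed

definition can_chart :: "real \<Rightarrow> real^3 \<Rightarrow> complex" where
  "can_chart g p = Complex (Arg (horiz p * cis (- g))) (p $ 3)"

lemma continuous_on_can_chart: "continuous_on {p. 0 < Re (horiz p * cis (- g))} (can_chart g)"
  unfolding can_chart_def
  by (intro continuous_intros) (auto simp: complex_nonpos_Reals_iff)

lemma can_chart:
  assumes "p \<in> can_side h"
  shows "can_chart g p \<in> can_rect h" "can_map h g (can_chart g p) = p"
proof -
  show r: "can_chart g p \<in> can_rect h"
    using assms Arg_bounded[of "horiz p * cis (- g)"] by (auto simp: can_chart_def mem_can_rect can_side_eq)
  show "can_map h g (can_chart g p) = p"
    using assms unfolding can_map_rect[OF r]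
    by (simp add: can_side_map_def can_chart_def cis_Arg_shift can_side_eq)
qed

lemma can_chart_base_point:
  assumes "norm (horiz p) = 1"
  shows "can_chart (Arg (horiz p)) p = Complex 0 (p $ 3)"
proof -
  have "horiz p = cis (Arg (horiz p))"
    using rcis_cmod_Arg[of "horiz p"] assms by (simp add: rcis_def)
  then have "horiz p * cis (- Arg (horiz p)) = 1"
    by (metis add.right_inverse cis_mult cis_zero)
  then show ?thesis by (simp add: can_chart_def)
qed

lemma mem_soup_can:
  "p \<in> soup_can h \<longleftrightarrow> p \<in> can_side h \<or> p \<in> horizontal_disk h \<or> p \<in> horizontal_disk 0"
  by (auto simp: soup_can_def)

context shortest_path
begin

lemma can_geodesic_at:
  assumes S: "S = soup_can h" and h: "h > 0" and t: "t \<in> {a<..<b}"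
  shows "\<exists>F q m. flat_model S F q \<and> \<Union>F \<inter> q -` {\<gamma> t} = {m} \<and> straight_at F q \<gamma> a b t m"
proof -
  define p where "p = \<gamma> t"
  define g where "g = Arg (horiz p)"
  let ?F = "can_regions h" and ?q = "can_map h g"
  have pS: "p \<in> soup_can h"
    using subsetD[OF in_S imageI[of t]] t unfolding S p_def by simp
  have sub: "can_rect h \<subseteq> \<Union>?F" "can_lid h \<subseteq> \<Union>?F" "can_base \<subseteq> \<Union>?F"
    by (auto simp: Union_can_regions)
  have q_sub: "?q ` can_rect h \<subseteq> S" "?q ` can_lid h \<subseteq> S" "?q ` can_base \<subseteq> S"
    unfolding S soup_can_def can_map_image_rect can_map_image_lid[OF h] can_map_image_base[OF h]
    by blast+
  have finish: ?thesis if m: "m \<in> \<Union>?F" "?q m = p" "straight_at ?F ?q \<gamma> a b t m"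
    and unique: "(m \<in> can_rect h \<and> \<bar>Re m\<bar> < pi \<and> 0 < Im m \<and> Im m < h) \<or>
      m \<in> ball (Complex 0 (h + 1)) 1 \<or> m \<in> ball (Complex 0 (- 1)) 1 \<or> m = Complex 0 h \<or> m = 0" for m
  proof (intro exI conjI)
    have "y = m" if "y \<in> \<Union>?F" "?q y = p" for y
      by (rule can_map_unique[OF h unique that(1), of g]) (simp add: that(2) m(2))
    then show "\<Union>?F \<inter> ?q -` {\<gamma> t} = {m}"
      using m(1,2) unfolding p_def[symmetric] by blast
    show "flat_model S ?F ?q"
      unfolding S by (rule flat_model_can[OF h])
  qed (rule m(3))
  have rim_chart: "continuous_on {p' \<in> can_side h. 0 < Re (horiz p' * cis (- g))} (can_chart g)"
    by (rule continuous_on_subset[OF continuous_on_can_chart]) auto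
  have direction: "0 < Re (horiz p' * cis (- g))" if "norm (horiz p) = 1" "dist p p' < 1" for p'
  proof (rule Re_near_direction)
    have "horiz p = rcis 1 g"
      unfolding g_def using that(1) rcis_cmod_Arg[of "horiz p"] by simp
    then show "norm (horiz p' - rcis 1 g) < 1"
      using dist_horiz_le[of p p'] that(2) by (simp add: dist_norm[where 'a = complex] norm_minus_commute)
  qed
  consider (side) "norm (horiz p) = 1" "0 < p $ 3" "p $ 3 < h"
    | (lid) "norm (horiz p) < 1" "p $ 3 = h" | (base) "norm (horiz p) < 1" "p $ 3 = 0"
    | (upper_rim) "norm (horiz p) = 1" "p $ 3 = h" | (lower_rim) "norm (horiz p) = 1" "p $ 3 = 0"
    using pS h by (auto simp: mem_soup_can can_side_eq horizontal_disk_eq) linarith+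
  then show ?thesis
  proof cases
    case side
    define \<rho> where "\<rho> = min 1 (min (p $ 3) (h - p $ 3))"
    have \<rho>: "\<rho> > 0" "\<rho> \<le> 1" "\<rho> \<le> p $ 3" "\<rho> \<le> h - p $ 3" using side by (auto simp: \<rho>_def)
    have in_side: "p' \<in> can_side h" if "p' \<in> S \<inter> ball p \<rho>" for p'
      using that \<rho> dist_height_le[of p p']
      by (auto simp: S mem_soup_can horizontal_disk_eq can_side_eq)
    have "straight_at ?F ?q \<gamma> a b t (can_chart g (\<gamma> t))"
    proof (rule straight_at_regular_point[OF t \<rho>(1) _ can_rect_short q_sub(1) can_rect_nearly_isometric sub(1)])
      show "convex (can_rect h)" by (simp add: can_rect_def)
      show "continuous_on (S \<inter> ball (\<gamma> t) \<rho>) (can_chart g)"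
        by (rule continuous_on_subset[OF continuous_on_can_chart])
          (use direction side \<rho> in \<open>auto simp: p_def\<close>)
      show "can_chart g p' \<in> can_rect h \<and> can_map h g (can_chart g p') = p'" if "p' \<in> S \<inter> ball (\<gamma> t) \<rho>" for p'
        using can_chart[OF in_side] that by (simp add: p_def)
    qed
    then show ?thesis
      using can_chart[of p h g] can_chart_base_point[OF side(1)] side sub
      by (intro finish[of "can_chart g p"]) (auto simp: p_def[symmetric] can_side_eq g_def)
  next
    case lid
    define \<kappa> where "\<kappa> p = Complex 0 (h + 1) - \<i> * horiz p * cis (- g)" for p
    have \<kappa>: "\<kappa> p' \<in> can_lid h \<and> ?q (\<kappa> p') = p'" if "p' \<in> horizontal_disk h" for p'
    proof
      show D: "\<kappa> p' \<in> can_lid h"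
        using that by (simp add: \<kappa>_def can_lid_def horizontal_disk_eq dist_norm norm_mult)
      have "\<i> * (\<kappa> p' - Complex 0 (h + 1)) * cis g = horiz p'"
        by (simp add: \<kappa>_def algebra_simps cis_mult)
      then show "?q (\<kappa> p') = p'"
        using that can_map_lid[OF h D] by (simp add: can_lid_map_def horizontal_disk_eq) (metis at_height_horiz)
    qed
    define \<rho> where "\<rho> = min h (1 - norm (horiz p))"
    have \<rho>: "\<rho> > 0" "\<rho> \<le> h" "\<rho> \<le> 1 - norm (horiz p)" using lid h by (auto simp: \<rho>_def)
    have in_lid: "p' \<in> horizontal_disk h" if "p' \<in> S \<inter> ball p \<rho>" for p'
    proof -
      have "norm (horiz p') < 1" "0 < p' $ 3"
        using that \<rho> dist_height_le[of p p'] dist_horiz_le[of p p'] norm_triangle_ineq2[of "horiz p'" "horiz p"] lid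
        by (auto simp: dist_norm[where 'a = complex] norm_minus_commute)
      then show ?thesis
        using that by (auto simp: S mem_soup_can horizontal_disk_eq can_side_eq)
    qed
    have "straight_at ?F ?q \<gamma> a b t (\<kappa> (\<gamma> t))"
    proof (rule straight_at_regular_point[OF t \<rho>(1) _ _ q_sub(2) _ sub(2)])
      show "convex (can_lid h)" by (simp add: can_lid_def)
      show "short_on (can_lid h) ?q"
        using h by (simp add: short_on_def can_lid_isometric)
      show "nearly_isometric_at (can_lid h) ?q x" for x
        using h by (intro nearly_isometric_at_isometry can_lid_isometric)
      show "continuous_on (S \<inter> ball (\<gamma> t) \<rho>) \<kappa>"
        unfolding \<kappa>_def by (intro continuous_intros)
      show "\<kappa> p' \<in> can_lid h \<and> ?q (\<kappa> p') = p'" if "p' \<in> S \<inter> ball (\<gamma> t) \<rho>" for p'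
        using \<kappa>[OF in_lid] that by (simp add: p_def)
    qed
    moreover have "\<kappa> p \<in> ball (Complex 0 (h + 1)) 1"
      using lid by (simp add: \<kappa>_def dist_norm norm_mult)
    ultimately show ?thesis
      using \<kappa>[of p] in_lid[of p] \<rho> pS sub S by (intro finish[of "\<kappa> p"]) (auto simp: p_def[symmetric])
  next
    case base
    define \<kappa> where "\<kappa> p = Complex 0 (- 1) + \<i> * cnj (horiz p * cis (- g))" for p
    have \<kappa>: "\<kappa> p' \<in> can_base \<and> ?q (\<kappa> p') = p'" if "p' \<in> horizontal_disk 0" for p'
    proof
      show D: "\<kappa> p' \<in> can_base"
        using that by (simp add: \<kappa>_def can_base_def horizontal_disk_eq dist_norm norm_mult)
      have "cnj (- \<i> * (\<kappa> p' - Complex 0 (- 1))) * cis g = horiz p'"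
        by (simp add: \<kappa>_def algebra_simps cis_mult cis_cnj)
      then show "?q (\<kappa> p') = p'"
        using that can_map_base[OF h D] by (simp add: can_base_map_def horizontal_disk_eq) (metis at_height_horiz)
    qed
    define \<rho> where "\<rho> = min h (1 - norm (horiz p))"
    have \<rho>: "\<rho> > 0" "\<rho> \<le> h" "\<rho> \<le> 1 - norm (horiz p)" using base h by (auto simp: \<rho>_def)
    have in_base: "p' \<in> horizontal_disk 0" if "p' \<in> S \<inter> ball p \<rho>" for p'
    proof -
      have "norm (horiz p') < 1" "p' $ 3 < h"
        using that \<rho> dist_height_le[of p p'] dist_horiz_le[of p p'] norm_triangle_ineq2[of "horiz p'" "horiz p"] base
        by (auto simp: dist_norm[where 'a = complex] norm_minus_commute)
      then show ?thesis
        using that by (auto simp: S mem_soup_can horizontal_disk_eq can_side_eq)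
    qed
    have "straight_at ?F ?q \<gamma> a b t (\<kappa> (\<gamma> t))"
    proof (rule straight_at_regular_point[OF t \<rho>(1) _ _ q_sub(3) _ sub(3)])
      show "convex can_base" by (simp add: can_base_def)
      show "short_on can_base ?q"
        using h by (simp add: short_on_def can_base_isometric)
      show "nearly_isometric_at can_base ?q x" for x
        using h by (intro nearly_isometric_at_isometry can_base_isometric)
      show "continuous_on (S \<inter> ball (\<gamma> t) \<rho>) \<kappa>"
        unfolding \<kappa>_def by (intro continuous_intros)
      show "\<kappa> p' \<in> can_base \<and> ?q (\<kappa> p') = p'" if "p' \<in> S \<inter> ball (\<gamma> t) \<rho>" for p'
        using \<kappa>[OF in_base] that by (simp add: p_def)
    qed
    moreover have "\<kappa> p \<in> ball (Complex 0 (- 1)) 1"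
      using base by (simp add: \<kappa>_def dist_norm norm_mult)
    ultimately show ?thesis
      using \<kappa>[of p] in_base[of p] \<rho> pS sub S by (intro finish[of "\<kappa> p"]) (auto simp: p_def[symmetric])
  next
    case upper_rim
    have p_side: "p \<in> can_side h" using upper_rim h by (simp add: can_side_eq)
    have m: "can_chart g p = Complex 0 h"
      using can_chart_base_point[OF upper_rim(1)] upper_rim by (simp add: g_def)
    have qm: "\<gamma> t = ?q (Complex 0 h)"
      using can_chart(2)[OF p_side, of g] m by (simp add: p_def)
    have "straight_at ?F ?q \<gamma> a b t (Complex 0 h)"
    proof (rule straight_at_rim_point[where C = "can_rect h" and D = "can_lid h" and n = \<i>
          and \<rho> = "min 1 h" and e\<^sub>0 = pi and \<kappa> = "can_chart g"
          and N = "{p' \<in> can_side h. 0 < Re (horiz p' * cis (- g))}"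
          and d\<^sub>1 = "\<lambda>\<epsilon>. Complex 0 h + of_real \<epsilon> * (- 1)" and d\<^sub>2 = "\<lambda>\<epsilon>. Complex 0 (h + 1) + (- \<i>) * cis ((- 1) * \<epsilon>)"])
      show "(x - Complex 0 h) \<bullet> \<i> < 0" if "x \<in> can_rect h" "?q x \<notin> ?q ` can_lid h" for x
      proof -
        have "Im x \<noteq> h"
          using that h by (auto simp: can_map_rect can_map_image_lid can_side_map_def horizontal_disk_eq)
        then show ?thesis using that(1) by (auto simp: mem_can_rect inner_complex_def)
      qed
      show "(x - Complex 0 h) \<bullet> \<i> > 0" if "x \<in> can_lid h" "x \<noteq> Complex 0 h" for x
        using can_lid_above[OF that(1)] that(2) by (fastforce simp: inner_complex_def)
      show "S \<inter> ball (\<gamma> t) (min 1 h) - ?q ` can_lid h \<subseteq> {p' \<in> can_side h. 0 < Re (horiz p' * cis (- g))}"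
      proof
        fix p' assume p': "p' \<in> S \<inter> ball (\<gamma> t) (min 1 h) - ?q ` can_lid h"
        then have "0 < p' $ 3"
          using dist_height_le[of p p'] upper_rim by (auto simp: p_def)
        moreover have "p' \<notin> horizontal_disk h"
          using p' h by (auto simp: can_map_image_lid)
        ultimately have "p' \<in> can_side h"
          using p' by (auto simp: S mem_soup_can horizontal_disk_eq)
        then show "p' \<in> {p' \<in> can_side h. 0 < Re (horiz p' * cis (- g))}"
          using p' direction[OF upper_rim(1), of p'] by (auto simp: p_def)
      qed
      show "\<gamma> t \<in> {p' \<in> can_side h. 0 < Re (horiz p' * cis (- g))}"
        using p_side direction[OF upper_rim(1), of p] by (simp add: p_def)
      show "Complex 0 (h + 1) + (- \<i>) * cis ((- 1) * 0) = Complex 0 h"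
        by (simp add: complex_eq_iff)
      show "((\<lambda>\<epsilon>. Complex 0 h + of_real \<epsilon> * (- 1)) has_vector_derivative \<i> * \<i>) (at 0)"
        using rim_derivatives(1)[of "Complex 0 h" "- 1"] by simp
      show "((\<lambda>\<epsilon>. Complex 0 (h + 1) + (- \<i>) * cis ((- 1) * \<epsilon>)) has_vector_derivative \<i> * \<i>) (at 0)"
        using rim_derivatives(2)[of "Complex 0 (h + 1)" "- \<i>" "- 1"] by simp
      show "Complex 0 h + of_real \<epsilon> * (- 1) \<in> can_rect h \<and> Complex 0 (h + 1) + (- \<i>) * cis ((- 1) * \<epsilon>) \<in> can_lid h \<and>
          ?q (Complex 0 h + of_real \<epsilon> * (- 1)) = ?q (Complex 0 (h + 1) + (- \<i>) * cis ((- 1) * \<epsilon>))" if "\<bar>\<epsilon>\<bar> < pi" for \<epsilon>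
      proof -
        have R: "Complex 0 h + of_real \<epsilon> * (- 1) \<in> can_rect h"
          using that h by (simp add: mem_can_rect)
        have D: "Complex 0 (h + 1) + (- \<i>) * cis ((- 1) * \<epsilon>) \<in> can_lid h"
          by (simp add: can_lid_def dist_norm cmod_def)
        have "\<i> * (Complex 0 (h + 1) + (- \<i>) * cis ((- 1) * \<epsilon>) - Complex 0 (h + 1)) = cis (- \<epsilon>)"
          by (simp add: complex_eq_iff)
        then show ?thesis
          using R D unfolding can_map_rect[OF R] can_map_lid[OF h D]
          by (simp add: can_side_map_def can_lid_map_def cis_mult)
      qed
    qed (use t h qm m q_sub sub rim_chart can_rect_short can_rect_nearly_isometric can_tangent_points
        can_chart convex_horizontal_disk can_lid_isometric
        in \<open>auto simp: can_rect_def can_lid_def can_map_image_lid[unfolded can_lid_def] p_def[symmetric]\<close>)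
    then show ?thesis
      using qm can_tangent_points(1)[OF h] sub by (intro finish[of "Complex 0 h"]) (auto simp: p_def)
  next
    case lower_rim
    have p_side: "p \<in> can_side h" using lower_rim h by (simp add: can_side_eq)
    have m: "can_chart g p = 0"
      using can_chart_base_point[OF lower_rim(1)] lower_rim by (simp add: g_def complex_eq_iff)
    have qm: "\<gamma> t = ?q 0"
      using can_chart(2)[OF p_side, of g] m by (simp add: p_def)
    have "straight_at ?F ?q \<gamma> a b t 0"
    proof (rule straight_at_rim_point[where C = "can_rect h" and D = can_base and n = "- \<i>"
          and \<rho> = "min 1 h" and e\<^sub>0 = pi and \<kappa> = "can_chart g"
          and N = "{p' \<in> can_side h. 0 < Re (horiz p' * cis (- g))}"
          and d\<^sub>1 = "\<lambda>\<epsilon>. 0 + of_real \<epsilon> * 1" and d\<^sub>2 = "\<lambda>\<epsilon>. Complex 0 (- 1) + \<i> * cis ((- 1) * \<epsilon>)"])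
      show "(x - 0) \<bullet> (- \<i>) < 0" if "x \<in> can_rect h" "?q x \<notin> ?q ` can_base" for x
      proof -
        have "Im x \<noteq> 0"
          using that h by (auto simp: can_map_rect can_map_image_base can_side_map_def horizontal_disk_eq)
        then show ?thesis using that(1) by (auto simp: mem_can_rect inner_complex_def)
      qed
      show "(x - 0) \<bullet> (- \<i>) > 0" if "x \<in> can_base" "x \<noteq> 0" for x
        using can_base_below[OF that(1)] that(2) by (fastforce simp: inner_complex_def)
      show "S \<inter> ball (\<gamma> t) (min 1 h) - ?q ` can_base \<subseteq> {p' \<in> can_side h. 0 < Re (horiz p' * cis (- g))}"
      proof
        fix p' assume p': "p' \<in> S \<inter> ball (\<gamma> t) (min 1 h) - ?q ` can_base"
        then have "p' $ 3 < h"
          using dist_height_le[of p p'] lower_rim by (auto simp: p_def)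
        moreover have "p' \<notin> horizontal_disk 0"
          using p' h by (auto simp: can_map_image_base)
        ultimately have "p' \<in> can_side h"
          using p' by (auto simp: S mem_soup_can horizontal_disk_eq)
        then show "p' \<in> {p' \<in> can_side h. 0 < Re (horiz p' * cis (- g))}"
          using p' direction[OF lower_rim(1), of p'] by (auto simp: p_def)
      qed
      show "\<gamma> t \<in> {p' \<in> can_side h. 0 < Re (horiz p' * cis (- g))}"
        using p_side direction[OF lower_rim(1), of p] by (simp add: p_def)
      show "Complex 0 (- 1) + \<i> * cis ((- 1) * 0) = 0"
        by (simp add: complex_eq_iff)
      show "((\<lambda>\<epsilon>. 0 + of_real \<epsilon> * 1) has_vector_derivative \<i> * - \<i>) (at 0)"
        using rim_derivatives(1)[of 0 1] by simp
      show "((\<lambda>\<epsilon>. Complex 0 (- 1) + \<i> * cis ((- 1) * \<epsilon>)) has_vector_derivative \<i> * - \<i>) (at 0)"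
        using rim_derivatives(2)[of "Complex 0 (- 1)" \<i> "- 1"] by simp
      show "0 + of_real \<epsilon> * 1 \<in> can_rect h \<and> Complex 0 (- 1) + \<i> * cis ((- 1) * \<epsilon>) \<in> can_base \<and>
          ?q (0 + of_real \<epsilon> * 1) = ?q (Complex 0 (- 1) + \<i> * cis ((- 1) * \<epsilon>))" if "\<bar>\<epsilon>\<bar> < pi" for \<epsilon>
      proof -
        have R: "0 + of_real \<epsilon> * 1 \<in> can_rect h"
          using that h by (simp add: mem_can_rect)
        have D: "Complex 0 (- 1) + \<i> * cis ((- 1) * \<epsilon>) \<in> can_base"
          by (simp add: can_base_def dist_norm norm_mult)
        have "cnj (- \<i> * (Complex 0 (- 1) + \<i> * cis ((- 1) * \<epsilon>) - Complex 0 (- 1))) = cis \<epsilon>"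
          by (simp add: complex_eq_iff)
        then show ?thesis
          using R D unfolding can_map_rect[OF R] can_map_base[OF h D] can_base_map_def
          by (simp add: can_side_map_def cis_mult)
      qed
    qed (use t h qm m q_sub sub rim_chart can_rect_short can_rect_nearly_isometric can_tangent_points
        can_chart convex_horizontal_disk can_base_isometric
        in \<open>auto simp: can_rect_def can_base_def can_map_image_base[unfolded can_base_def] p_def[symmetric]\<close>)
    then show ?thesis
      using qm can_tangent_points(4) sub by (intro finish[of 0]) (auto simp: p_def)
  qed
qed

end

section \<open>The conical cup\<close>

definition cup_sector :: "real \<Rightarrow> complex set" where
  "cup_sector \<phi> = {w. norm w \<le> 1 / sin \<phi> \<and> \<bar>Arg w\<bar> \<le> pi * sin \<phi>}"

definition cup_lid :: "real \<Rightarrow> complex set" where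
  "cup_lid \<phi> = cball (of_real (1 / sin \<phi> + 1)) 1"

definition cup_side_map :: "real \<Rightarrow> real \<Rightarrow> complex \<Rightarrow> real^3" where
  "cup_side_map \<phi> g w = at_height (rcis (norm w * sin \<phi>) (Arg w / sin \<phi> + g)) (norm w * cos \<phi>)"

definition cup_lid_map :: "real \<Rightarrow> real \<Rightarrow> complex \<Rightarrow> real^3" where
  "cup_lid_map \<phi> g w = at_height (cnj (of_real (1 / sin \<phi> + 1) - w) * cis g) (cot \<phi>)"

text \<open>
  The sector is symmetric about the positive real axis, which is mapped to the ruling at angle
  \<open>g\<close>; the lid is tangent to the sector at the end of that ruling.
\<close>
definition cup_map :: "real \<Rightarrow> real \<Rightarrow> complex \<Rightarrow> real^3" where
  "cup_map \<phi> g w = (if norm w \<le> 1 / sin \<phi> then cup_side_map \<phi> g w else cup_lid_map \<phi> g w)"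

definition cup_regions :: "real \<Rightarrow> complex set set" where
  "cup_regions \<phi> = {cup_sector \<phi>, cup_lid \<phi>}"

definition cup_chart :: "real \<Rightarrow> real \<Rightarrow> real^3 \<Rightarrow> complex" where
  "cup_chart \<phi> g p = rcis (p $ 3 / cos \<phi>) (sin \<phi> * Arg (horiz p * cis (- g)))"

locale cone_angle =
  fixes \<phi> :: real
  assumes angle: "0 < \<phi>" "\<phi> < pi / 2"
begin

lemma sin_pos: "0 < sin \<phi>" and cos_pos: "0 < cos \<phi>" and sin_less_1: "sin \<phi> < 1"
  and tan_pos: "0 < tan \<phi>" and cot_pos: "0 < cot \<phi>"
proof -
  show 1: "0 < sin \<phi>" using angle by (intro sin_gt_zero) auto
  show 2: "0 < cos \<phi>" using angle by (intro cos_gt_zero) auto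
  show "sin \<phi> < 1" using angle sin_monotone_2pi[of \<phi> "pi / 2"] by simp
  show "0 < tan \<phi>" "0 < cot \<phi>" using 1 2 by (simp_all add: tan_def cot_def)
qed

lemma sector_angle: "pi * sin \<phi> < pi" "0 < pi * sin \<phi>"
  using sin_pos sin_less_1 by auto

lemma cup_sector_eq: "cup_sector \<phi> = {rcis r t | r t. 0 \<le> r \<and> r \<le> 1 / sin \<phi> \<and> \<bar>t\<bar> \<le> pi * sin \<phi>}"
proof (intro equalityI subsetI)
  fix w assume "w \<in> cup_sector \<phi>"
  then have "w = rcis (norm w) (Arg w) \<and> 0 \<le> norm w \<and> norm w \<le> 1 / sin \<phi> \<and> \<bar>Arg w\<bar> \<le> pi * sin \<phi>"
    by (simp add: rcis_cmod_Arg cup_sector_def)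
  then show "w \<in> {rcis r t | r t. 0 \<le> r \<and> r \<le> 1 / sin \<phi> \<and> \<bar>t\<bar> \<le> pi * sin \<phi>}" by blast
next
  fix w assume "w \<in> {rcis r t | r t. 0 \<le> r \<and> r \<le> 1 / sin \<phi> \<and> \<bar>t\<bar> \<le> pi * sin \<phi>}"
  then obtain r t where w: "w = rcis r t" "0 \<le> r" "r \<le> 1 / sin \<phi>" "\<bar>t\<bar> \<le> pi * sin \<phi>" by blast
  then have "\<bar>t\<bar> < pi" using sector_angle(1) by linarith
  then show "w \<in> cup_sector \<phi>"
    using w sector_angle(2) Arg_rcis_abs[of r t] by (cases "r = 0") (auto simp: cup_sector_def Arg_zero)
qed

lemma mem_cup_sector_rcis:
  "0 \<le> r \<Longrightarrow> r \<le> 1 / sin \<phi> \<Longrightarrow> \<bar>t\<bar> \<le> pi * sin \<phi> \<Longrightarrow> rcis r t \<in> cup_sector \<phi>"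
  unfolding cup_sector_eq by blast

lemma cup_side_map_rcis:
  assumes "0 \<le> r" "\<bar>t\<bar> < pi"
  shows "cup_side_map \<phi> g (rcis r t) = at_height (rcis (r * sin \<phi>) (t / sin \<phi> + g)) (r * cos \<phi>)"
  using assms Arg_rcis_abs[of r t] by (cases "r = 0") (auto simp: cup_side_map_def)

lemma dist_cup_side_map:
  "dist (cup_side_map \<phi> g x) (cup_side_map \<phi> g y) =
     sqrt ((norm x - norm y)\<^sup>2 + 4 * norm x * norm y * (sin \<phi> * sin ((Arg x - Arg y) / (2 * sin \<phi>)))\<^sup>2)"
proof -
  have 1: "(Arg x / sin \<phi> + g - (Arg y / sin \<phi> + g)) / 2 = (Arg x - Arg y) / (2 * sin \<phi>)"
    using sin_pos by (simp add: field_simps)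
  have 2: "(norm x * sin \<phi> - norm y * sin \<phi>)\<^sup>2 + (norm x * cos \<phi> - norm y * cos \<phi>)\<^sup>2 = (norm x - norm y)\<^sup>2"
  proof -
    have "(norm x * sin \<phi> - norm y * sin \<phi>)\<^sup>2 + (norm x * cos \<phi> - norm y * cos \<phi>)\<^sup>2 =
        (norm x - norm y)\<^sup>2 * ((sin \<phi>)\<^sup>2 + (cos \<phi>)\<^sup>2)"
      by (simp only: left_diff_distrib[symmetric] power_mult_distrib distrib_left)
    then show ?thesis by simp
  qed
  have "(dist (rcis (norm x * sin \<phi>) (Arg x / sin \<phi> + g)) (rcis (norm y * sin \<phi>) (Arg y / sin \<phi> + g)))\<^sup>2 +
      (norm x * cos \<phi> - norm y * cos \<phi>)\<^sup>2 =
      (norm x - norm y)\<^sup>2 + 4 * norm x * norm y * (sin \<phi> * sin ((Arg x - Arg y) / (2 * sin \<phi>)))\<^sup>2"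
    unfolding dist_norm norm_rcis_diff 1 2[symmetric] by (simp add: power_mult_distrib power2_eq_square)
  then show ?thesis
    unfolding cup_side_map_def dist_at_height by simp
qed

lemma dist_polar:
  "dist x y = sqrt ((norm x - norm y)\<^sup>2 + 4 * norm x * norm y * (sin ((Arg x - Arg y) / 2))\<^sup>2)" for x y :: complex
  using norm_rcis_diff[of "norm x" "Arg x" "norm y" "Arg y"]
  by (simp add: rcis_cmod_Arg dist_norm real_sqrt_unique)

lemma short_cup_side_map: "short_on (cup_sector \<phi>) (cup_side_map \<phi> g)"
proof (rule short_onI)
  fix x y assume xy: "x \<in> cup_sector \<phi>" "y \<in> cup_sector \<phi>"
  define u where "u = \<bar>Arg x - Arg y\<bar> / (2 * sin \<phi>)"
  have ad: "\<bar>Arg x - Arg y\<bar> \<le> 2 * (pi * sin \<phi>)"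
    using xy by (auto simp: cup_sector_def)
  have u: "0 \<le> u" "u \<le> pi"
    using ad sin_pos by (auto simp: u_def divide_le_eq mult_ac)
  have "sin \<phi> * sin u \<le> sin (sin \<phi> * u)"
    using sin_pos sin_less_1 u by (intro sin_mult_ge) auto
  moreover have "0 \<le> sin \<phi> * sin u"
    by (intro mult_nonneg_nonneg less_imp_le[OF sin_pos] sin_ge_zero u)
  ultimately have "(sin \<phi> * sin u)\<^sup>2 \<le> (sin (sin \<phi> * u))\<^sup>2"
    by (intro power_mono)
  moreover have abs: "(sin (\<bar>z\<bar> / c))\<^sup>2 = (sin (z / c))\<^sup>2" for z c :: real
    by (cases "z \<ge> 0") auto
  have "sin \<phi> * u = \<bar>Arg x - Arg y\<bar> / 2"
    using sin_pos by (simp add: u_def)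
  then have "(sin (sin \<phi> * u))\<^sup>2 = (sin ((Arg x - Arg y) / 2))\<^sup>2"
    by (simp only: abs)
  moreover have "(sin u)\<^sup>2 = (sin ((Arg x - Arg y) / (2 * sin \<phi>)))\<^sup>2"
    by (simp only: u_def abs)
  ultimately have "(sin \<phi> * sin ((Arg x - Arg y) / (2 * sin \<phi>)))\<^sup>2 \<le> (sin ((Arg x - Arg y) / 2))\<^sup>2"
    by (simp only: power_mult_distrib)
  then show "dist (cup_side_map \<phi> g x) (cup_side_map \<phi> g y) \<le> dist x y"
    unfolding dist_cup_side_map dist_polar[of x y]
    by (intro real_sqrt_le_mono add_left_mono mult_left_mono) auto
qed

lemma nearly_isometric_cup_side_map:
  assumes "x \<notin> \<real>\<^sub>\<le>\<^sub>0"
  shows "nearly_isometric_at UNIV (cup_side_map \<phi> g) x"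
  unfolding nearly_isometric_at_def
proof (intro allI impI)
  fix k :: real assume "k < 1"
  define k' where "k' = max k 0"
  have k': "k \<le> k'" "0 \<le> k'" "k' < 1" using \<open>k < 1\<close> by (auto simp: k'_def)
  obtain \<eta> where \<eta>: "\<eta> > 0" "\<And>x. \<bar>x\<bar> < \<eta> \<Longrightarrow> k' * \<bar>x\<bar> \<le> \<bar>sin x\<bar>"
    using sin_near_zero_ge[OF k'(3)] by blast
  have "sin \<phi> * \<eta> > 0" using sin_pos \<eta> by simp
  then obtain \<delta> where \<delta>: "\<delta> > 0" "\<And>y. dist y x < \<delta> \<Longrightarrow> dist (Arg y) (Arg x) < sin \<phi> * \<eta>"
    using continuous_at_Arg[OF assms] unfolding continuous_at_eps_delta by blast
  have "k * dist y z \<le> dist (cup_side_map \<phi> g y) (cup_side_map \<phi> g z)"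
    if "y \<in> ball x \<delta>" "z \<in> ball x \<delta>" for y z
  proof -
    define D where "D = Arg y - Arg z"
    have "\<bar>D\<bar> < 2 * (sin \<phi> * \<eta>)"
      using \<delta>(2)[of y] \<delta>(2)[of z] that by (simp add: D_def dist_commute dist_real_def)
    then have "\<bar>D / (2 * sin \<phi>)\<bar> < \<eta>"
      using sin_pos by (simp add: abs_mult field_simps)
    from \<eta>(2)[OF this] have "sin \<phi> * (k' * \<bar>D / (2 * sin \<phi>)\<bar>) \<le> sin \<phi> * \<bar>sin (D / (2 * sin \<phi>))\<bar>"
      using sin_pos by (intro mult_left_mono) auto
    then have "k' * \<bar>D / 2\<bar> \<le> sin \<phi> * \<bar>sin (D / (2 * sin \<phi>))\<bar>"
      using sin_pos by (simp add: abs_mult)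
    moreover have "k' * \<bar>sin (D / 2)\<bar> \<le> k' * \<bar>D / 2\<bar>"
      using k' by (intro mult_left_mono abs_sin_x_le_abs_x)
    ultimately have "(k' * \<bar>sin (D / 2)\<bar>)\<^sup>2 \<le> (sin \<phi> * \<bar>sin (D / (2 * sin \<phi>))\<bar>)\<^sup>2"
      using k' by (intro power_mono) auto
    then have "k'\<^sup>2 * (sin (D / 2))\<^sup>2 \<le> (sin \<phi> * sin (D / (2 * sin \<phi>)))\<^sup>2"
      by (simp add: power_mult_distrib)
    then have "4 * norm y * norm z * (k'\<^sup>2 * (sin (D / 2))\<^sup>2) \<le>
        4 * norm y * norm z * (sin \<phi> * sin (D / (2 * sin \<phi>)))\<^sup>2"
      by (intro mult_left_mono) auto
    moreover have "k'\<^sup>2 * (norm y - norm z)\<^sup>2 \<le> (norm y - norm z)\<^sup>2"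
      using k' by (simp add: mult_left_le_one_le power_le_one)
    ultimately have "k'\<^sup>2 * ((norm y - norm z)\<^sup>2 + 4 * norm y * norm z * (sin (D / 2))\<^sup>2) \<le>
        (norm y - norm z)\<^sup>2 + 4 * norm y * norm z * (sin \<phi> * sin (D / (2 * sin \<phi>)))\<^sup>2"
      by (simp add: distrib_left mult_ac)
    then have "sqrt (k'\<^sup>2 * ((norm y - norm z)\<^sup>2 + 4 * norm y * norm z * (sin (D / 2))\<^sup>2)) \<le>
        dist (cup_side_map \<phi> g y) (cup_side_map \<phi> g z)"
      unfolding dist_cup_side_map D_def by (rule real_sqrt_le_mono)
    then have "k' * dist y z \<le> dist (cup_side_map \<phi> g y) (cup_side_map \<phi> g z)"
      using k' by (simp add: real_sqrt_mult dist_polar[of y z] D_def)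
    then show ?thesis
      using k' mult_right_mono[of k k' "dist y z"] by auto
  qed
  then show "\<exists>\<delta>>0. \<forall>y\<in>UNIV \<inter> ball x \<delta>. \<forall>z\<in>UNIV \<inter> ball x \<delta>.
      k * dist y z \<le> dist (cup_side_map \<phi> g y) (cup_side_map \<phi> g z)"
    using \<delta>(1) by auto
qed

lemma cup_sector_slit:
  assumes "w \<in> cup_sector \<phi>" "w \<noteq> 0"
  shows "w \<notin> \<real>\<^sub>\<le>\<^sub>0"
proof
  assume "w \<in> \<real>\<^sub>\<le>\<^sub>0"
  then obtain r where "w = of_real r" "r \<le> 0" by (auto elim: nonpos_Reals_cases)
  then have "Arg w = pi" using assms(2) by (simp add: Arg_of_real)
  then show False using assms(1) sector_angle by (simp add: cup_sector_def)
qed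

lemma dist_cup_lid_map: "dist (cup_lid_map \<phi> g x) (cup_lid_map \<phi> g y) = dist x y"
proof -
  have "cnj (c - x) * cis g - cnj (c - y) * cis g = cnj (y - x) * cis g" for c
    by (simp add: algebra_simps)
  then show ?thesis
    by (simp only: cup_lid_map_def dist_at_height dist_norm[where 'a = complex])
      (simp add: norm_mult norm_minus_commute del: complex_cnj_mult complex_cnj_diff)
qed

lemma cup_lid_beyond:
  assumes "w \<in> cup_lid \<phi>"
  shows "1 / sin \<phi> \<le> Re w" and "1 / sin \<phi> \<le> norm w" and "norm w = 1 / sin \<phi> \<Longrightarrow> w = of_real (1 / sin \<phi>)"
    and "Re w = 1 / sin \<phi> \<Longrightarrow> w = of_real (1 / sin \<phi>)"
proof -
  have "dist (of_real (1 / sin \<phi>) + 1) w \<le> 1"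
    using assms by (simp add: cup_lid_def)
  from tangent_disk[OF _ this] show 1: "1 / sin \<phi> \<le> Re w"
    and 2: "Re w = 1 / sin \<phi> \<Longrightarrow> w = of_real (1 / sin \<phi>)"
    by (auto simp: inner_complex_def)
  show "1 / sin \<phi> \<le> norm w" using 1 complex_Re_le_cmod[of w] by linarith
  show "w = of_real (1 / sin \<phi>)" if "norm w = 1 / sin \<phi>"
    using 1 2 that complex_Re_le_cmod[of w] by linarith
qed

lemma cup_map_sector: "w \<in> cup_sector \<phi> \<Longrightarrow> cup_map \<phi> g w = cup_side_map \<phi> g w"
  by (simp add: cup_map_def cup_sector_def)

lemma cup_map_lid:
  assumes "w \<in> cup_lid \<phi>"
  shows "cup_map \<phi> g w = cup_lid_map \<phi> g w"
proof (cases "norm w = 1 / sin \<phi>")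
  case True
  with cup_lid_beyond[OF assms] have w: "w = rcis (1 / sin \<phi>) 0" by (simp add: rcis_def)
  have "cup_side_map \<phi> g w = at_height (rcis (1 / sin \<phi> * sin \<phi>) (0 / sin \<phi> + g)) (1 / sin \<phi> * cos \<phi>)"
    unfolding w by (rule cup_side_map_rcis) (use sin_pos in auto)
  also have "\<dots> = cup_lid_map \<phi> g w"
    using sin_pos by (simp add: cup_lid_map_def w cot_def) (simp add: rcis_def)
  finally show ?thesis
    using True by (simp add: cup_map_def)
next
  case False
  with cup_lid_beyond(2)[OF assms] show ?thesis by (simp add: cup_map_def)
qed

lemma cup_chart:
  assumes "p \<in> cup_side \<phi>"
  shows "cup_chart \<phi> g p \<in> cup_sector \<phi>" "cup_map \<phi> g (cup_chart \<phi> g p) = p"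
    and "norm (cup_chart \<phi> g p) = p $ 3 / cos \<phi>"
proof -
  have p: "norm (horiz p) = p $ 3 * tan \<phi>" "0 \<le> p $ 3" "p $ 3 \<le> cot \<phi>"
    using assms cup_side_eq[OF angle] by auto
  define A where "A = Arg (horiz p * cis (- g))"
  have A: "\<bar>A\<bar> \<le> pi" using Arg_bounded[of "horiz p * cis (- g)"] by (auto simp: A_def)
  have A': "\<bar>sin \<phi> * A\<bar> \<le> pi * sin \<phi>"
    using mult_right_mono[OF A, of "sin \<phi>"] sin_pos by (simp add: abs_mult mult.commute)
  have A'': "\<bar>sin \<phi> * A\<bar> < pi" using A' sector_angle(1) by linarith
  have r: "0 \<le> p $ 3 / cos \<phi>" "p $ 3 / cos \<phi> \<le> 1 / sin \<phi>"
    using p cos_pos sin_pos by (auto simp: cot_def field_simps)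
  show w: "cup_chart \<phi> g p \<in> cup_sector \<phi>"
    unfolding cup_chart_def A_def[symmetric] by (rule mem_cup_sector_rcis[OF r A'])
  show "norm (cup_chart \<phi> g p) = p $ 3 / cos \<phi>"
    unfolding cup_chart_def complex_mod_rcis using r(1) by (rule abs_of_nonneg)
  have "horiz p * cis (- g) = rcis (norm (horiz p)) A"
    using rcis_cmod_Arg[of "horiz p * cis (- g)"] by (simp add: A_def norm_mult)
  then have "horiz p * cis (- g) * cis g = rcis (norm (horiz p)) A * cis g" by simp
  then have h: "horiz p = rcis (norm (horiz p)) (A + g)"
    by (simp add: rcis_def mult.assoc cis_mult)
  have "cup_side_map \<phi> g (cup_chart \<phi> g p) = at_height (rcis (p $ 3 * tan \<phi>) (A + g)) (p $ 3)"
    unfolding cup_chart_def A_def[symmetric] using cup_side_map_rcis[OF r(1) A''] sin_pos cos_pos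
    by (simp add: tan_def)
  also have "\<dots> = p"
    using h p(1) by (metis at_height_horiz)
  finally show "cup_map \<phi> g (cup_chart \<phi> g p) = p"
    using cup_map_sector[OF w] by simp
qed

lemma cup_map_image_sector: "cup_map \<phi> g ` cup_sector \<phi> = cup_side \<phi>"
proof (intro equalityI subsetI)
  fix p assume "p \<in> cup_map \<phi> g ` cup_sector \<phi>"
  then obtain w where w: "w \<in> cup_sector \<phi>" "p = cup_side_map \<phi> g w"
    by (auto simp: cup_map_sector)
  then show "p \<in> cup_side \<phi>"
    unfolding cup_side_eq[OF angle] using sin_pos cos_pos
    by (auto simp: cup_side_map_def cup_sector_def tan_def cot_def field_simps)
next
  fix p assume "p \<in> cup_side \<phi>"
  from cup_chart[OF this, of g] show "p \<in> cup_map \<phi> g ` cup_sector \<phi>"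
    by (metis image_eqI)
qed

definition lid_chart :: "real \<Rightarrow> real^3 \<Rightarrow> complex" where
  "lid_chart g p = of_real (1 / sin \<phi> + 1) - cnj (horiz p * cis (- g))"

lemma lid_chart:
  assumes "p \<in> horizontal_disk (cot \<phi>)"
  shows "lid_chart g p \<in> cup_lid \<phi>" "cup_map \<phi> g (lid_chart g p) = p"
proof -
  show D: "lid_chart g p \<in> cup_lid \<phi>"
    using assms by (simp add: lid_chart_def cup_lid_def horizontal_disk_eq dist_norm norm_mult del: of_real_add)
  have h: "cnj (of_real (1 / sin \<phi> + 1) - lid_chart g p) * cis g = horiz p" "p $ 3 = cot \<phi>"
    using assms by (simp_all add: lid_chart_def horizontal_disk_eq mult.assoc cis_mult)
  show "cup_map \<phi> g (lid_chart g p) = p"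
    unfolding cup_map_lid[OF D] cup_lid_map_def h(1) h(2)[symmetric] by (rule at_height_horiz)
qed

lemma cup_map_image_lid: "cup_map \<phi> g ` cup_lid \<phi> = horizontal_disk (cot \<phi>)"
proof (intro equalityI subsetI)
  fix p assume "p \<in> cup_map \<phi> g ` cup_lid \<phi>"
  then obtain w where "w \<in> cup_lid \<phi>" "p = cup_lid_map \<phi> g w"
    by (auto simp: cup_map_lid)
  then show "p \<in> horizontal_disk (cot \<phi>)"
    by (simp add: cup_lid_map_def horizontal_disk_eq norm_mult cup_lid_def dist_norm
        del: complex_cnj_diff of_real_add)
next
  fix p assume "p \<in> horizontal_disk (cot \<phi>)"
  from lid_chart[OF this, of g] show "p \<in> cup_map \<phi> g ` cup_lid \<phi>"
    by (metis image_eqI)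
qed

lemma cup_lid_isometric:
  "x \<in> cup_lid \<phi> \<Longrightarrow> y \<in> cup_lid \<phi> \<Longrightarrow> dist (cup_map \<phi> g x) (cup_map \<phi> g y) = dist x y"
  by (simp add: cup_map_lid dist_cup_lid_map)

lemma cup_sector_short: "short_on (cup_sector \<phi>) (cup_map \<phi> g)"
  using short_cup_side_map[of g] by (simp add: short_on_def cup_map_sector)

lemma cup_sector_nearly_isometric:
  assumes "x \<in> cup_sector \<phi>" "x \<noteq> 0"
  shows "nearly_isometric_at (cup_sector \<phi>) (cup_map \<phi> g) x"
  using assms
  by (intro nearly_isometric_at_cong[OF cup_map_sector] nearly_isometric_cup_side_map cup_sector_slit)

lemma cup_side_map_inj:
  assumes eq: "cup_side_map \<phi> g y = cup_side_map \<phi> g x"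
    and "\<bar>Arg x\<bar> < pi * sin \<phi>" "\<bar>Arg y\<bar> \<le> pi * sin \<phi>"
  shows "y = x"
proof -
  have n: "norm y = norm x" and
    r: "rcis (norm x * sin \<phi>) (Arg y / sin \<phi> + g) = rcis (norm x * sin \<phi>) (Arg x / sin \<phi> + g)"
    using eq cos_pos by (auto simp: cup_side_map_def)
  show ?thesis
  proof (cases "x = 0")
    case True
    then show ?thesis using n by simp
  next
    case False
    then have "cis (Arg y / sin \<phi> + g) = cis (Arg x / sin \<phi> + g)"
      using r sin_pos by (simp add: rcis_def)
    moreover have "\<bar>Arg y - Arg x\<bar> < 2 * pi * sin \<phi>"
      using assms(2,3) by linarith
    then have "\<bar>Arg y / sin \<phi> + g - (Arg x / sin \<phi> + g)\<bar> < 2 * pi"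
      using sin_pos by (simp add: field_simps flip: diff_divide_distrib)
    ultimately have "Arg y / sin \<phi> + g = Arg x / sin \<phi> + g"
      by (rule cis_eq_imp_eq)
    then have "Arg y = Arg x" using sin_pos by simp
    then show ?thesis using n by (metis rcis_cmod_Arg)
  qed
qed

lemma cup_map_unique:
  assumes x: "(norm x < 1 / sin \<phi> \<and> \<bar>Arg x\<bar> < pi * sin \<phi>) \<or>
      x \<in> ball (of_real (1 / sin \<phi> + 1)) 1 \<or> x = of_real (1 / sin \<phi>)"
    and y: "y \<in> \<Union>(cup_regions \<phi>)" and eq: "cup_map \<phi> g y = cup_map \<phi> g x"
  shows "y = x"
proof -
  have sector: "y = x" if "x \<in> cup_sector \<phi>" "y \<in> cup_sector \<phi>" "\<bar>Arg x\<bar> < pi * sin \<phi>"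
    using cup_side_map_inj[of g y x] that eq by (simp add: cup_map_sector) (simp add: cup_sector_def)
  have lid: "y = x" if "x \<in> cup_lid \<phi>" "y \<in> cup_lid \<phi>"
    using cup_lid_isometric[OF that(2,1), of g] eq by simp
  have height: "cup_map \<phi> g w $ 3 = norm w * cos \<phi>" "norm (horiz (cup_map \<phi> g w)) = norm w * sin \<phi>"
    if "w \<in> cup_sector \<phi>" for w
    using that sin_pos by (simp_all add: cup_map_sector cup_side_map_def)
  have height': "cup_map \<phi> g w $ 3 = cot \<phi>"
    "norm (horiz (cup_map \<phi> g w)) = dist (of_real (1 / sin \<phi> + 1)) w" if "w \<in> cup_lid \<phi>" for w
    using that by (simp_all add: cup_map_lid cup_lid_map_def norm_mult dist_norm
        del: complex_cnj_diff of_real_add)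
  have y: "y \<in> cup_sector \<phi> \<or> y \<in> cup_lid \<phi>"
    using y by (auto simp: cup_regions_def)
  from x show ?thesis
  proof (elim disjE conjE)
    assume x: "norm x < 1 / sin \<phi>" "\<bar>Arg x\<bar> < pi * sin \<phi>"
    then have xs: "x \<in> cup_sector \<phi>" by (simp add: cup_sector_def)
    have "y \<notin> cup_lid \<phi>"
    proof
      assume "y \<in> cup_lid \<phi>"
      from height'(1)[OF this] have "norm x * cos \<phi> = cot \<phi>"
        using height(1)[OF xs] eq by simp
      then show False using x sin_pos cos_pos by (simp add: cot_def field_simps)
    qed
    then show ?thesis using sector xs x y by blast
  next
    assume "x \<in> ball (of_real (1 / sin \<phi> + 1)) 1"
    then have xl: "x \<in> cup_lid \<phi>" "dist (of_real (1 / sin \<phi> + 1)) x < 1"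
      by (simp_all add: cup_lid_def del: of_real_add)
    have "y \<notin> cup_sector \<phi>"
    proof
      assume "y \<in> cup_sector \<phi>"
      note height[OF this]
      then have "norm y * cos \<phi> = cot \<phi>" "norm y * sin \<phi> < 1"
        using height'[OF xl(1)] eq xl(2) by auto
      then show False using sin_pos cos_pos by (simp add: cot_def field_simps)
    qed
    then show ?thesis using lid xl y by blast
  next
    assume x: "x = of_real (1 / sin \<phi>)"
    then have "Arg x = 0" "norm x = 1 / sin \<phi>"
      using sin_pos by (auto simp: Arg_of_real norm_divide)
    moreover from this have "x \<in> cup_sector \<phi>"
      using sector_angle by (simp add: cup_sector_def)
    moreover have "x \<in> cup_lid \<phi>"
      by (simp add: x cup_lid_def dist_norm)
    ultimately show ?thesis
      using y sector lid sector_angle by auto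
  qed
qed

lemma closed_segment_cup_sector:
  assumes "x \<in> cup_sector \<phi>"
  shows "closed_segment 0 x \<subseteq> cup_sector \<phi>"
proof
  fix w assume "w \<in> closed_segment 0 x"
  then obtain u where u: "0 \<le> u" "u \<le> 1" "w = of_real u * x"
    by (auto simp: closed_segment_def scaleR_conv_of_real)
  obtain r t where x: "x = rcis r t" "0 \<le> r" "r \<le> 1 / sin \<phi>" "\<bar>t\<bar> \<le> pi * sin \<phi>"
    using assms unfolding cup_sector_eq by blast
  have "w = rcis (u * r) t" by (simp add: u x rcis_def)
  moreover have "u * r \<le> 1 / sin \<phi>"
    using u x mult_right_mono[of u 1 r] by auto
  ultimately show "w \<in> cup_sector \<phi>"
    using u x by (auto intro: mem_cup_sector_rcis)
qed

lemma interior_cup_sector: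
  assumes "w \<in> interior (cup_sector \<phi>)"
  shows "w \<noteq> 0" "norm w < 1 / sin \<phi>" "\<bar>Arg w\<bar> < pi * sin \<phi>"
proof -
  have w: "w \<in> cup_sector \<phi>" using assms interior_subset by blast
  have out: "rcis r t \<notin> cup_sector \<phi>" if "0 < r" "pi * sin \<phi> < \<bar>t\<bar>" "\<bar>t\<bar> < pi" for r t
    using that Arg_rcis_abs[of r t] by (auto simp: cup_sector_def)
  show 0: "w \<noteq> 0"
  proof
    assume "w = 0"
    have "- of_real \<delta> \<notin> cup_sector \<phi>" if "0 < \<delta>" for \<delta>
      using that sector_angle Arg_of_real[of "- \<delta>"] by (simp add: cup_sector_def)
    then have "- of_real 0 \<notin> interior (cup_sector \<phi>)"
      by (intro not_interior_limit[where d = 1]) (auto intro!: continuous_intros)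
    then show False using assms \<open>w = 0\<close> by simp
  qed
  show "norm w < 1 / sin \<phi>"
  proof (rule ccontr)
    assume "\<not> norm w < 1 / sin \<phi>"
    then have n: "norm w = 1 / sin \<phi>" using w by (auto simp: cup_sector_def)
    have "of_real (1 + \<delta>) * w \<notin> cup_sector \<phi>" if "0 < \<delta>" for \<delta>
    proof -
      have "norm (of_real (1 + \<delta>) * w) = (1 + \<delta>) * (1 / sin \<phi>)"
        unfolding norm_mult n norm_of_real using that by simp
      also have "\<dots> > 1 / sin \<phi>"
        using that sin_pos by (simp add: divide_strict_right_mono)
      finally show ?thesis by (simp add: cup_sector_def del: of_real_add)
    qed
    then have "of_real (1 + 0) * w \<notin> interior (cup_sector \<phi>)"
      by (intro not_interior_limit[where d = 1]) (auto intro!: continuous_intros)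
    then show False using assms by simp
  qed
  show "\<bar>Arg w\<bar> < pi * sin \<phi>"
  proof (rule ccontr)
    assume "\<not> \<bar>Arg w\<bar> < pi * sin \<phi>"
    then have n: "\<bar>Arg w\<bar> = pi * sin \<phi>" using w by (auto simp: cup_sector_def)
    define \<sigma> :: real where "\<sigma> = (if Arg w \<ge> 0 then 1 else - 1)"
    have "Arg w = \<sigma> * (pi * sin \<phi>)"
      using n by (auto simp: \<sigma>_def)
    then have ws: "w = rcis (norm w) (\<sigma> * (pi * sin \<phi>))"
      by (metis rcis_cmod_Arg)
    have "rcis (norm w) (\<sigma> * (pi * sin \<phi> + \<delta>)) \<notin> cup_sector \<phi>" if "0 < \<delta>" "\<delta> < pi - pi * sin \<phi>" for \<delta>
      using that 0 sector_angle by (intro out) (auto simp: \<sigma>_def)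
    moreover have "continuous_on UNIV (\<lambda>\<delta>. rcis (norm w) (\<sigma> * (pi * sin \<phi> + \<delta>)))"
      by (intro continuous_intros)
    ultimately have "rcis (norm w) (\<sigma> * (pi * sin \<phi> + 0)) \<notin> interior (cup_sector \<phi>)"
      using sector_angle
      by (intro not_interior_limit[where d = "pi - pi * sin \<phi>" and f = "\<lambda>\<delta>. rcis (norm w) (\<sigma> * (pi * sin \<phi> + \<delta>))"])
        (auto simp: continuous_on_eq_continuous_at)
    then show False using assms ws by simp
  qed
qed

lemma compact_cup_sector: "compact (cup_sector \<phi>)"
proof -
  have "cup_sector \<phi> = (\<lambda>(r, t). rcis r t) ` ({0..1 / sin \<phi>} \<times> {- (pi * sin \<phi>)..pi * sin \<phi>})"
    unfolding cup_sector_eq by (force simp: abs_le_iff)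
  moreover have "compact ((\<lambda>(r, t). rcis r t) ` ({0..1 / sin \<phi>} \<times> {- (pi * sin \<phi>)..pi * sin \<phi>}))"
    unfolding case_prod_beta
    by (intro compact_continuous_image continuous_intros compact_Times compact_Icc)
  ultimately show ?thesis by simp
qed

lemma plane_region_cup_sector: "plane_region (cup_sector \<phi>)"
proof -
  define s where "s = 1 / sin \<phi>"
  define \<beta> where "\<beta> = pi * sin \<phi>"
  have s: "s > 0" using sin_pos by (simp add: s_def)
  have \<beta>: "0 < \<beta>" "\<beta> < pi" using sector_angle by (auto simp: \<beta>_def)
  define e\<^sub>1 where "e\<^sub>1 = linepath 0 (rcis s (- \<beta>))"
  define e\<^sub>2 where "e\<^sub>2 = part_circlepath 0 s (- \<beta>) \<beta>"
  define e\<^sub>3 where "e\<^sub>3 = linepath (rcis s \<beta>) 0"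
  have image1: "path_image e\<^sub>1 = {rcis u (- \<beta>) | u. 0 \<le> u \<and> u \<le> s}"
    using s by (simp add: e\<^sub>1_def rcis_segment)
  have image2: "path_image e\<^sub>2 = {rcis s t | t. - \<beta> \<le> t \<and> t \<le> \<beta>}"
    using s \<beta> by (auto simp: e\<^sub>2_def path_image_part_circlepath rcis_def cis_conv_exp)
  have image3: "path_image e\<^sub>3 = {rcis u \<beta> | u. 0 \<le> u \<and> u \<le> s}"
    using s by (simp add: e\<^sub>3_def closed_segment_commute[of _ 0] rcis_segment)
  have ends: "pathstart e\<^sub>1 = 0" "pathfinish e\<^sub>1 = rcis s (- \<beta>)" "pathstart e\<^sub>2 = rcis s (- \<beta>)"
    "pathfinish e\<^sub>2 = rcis s \<beta>" "pathstart e\<^sub>3 = rcis s \<beta>" "pathfinish e\<^sub>3 = 0"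
    by (simp_all add: e\<^sub>1_def e\<^sub>2_def e\<^sub>3_def rcis_def cis_conv_exp)
  have radius: "u = v" if "rcis u t = rcis v t'" "0 \<le> u" "0 \<le> v" for u v t t'
    using that by (metis abs_of_nonneg complex_mod_rcis)
  have arc1: "arc (e\<^sub>1 +++ e\<^sub>2)"
  proof (rule arc_join)
    show "arc e\<^sub>1" using s by (auto simp: e\<^sub>1_def intro!: arc_linepath)
    show "arc e\<^sub>2" using s \<beta> by (auto simp: e\<^sub>2_def intro!: arc_part_circlepath)
    show "path_image e\<^sub>1 \<inter> path_image e\<^sub>2 \<subseteq> {pathstart e\<^sub>2}"
      using s radius by (fastforce simp: image1 image2 ends)
  qed (simp add: ends)
  have "path_image (e\<^sub>1 +++ e\<^sub>2) \<inter> path_image e\<^sub>3 \<subseteq> {pathstart (e\<^sub>1 +++ e\<^sub>2), pathstart e\<^sub>3}"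
  proof
    fix w assume "w \<in> path_image (e\<^sub>1 +++ e\<^sub>2) \<inter> path_image e\<^sub>3"
    then have "w \<in> path_image e\<^sub>1 \<or> w \<in> path_image e\<^sub>2" "w \<in> path_image e\<^sub>3"
      by (auto simp: path_image_join ends)
    then obtain u where u: "w = rcis u \<beta>" "0 \<le> u" "u \<le> s"
      and w: "(\<exists>v. w = rcis v (- \<beta>) \<and> 0 \<le> v) \<or> (\<exists>t. w = rcis s t)"
      unfolding image1 image2 image3 by blast
    from w show "w \<in> {pathstart (e\<^sub>1 +++ e\<^sub>2), pathstart e\<^sub>3}"
    proof (elim disjE exE conjE)
      fix v assume v: "w = rcis v (- \<beta>)" "0 \<le> v"
      then have "v = u" using radius[of v "- \<beta>" u \<beta>] u by auto
      have "u = 0"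
      proof (rule ccontr)
        assume "u \<noteq> 0"
        then have "cis (- \<beta>) = cis \<beta>"
          using u v \<open>v = u\<close> by (simp add: rcis_def)
        then have "- \<beta> = \<beta>" by (rule cis_eq_imp_eq) (use \<beta> in auto)
        then show False using \<beta> by simp
      qed
      then show ?thesis using u by (simp add: ends)
    next
      fix t assume "w = rcis s t"
      then have "u = s" using radius[of u \<beta> s t] u s by auto
      then show ?thesis using u by (simp add: ends)
    qed
  qed
  then have simple: "simple_path ((e\<^sub>1 +++ e\<^sub>2) +++ e\<^sub>3)"
    using arc1 s by (intro simple_path_join_loop) (auto simp: ends e\<^sub>3_def intro!: arc_linepath)
  have valid: "valid_path ((e\<^sub>1 +++ e\<^sub>2) +++ e\<^sub>3)"
    by (intro valid_path_join) (auto simp: ends, auto simp: e\<^sub>1_def e\<^sub>2_def e\<^sub>3_def)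
  have image: "path_image ((e\<^sub>1 +++ e\<^sub>2) +++ e\<^sub>3) = path_image e\<^sub>1 \<union> path_image e\<^sub>2 \<union> path_image e\<^sub>3"
    by (simp add: path_image_join ends)
  define U where "U = {w \<in> - \<real>\<^sub>\<le>\<^sub>0. norm w < s \<and> \<bar>Arg w\<bar> < \<beta>}"
  have "open U"
  proof -
    have "open ((- \<real>\<^sub>\<le>\<^sub>0) \<inter> Arg -` {- \<beta><..<\<beta>})"
      by (rule continuous_open_preimage[OF continuous_on_Arg]) (auto simp: open_Compl)
    moreover have "U = ((- \<real>\<^sub>\<le>\<^sub>0) \<inter> Arg -` {- \<beta><..<\<beta>}) \<inter> ball 0 s"
      by (auto simp: U_def)
    ultimately show ?thesis by auto
  qed
  moreover have "U \<subseteq> cup_sector \<phi>"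
    by (auto simp: U_def cup_sector_def s_def \<beta>_def)
  ultimately have "U \<subseteq> interior (cup_sector \<phi>)"
    by (simp add: interior_maximal)
  moreover have "cup_sector \<phi> \<subseteq> U \<union> path_image ((e\<^sub>1 +++ e\<^sub>2) +++ e\<^sub>3)"
  proof
    fix w assume w: "w \<in> cup_sector \<phi>"
    have rep: "w = rcis (norm w) (Arg w)" by (simp add: rcis_cmod_Arg)
    have le: "0 \<le> norm w" "norm w \<le> s" "\<bar>Arg w\<bar> \<le> \<beta>"
      using w by (auto simp: cup_sector_def s_def \<beta>_def)
    consider "w = 0" | "Arg w = \<beta>" | "Arg w = - \<beta>" | "norm w = s" | "w \<noteq> 0" "norm w < s" "\<bar>Arg w\<bar> < \<beta>"
      using le by linarith
    then show "w \<in> U \<union> path_image ((e\<^sub>1 +++ e\<^sub>2) +++ e\<^sub>3)"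
    proof cases
      case 1
      then have "w = rcis 0 \<beta>" by simp
      then show ?thesis using s unfolding image image3 by force
    next
      case 2
      then have "w \<in> path_image e\<^sub>3" unfolding image3 using rep le by auto
      then show ?thesis by (simp add: image)
    next
      case 3
      then have "w \<in> path_image e\<^sub>1" unfolding image1 using rep le by auto
      then show ?thesis by (simp add: image)
    next
      case 4
      then have "w \<in> path_image e\<^sub>2" unfolding image2 using rep le by auto
      then show ?thesis by (simp add: image)
    next
      case 5
      then show ?thesis using cup_sector_slit[OF w] by (simp add: U_def)
    qed
  qed
  moreover have "path_image ((e\<^sub>1 +++ e\<^sub>2) +++ e\<^sub>3) \<subseteq> cup_sector \<phi>"
    unfolding image image1 image2 image3 using \<beta> s
    by (auto simp: s_def \<beta>_def intro!: mem_cup_sector_rcis)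
  moreover have "w \<notin> interior (cup_sector \<phi>)" if w: "w \<in> path_image ((e\<^sub>1 +++ e\<^sub>2) +++ e\<^sub>3)" for w
  proof
    assume "w \<in> interior (cup_sector \<phi>)"
    note int = interior_cup_sector[OF this]
    from w consider u where "w = rcis u \<beta>" "0 \<le> u" | u where "w = rcis u (- \<beta>)" "0 \<le> u" | t where "w = rcis s t"
      unfolding image image1 image2 image3 by blast
    then show False
    proof cases
      case (1 u)
      then have "u > 0" using int(1) by (cases "u = 0") auto
      then show ?thesis using 1 int(3) Arg_rcis_abs[of u \<beta>] \<beta> by (simp add: \<beta>_def)
    next
      case (2 u)
      then have "u > 0" using int(1) by (cases "u = 0") auto
      then show ?thesis using 2 int(3) Arg_rcis_abs[of u "- \<beta>"] \<beta> by (simp add: \<beta>_def)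
    next
      case 3
      then show ?thesis using int(2) s by (simp add: s_def)
    qed
  qed
  ultimately have "path_image ((e\<^sub>1 +++ e\<^sub>2) +++ e\<^sub>3) = cup_sector \<phi> - interior (cup_sector \<phi>)"
    by blast
  also have "\<dots> = frontier (cup_sector \<phi>)"
    using compact_imp_closed[OF compact_cup_sector] by (simp add: frontier_def)
  finally have frontier: "path_image ((e\<^sub>1 +++ e\<^sub>2) +++ e\<^sub>3) = frontier (cup_sector \<phi>)" .
  have "0 \<in> cup_sector \<phi>"
    using s \<beta> mem_cup_sector_rcis[of 0 0] by (simp add: s_def \<beta>_def)
  then have "starlike (cup_sector \<phi>)"
    unfolding starlike_def using closed_segment_cup_sector by blast
  then have "simply_connected (cup_sector \<phi>)"
    by (rule starlike_imp_simply_connected)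
  moreover have "pathfinish ((e\<^sub>1 +++ e\<^sub>2) +++ e\<^sub>3) = pathstart ((e\<^sub>1 +++ e\<^sub>2) +++ e\<^sub>3)"
    by (simp add: ends)
  ultimately show ?thesis
    unfolding plane_region_def using compact_cup_sector simple valid frontier by blast
qed

end

context cone_angle
begin

lemma cup_layout_cup_map: "cup_layout \<phi> (cup_regions \<phi>) (cup_map \<phi> g)"
proof -
  define \<beta> where "\<beta> = pi * sin \<phi>"
  define M where "M = (*) (cis (- \<beta>))"
  have \<beta>: "0 < \<beta>" "\<beta> < pi" using sector_angle by (auto simp: \<beta>_def)
  have s: "slant_height \<phi> = 1 / sin \<phi>" by (simp add: slant_height_def)
  have \<alpha>: "2 * pi / (1 / sin \<phi>) = 2 * \<beta>" by (simp add: \<beta>_def)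
  have M_rcis: "M (of_real r * cis t) = rcis r (t - \<beta>)" for r t
    by (simp add: M_def rcis_def cis_mult mult.left_commute)
  have side: "M ` sector (1 / sin \<phi>) (2 * \<beta>) = cup_sector \<phi>"
  proof (intro equalityI subsetI)
    fix w assume "w \<in> M ` sector (1 / sin \<phi>) (2 * \<beta>)"
    then show "w \<in> cup_sector \<phi>"
      by (auto simp: sector_def M_rcis abs_le_iff intro!: mem_cup_sector_rcis simp flip: \<beta>_def)
  next
    fix w assume "w \<in> cup_sector \<phi>"
    then obtain r t where w: "w = rcis r t" "0 \<le> r" "r \<le> 1 / sin \<phi>" "\<bar>t\<bar> \<le> \<beta>"
      unfolding cup_sector_eq \<beta>_def by blast
    then have "w = M (of_real r * cis (t + \<beta>))"
      by (simp add: M_rcis)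
    moreover have "of_real r * cis (t + \<beta>) \<in> sector (1 / sin \<phi>) (2 * \<beta>)"
      unfolding sector_def using w by (intro CollectI exI[of _ r] exI[of _ "t + \<beta>"]) auto
    ultimately show "w \<in> M ` sector (1 / sin \<phi>) (2 * \<beta>)" by blast
  qed
  have inv: "cis \<beta> * (cis (- \<beta>) * w) = w" "cis (- \<beta>) * (cis \<beta> * w) = w" for w
    by (simp_all add: cis_mult flip: mult.assoc)
  have lid: "M ` cball (of_real (1 / sin \<phi> + 1) * cis \<beta>) 1 = cup_lid \<phi>"
  proof (rule set_eqI)
    fix w
    have "w \<in> M ` cball (of_real (1 / sin \<phi> + 1) * cis \<beta>) 1 \<longleftrightarrow>
        cis \<beta> * w \<in> cball (of_real (1 / sin \<phi> + 1) * cis \<beta>) 1"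
      unfolding M_def image_iff using inv by metis
    also have "\<dots> \<longleftrightarrow> norm (cis \<beta> * (of_real (1 / sin \<phi> + 1) - w)) \<le> 1"
      by (simp add: dist_norm algebra_simps)
    also have "\<dots> \<longleftrightarrow> w \<in> cup_lid \<phi>"
      by (simp add: norm_mult cup_lid_def dist_norm)
    finally show "w \<in> M ` cball (of_real (1 / sin \<phi> + 1) * cis \<beta>) 1 \<longleftrightarrow> w \<in> cup_lid \<phi>" .
  qed
  have q_rcis: "cup_map \<phi> g (rcis r t) = at_height (rcis (r * sin \<phi>) (t / sin \<phi> + g)) (r * cos \<phi>)"
    if "0 \<le> r" "r \<le> 1 / sin \<phi>" "\<bar>t\<bar> \<le> \<beta>" for r t
  proof -
    have "\<bar>t\<bar> < pi" using that(3) \<beta>(2) by linarith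
    then show ?thesis
      using that cup_map_sector[OF mem_cup_sector_rcis] by (simp add: cup_side_map_rcis \<beta>_def)
  qed
  have cut: "cup_map \<phi> g (M (of_real r)) = cup_map \<phi> g (M (of_real r * cis (2 * \<beta>)))"
    if "r \<in> {0..1 / sin \<phi>}" for r
  proof -
    have M': "M (of_real r) = rcis r (- \<beta>)" using M_rcis[of r 0] by simp
    have "cis (g - pi) = cis (g + pi)"
      by (simp flip: cis_mult cis_divide)
    moreover have "- \<beta> / sin \<phi> + g = g - pi" "\<beta> / sin \<phi> + g = g + pi"
      using sin_pos by (simp_all add: \<beta>_def)
    ultimately have "rcis (r * sin \<phi>) (- \<beta> / sin \<phi> + g) = rcis (r * sin \<phi>) (\<beta> / sin \<phi> + g)"
      by (simp only: rcis_def)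
    then show ?thesis
      using that \<beta> unfolding M' M_rcis by (simp add: q_rcis)
  qed
  have glue: "cup_map \<phi> g (M (of_real (1 / sin \<phi>) * cis t)) =
      cup_map \<phi> g (M (of_real (1 / sin \<phi> + 1) * cis \<beta> - cis (\<beta> - 1 / sin \<phi> * (t - \<beta>))))"
    if "t \<in> {0..2 * \<beta>}" for t
  proof -
    define \<psi> where "\<psi> = 1 / sin \<phi> * (t - \<beta>)"
    let ?w = "of_real (1 / sin \<phi> + 1) - cis (- \<psi>)"
    have w: "M (of_real (1 / sin \<phi> + 1) * cis \<beta> - cis (\<beta> - \<psi>)) = ?w"
      unfolding M_def right_diff_distrib using inv(2)[of "of_real (1 / sin \<phi> + 1)"]
      by (simp add: cis_mult mult.commute mult.left_commute)
    have D: "?w \<in> cup_lid \<phi>"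
      by (simp add: cup_lid_def dist_norm)
    have "cnj (of_real (1 / sin \<phi> + 1) - ?w) * cis g = cis (\<psi> + g)"
      by (simp add: cis_cnj cis_mult)
    then have "cup_map \<phi> g ?w = at_height (cis (\<psi> + g)) (cot \<phi>)"
      unfolding cup_map_lid[OF D] cup_lid_map_def by (rule arg_cong)
    moreover have "cup_map \<phi> g (rcis (1 / sin \<phi>) (t - \<beta>)) =
        at_height (rcis (1 / sin \<phi> * sin \<phi>) ((t - \<beta>) / sin \<phi> + g)) (1 / sin \<phi> * cos \<phi>)"
      using that sin_pos by (intro q_rcis) auto
    then have "cup_map \<phi> g (rcis (1 / sin \<phi>) (t - \<beta>)) = at_height (cis (\<psi> + g)) (cot \<phi>)"
      using sin_pos by (simp add: \<psi>_def cot_def cis_rcis_eq)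
    ultimately show ?thesis
      unfolding w[unfolded \<psi>_def] M_rcis by (simp add: \<psi>_def)
  qed
  have "plane_isometry M"
    by (simp add: plane_isometry_def M_def dist_norm norm_mult flip: right_diff_distrib)
  then show ?thesis
    unfolding cup_layout_def Let_def s \<alpha>
    using side lid cut glue cup_map_image_sector cup_map_image_lid \<beta>
    by (intro exI[of _ M] exI[of _ \<beta>] conjI) (auto simp: cup_regions_def)
qed

lemma flat_model_cup: "flat_model (conical_cup \<phi>) (cup_regions \<phi>) (cup_map \<phi> g)"
proof -
  have lid0: "0 \<notin> cup_lid \<phi>"
    using cup_lid_beyond(1)[of 0] sin_pos by (auto simp: divide_le_0_iff)
  have "flat_decomposition (conical_cup \<phi>) (cup_regions \<phi>) (cup_map \<phi> g)"
  proof (rule flat_decompositionI[where p = 0])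
    show "plane_region R" if "R \<in> cup_regions \<phi>" for R
      using that plane_region_cup_sector by (auto simp: cup_regions_def cup_lid_def plane_region_cball)
    show "cup_map \<phi> g ` \<Union>(cup_regions \<phi>) = conical_cup \<phi>"
      by (simp add: cup_regions_def conical_cup_def image_Un cup_map_image_sector cup_map_image_lid)
    show "short_on R (cup_map \<phi> g)" if "R \<in> cup_regions \<phi>" for R
      using that cup_sector_short short_onI[OF order_eq_refl[OF cup_lid_isometric]]
      by (auto simp: cup_regions_def)
    show "nearly_isometric_at R (cup_map \<phi> g) x" if "R \<in> cup_regions \<phi>" "x \<in> R" "x \<noteq> 0" for R x
      using that cup_sector_nearly_isometric[of x g]
        nearly_isometric_at_isometry[OF cup_lid_isometric[where g = g]]
      by (auto simp: cup_regions_def)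
    show "dist (cup_map \<phi> g x) (cup_map \<phi> g 0) = dist x 0" if "R \<in> cup_regions \<phi>" "x \<in> R" "0 \<in> R" for R x
      using that lid0 by (auto simp: cup_regions_def cup_map_sector dist_cup_side_map)
    show "y = x" if "R \<in> cup_regions \<phi>" "x \<in> interior R" "y \<in> \<Union>(cup_regions \<phi>)" "cup_map \<phi> g y = cup_map \<phi> g x" for R x y
    proof (rule cup_map_unique[OF _ that(3,4)])
      from that(1) consider "R = cup_sector \<phi>" | "R = cup_lid \<phi>" by (auto simp: cup_regions_def)
      then show "(norm x < 1 / sin \<phi> \<and> \<bar>Arg x\<bar> < pi * sin \<phi>) \<or>
          x \<in> ball (of_real (1 / sin \<phi> + 1)) 1 \<or> x = of_real (1 / sin \<phi>)"
        using that(2) interior_cup_sector[of x] by cases (simp_all add: cup_lid_def interior_cball del: of_real_add)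
    qed
  qed (simp add: cup_regions_def)
  then show ?thesis
    unfolding flat_model_def using angle cup_layout_cup_map by blast
qed

lemma mem_conical_cup: "p \<in> conical_cup \<phi> \<longleftrightarrow> p \<in> cup_side \<phi> \<or> p \<in> horizontal_disk (cot \<phi>)"
  by (auto simp: conical_cup_def)

lemma continuous_on_cup_chart: "continuous_on {p. 0 < Re (horiz p * cis (- g))} (cup_chart \<phi> g)"
  unfolding cup_chart_def
  by (intro continuous_intros) (use cos_pos in \<open>auto simp: complex_nonpos_Reals_iff\<close>)

lemma cup_side_dist_apex:
  assumes "p \<in> cup_side \<phi>"
  shows "dist p (at_height 0 0) = p $ 3 / cos \<phi>"
proof -
  have p: "norm (horiz p) = p $ 3 * tan \<phi>" "0 \<le> p $ 3"
    using assms cup_side_eq[OF angle] by auto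
  have "(p $ 3 * tan \<phi>)\<^sup>2 + (p $ 3)\<^sup>2 = (p $ 3 / cos \<phi>)\<^sup>2"
  proof -
    have "(p $ 3 * tan \<phi>)\<^sup>2 + (p $ 3)\<^sup>2 = (p $ 3)\<^sup>2 * (1 + (tan \<phi>)\<^sup>2)"
      by (simp add: power_mult_distrib distrib_left)
    also have "\<dots> = (p $ 3 / cos \<phi>)\<^sup>2"
      using tan_sec[of \<phi>] cos_pos by (simp add: power_mult_distrib divide_inverse)
    finally show ?thesis .
  qed
  then show ?thesis
    using dist_at_height[of "horiz p" "p $ 3" 0 0] p cos_pos by simp
qed

lemma cup_chart_axis:
  assumes p: "p \<in> cup_side \<phi>" and "0 < p $ 3"
  shows "cup_chart \<phi> (Arg (horiz p)) p = of_real (p $ 3 / cos \<phi>)"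
proof -
  have n: "norm (horiz p) > 0"
    using assms cup_side_eq[OF angle] tan_pos by auto
  have "horiz p = rcis (norm (horiz p)) (Arg (horiz p))"
    by (simp add: rcis_cmod_Arg)
  then have "horiz p * cis (- Arg (horiz p)) = of_real (norm (horiz p))"
    by (metis add.right_inverse cis_mult cis_zero mult.assoc mult.right_neutral rcis_def)
  then have "Arg (horiz p * cis (- Arg (horiz p))) = 0"
    using n by (simp add: Arg_of_real)
  then show ?thesis by (simp add: cup_chart_def rcis_def)
qed

lemma chord_in_cup_sector:
  assumes r: "0 < r" "r \<le> 1 / sin \<phi>" and \<theta>: "\<bar>\<theta>\<bar> \<le> pi * sin \<phi>" "\<bar>\<theta>\<bar> < pi / 2"
  shows "closed_segment (rcis r (- \<theta>)) (rcis r \<theta>) \<subseteq> cup_sector \<phi>"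
proof
  fix w assume "w \<in> closed_segment (rcis r (- \<theta>)) (rcis r \<theta>)"
  then obtain u where u: "0 \<le> u" "u \<le> 1" "w = (1 - u) *\<^sub>R rcis r (- \<theta>) + u *\<^sub>R rcis r \<theta>"
    by (auto simp: closed_segment_def)
  have Re: "Re w = r * cos \<theta>" and Im: "Im w = (2 * u - 1) * (r * sin \<theta>)"
    by (simp_all add: u algebra_simps)
  have cos: "0 < cos \<theta>" using \<theta> by (intro cos_gt_zero_pi) auto
  have "norm w \<le> (1 - u) * r + u * r"
    using norm_triangle_ineq[of "(1 - u) *\<^sub>R rcis r (- \<theta>)" "u *\<^sub>R rcis r \<theta>"] u r by simp
  then have "norm w \<le> 1 / sin \<phi>" using r by (simp add: algebra_simps)
  moreover have "\<bar>Arg w\<bar> \<le> \<bar>\<theta>\<bar>"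
  proof -
    have "Im w / Re w = (2 * u - 1) * tan \<theta>"
      using Re Im r cos by (simp add: tan_def)
    then have A: "Arg w = arctan ((2 * u - 1) * tan \<theta>)"
      using arg_conv_arctan[of w] Re r cos by simp
    have "\<bar>(2 * u - 1) * tan \<theta>\<bar> \<le> 1 * \<bar>tan \<theta>\<bar>"
      unfolding abs_mult using u by (intro mult_right_mono) auto
    also have "\<bar>tan \<theta>\<bar> = tan \<bar>\<theta>\<bar>"
      using \<theta> tan_gt_zero[of \<theta>] tan_gt_zero[of "- \<theta>"] by (cases \<theta> "0::real" rule: linorder_cases) auto
    finally have "\<bar>(2 * u - 1) * tan \<theta>\<bar> \<le> tan \<bar>\<theta>\<bar>" by simp
    then have "arctan \<bar>(2 * u - 1) * tan \<theta>\<bar> \<le> arctan (tan \<bar>\<theta>\<bar>)"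
      by (simp only: arctan_le_iff)
    also have "\<dots> = \<bar>\<theta>\<bar>" using \<theta> by (intro arctan_tan) auto
    finally show ?thesis
      unfolding A by (cases "(2 * u - 1) * tan \<theta> \<ge> 0") (auto simp: abs_if arctan_minus)
  qed
  ultimately show "w \<in> cup_sector \<phi>"
    using \<theta> by (simp add: cup_sector_def)
qed

lemma Arg_near_axis:
  assumes "0 < r"
  obtains \<eta> where "0 < \<eta>" "ball (of_real r) \<eta> \<inter> cball 0 (1 / sin \<phi>) \<subseteq> cup_sector \<phi> - {0}"
proof -
  have "of_real r \<notin> \<real>\<^sub>\<le>\<^sub>0" "Arg (of_real r) = 0"
    using assms by (simp_all add: Arg_of_real)
  then obtain \<delta> where \<delta>: "\<delta> > 0" "\<And>w. dist w (of_real r) < \<delta> \<Longrightarrow> \<bar>Arg w\<bar> < pi * sin \<phi>"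
    using continuous_at_Arg[of "of_real r"] sector_angle(2) unfolding continuous_at_eps_delta
    by (metis dist_0_norm dist_commute real_norm_def)
  have "ball (of_real r) (min \<delta> r) \<inter> cball 0 (1 / sin \<phi>) \<subseteq> cup_sector \<phi> - {0}"
    using \<delta>(2) assms by (force simp: cup_sector_def dist_commute dist_norm)
  then show ?thesis
    using that[of "min \<delta> r"] \<delta>(1) assms by auto
qed

end

lemma not_through_apex:
  assumes "shortest_path S \<gamma> a b c" "cone_angle \<phi>" and S: "S = conical_cup \<phi>" and t: "t \<in> {a<..<b}"
  shows "\<gamma> t \<noteq> at_height 0 0"
proof
  interpret shortest_path S \<gamma> a b c by fact
  interpret cone_angle \<phi> by fact
  assume apex: "\<gamma> t = at_height 0 0"
  obtain d where d: "0 < d" "a \<le> t - d" "t + d \<le> b" "\<And>w. w \<in> {t - d..t + d} \<Longrightarrow> \<gamma> w \<in> S \<inter> ball (\<gamma> t) (cot \<phi>)"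
    using near_time[OF t cot_pos] by blast
  have in_side: "\<gamma> w \<in> cup_side \<phi>" if "w \<in> {t - d..t + d}" for w
  proof -
    have "\<gamma> w $ 3 < cot \<phi>"
      using d(4)[OF that] dist_height_le[of "\<gamma> w" "\<gamma> t"] by (auto simp: apex dist_commute)
    then show ?thesis
      using d(4)[OF that] by (auto simp: S mem_conical_cup horizontal_disk_eq)
  qed
  define P Q where "P = \<gamma> (t - d)" and "Q = \<gamma> (t + d)"
  have PQ: "P \<in> cup_side \<phi>" "Q \<in> cup_side \<phi>"
    unfolding P_def Q_def using d(1) by (auto intro!: in_side)
  have sub: "cup_map \<phi> g ` cup_sector \<phi> \<subseteq> S" for g
    by (auto simp: cup_map_image_sector S conical_cup_def)
  have radial: "joinable S (\<gamma> t) p (p $ 3 / cos \<phi>)" if "p \<in> cup_side \<phi>" for p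
  proof -
    have "joinable S (cup_map \<phi> 0 0) (cup_map \<phi> 0 (cup_chart \<phi> 0 p)) (dist 0 (cup_chart \<phi> 0 p))"
      by (rule joinable_segment[OF cup_sector_short closed_segment_cup_sector sub])
        (use cup_chart[OF that] in auto)
    moreover have "cup_map \<phi> 0 0 = \<gamma> t"
      using sin_pos by (simp add: apex cup_map_def cup_side_map_def)
    ultimately show ?thesis
      using cup_chart[OF that, of 0] by simp
  qed
  have "c * (t - (t - d)) \<le> P $ 3 / cos \<phi>"
    using joinable_sym[OF radial[OF PQ(1)]] d by (intro shortest) (auto simp: P_def)
  moreover have "P $ 3 / cos \<phi> \<le> c * (t - (t - d))"
    using lipschitz[of "t - d" t] d cup_side_dist_apex[OF PQ(1)] by (simp add: P_def apex)
  ultimately have P: "P $ 3 / cos \<phi> = c * d" by simp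
  have "c * (t + d - t) \<le> Q $ 3 / cos \<phi>"
    using radial[OF PQ(2)] d by (intro shortest) (auto simp: Q_def)
  moreover have "Q $ 3 / cos \<phi> \<le> c * (t + d - t)"
    using lipschitz[of t "t + d"] d cup_side_dist_apex[OF PQ(2)] by (simp add: Q_def apex dist_commute)
  ultimately have Q: "Q $ 3 / cos \<phi> = c * d" by simp
  define D where "D = Arg (horiz Q * cis (- Arg (horiz P)))"
  define g where "g = Arg (horiz P) + D / 2"
  have D: "- pi < D" "D \<le> pi" using Arg_bounded[of "horiz Q * cis (- Arg (horiz P))"] by (auto simp: D_def)
  have r: "c * d > 0" using c_pos d by simp
  have pos: "norm (horiz P) > 0" "norm (horiz Q) > 0"
  proof -
    have "0 < P $ 3 / cos \<phi>" "0 < Q $ 3 / cos \<phi>" using P Q r by simp_all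
    then have "0 < P $ 3" "0 < Q $ 3" using cos_pos by (auto simp: zero_less_divide_iff)
    then show "norm (horiz P) > 0" "norm (horiz Q) > 0"
      using PQ tan_pos by (auto simp: cup_side_eq[OF angle])
  qed
  have "horiz P * cis (- g) = rcis (norm (horiz P)) (- (D / 2))"
    by (simp only: cis_diff_Arg) (simp add: g_def)
  then have "Arg (horiz P * cis (- g)) = - (D / 2)"
    using D pos by (simp add: Arg_rcis_abs)
  then have chart_P: "cup_chart \<phi> g P = rcis (c * d) (- (sin \<phi> * (D / 2)))"
    by (simp add: cup_chart_def P)
  have "horiz Q * cis (- Arg (horiz P)) = rcis (norm (horiz Q)) D"
    using rcis_cmod_Arg[of "horiz Q * cis (- Arg (horiz P))"] by (simp add: D_def norm_mult)
  then have "horiz Q * cis (- Arg (horiz P)) * cis (- (D / 2)) = rcis (norm (horiz Q)) (D / 2)"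
    by (simp add: rcis_def mult.assoc cis_mult)
  then have "horiz Q * cis (- g) = rcis (norm (horiz Q)) (D / 2)"
    by (simp add: g_def mult.assoc cis_mult)
  then have "Arg (horiz Q * cis (- g)) = D / 2"
    using D pos by (simp add: Arg_rcis_abs)
  then have chart_Q: "cup_chart \<phi> g Q = rcis (c * d) (sin \<phi> * (D / 2))"
    by (simp only: cup_chart_def Q)
  define \<theta> where "\<theta> = sin \<phi> * (D / 2)"
  have "\<bar>D / 2\<bar> \<le> pi / 2" using D by auto
  then have \<theta>: "\<bar>\<theta>\<bar> \<le> sin \<phi> * (pi / 2)"
    unfolding \<theta>_def abs_mult using sin_pos by simp
  have \<theta>': "\<bar>\<theta>\<bar> \<le> pi * sin \<phi>" "\<bar>\<theta>\<bar> < pi / 2"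
  proof -
    have "sin \<phi> * (pi / 2) = pi * sin \<phi> / 2" by simp
    then show "\<bar>\<theta>\<bar> \<le> pi * sin \<phi>" "\<bar>\<theta>\<bar> < pi / 2"
      using \<theta> sector_angle by linarith+
  qed
  have "c * d \<le> 1 / sin \<phi>"
    using cup_chart(1,3)[OF PQ(1), of g] P by (simp add: cup_sector_def)
  then have "joinable S (cup_map \<phi> g (cup_chart \<phi> g P)) (cup_map \<phi> g (cup_chart \<phi> g Q))
      (dist (cup_chart \<phi> g P) (cup_chart \<phi> g Q))"
    using r \<theta>' unfolding chart_P chart_Q \<theta>_def[symmetric]
    by (intro joinable_segment[OF cup_sector_short _ sub] chord_in_cup_sector)
  then have "c * (t + d - (t - d)) \<le> dist (cup_chart \<phi> g P) (cup_chart \<phi> g Q)"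
    using cup_chart(2)[OF PQ(1), of g] cup_chart(2)[OF PQ(2), of g] d
    by (intro shortest) (auto simp: P_def Q_def)
  moreover have "dist (cup_chart \<phi> g P) (cup_chart \<phi> g Q) < 2 * (c * d)"
  proof -
    have "(dist (cup_chart \<phi> g P) (cup_chart \<phi> g Q))\<^sup>2 = 4 * (c * d) * (c * d) * (sin ((- \<theta> - \<theta>) / 2))\<^sup>2"
      unfolding chart_P chart_Q \<theta>_def[symmetric] dist_norm norm_rcis_diff by simp
    also have "\<dots> = (2 * (c * d))\<^sup>2 * (sin \<theta>)\<^sup>2"
      by (simp add: power2_eq_square)
    also have "\<dots> < (2 * (c * d))\<^sup>2 * 1"
    proof (rule mult_strict_left_mono)
      have "0 < cos \<theta>" using \<theta>' by (intro cos_gt_zero_pi) auto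
      then show "(sin \<theta>)\<^sup>2 < 1" using sin_cos_squared_add[of \<theta>] by (smt (verit) zero_less_power)
      show "0 < (2 * (c * d))\<^sup>2" using r by (intro zero_less_power) simp
    qed
    finally have "(dist (cup_chart \<phi> g P) (cup_chart \<phi> g Q))\<^sup>2 < (2 * (c * d))\<^sup>2"
      by (simp only: mult_1_right)
    then show ?thesis
      by (rule power2_less_imp_less) (use r in linarith)
  qed
  ultimately show False by simp
qed

lemma (in cone_angle) cup_chart_near:
  assumes p: "p \<in> cup_side \<phi>" "0 < p $ 3" and "0 < \<eta>"
  obtains \<rho> where "0 < \<rho>"
    "ball p \<rho> \<subseteq> {p'. 0 < Re (horiz p' * cis (- Arg (horiz p)))} \<inter>
       cup_chart \<phi> (Arg (horiz p)) -` ball (of_real (p $ 3 / cos \<phi>)) \<eta>"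
proof -
  let ?g = "Arg (horiz p)"
  let ?U = "{p'. 0 < Re (horiz p' * cis (- ?g))}"
  have eq: "horiz p * cis (- ?g) = of_real (norm (horiz p))"
    using cis_diff_Arg[of "horiz p" ?g] by (simp add: rcis_def)
  have "norm (horiz p) > 0"
    using p cup_side_eq[OF angle] tan_pos by auto
  then have "p \<in> ?U \<inter> cup_chart \<phi> ?g -` ball (of_real (p $ 3 / cos \<phi>)) \<eta>"
    using cup_chart_axis[OF p] \<open>0 < \<eta>\<close> unfolding Int_iff vimage_eq mem_Collect_eq eq by simp
  moreover have "open ?U"
    by (intro open_Collect_less continuous_intros)
  then have "open (?U \<inter> cup_chart \<phi> ?g -` ball (of_real (p $ 3 / cos \<phi>)) \<eta>)"
    by (intro continuous_open_preimage continuous_on_cup_chart) auto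
  ultimately show ?thesis
    using that unfolding open_contains_ball by blast
qed

lemma cup_geodesic_at:
  assumes "shortest_path S \<gamma> a b c" "cone_angle \<phi>" and S: "S = conical_cup \<phi>" and t: "t \<in> {a<..<b}"
  shows "\<exists>F q m. flat_model S F q \<and> \<Union>F \<inter> q -` {\<gamma> t} = {m} \<and> straight_at F q \<gamma> a b t m"
proof -
  interpret shortest_path S \<gamma> a b c by fact
  interpret cone_angle \<phi> by fact
  define p where "p = \<gamma> t"
  define g where "g = Arg (horiz p)"
  let ?F = "cup_regions \<phi>" and ?q = "cup_map \<phi> g"
  have pS: "p \<in> conical_cup \<phi>"
    using subsetD[OF in_S imageI[of t]] t unfolding S p_def by simp
  have sub: "cup_sector \<phi> \<subseteq> \<Union>?F" "cup_lid \<phi> \<subseteq> \<Union>?F"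
    by (auto simp: cup_regions_def)
  have q_sub: "?q ` cup_sector \<phi> \<subseteq> S" "?q ` cup_lid \<phi> \<subseteq> S"
    unfolding S conical_cup_def cup_map_image_sector cup_map_image_lid by blast+
  have finish: ?thesis if m: "m \<in> \<Union>?F" "?q m = p" "straight_at ?F ?q \<gamma> a b t m"
    and unique: "(norm m < 1 / sin \<phi> \<and> \<bar>Arg m\<bar> < pi * sin \<phi>) \<or>
      m \<in> ball (of_real (1 / sin \<phi> + 1)) 1 \<or> m = of_real (1 / sin \<phi>)" for m
  proof (intro exI conjI)
    have "y = m" if "y \<in> \<Union>?F" "?q y = p" for y
      by (rule cup_map_unique[OF unique that(1), of g]) (simp add: that(2) m(2))
    then show "\<Union>?F \<inter> ?q -` {\<gamma> t} = {m}"
      using m(1,2) unfolding p_def[symmetric] by blast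
    show "flat_model S ?F ?q"
      unfolding S by (rule flat_model_cup)
  qed (rule m(3))
  have "p \<noteq> at_height 0 0"
    unfolding p_def by (rule not_through_apex[OF assms])
  moreover have "p = at_height 0 0" if "p \<in> cup_side \<phi>" "p $ 3 = 0"
  proof -
    have "horiz p = 0" using that cup_side_eq[OF angle] by auto
    then show ?thesis using that(2) by (metis at_height_horiz)
  qed
  moreover have "cot \<phi> * tan \<phi> = 1"
    using sin_pos cos_pos by (simp add: cot_def tan_def)
  ultimately consider (side) "p \<in> cup_side \<phi>" "0 < p $ 3" "p $ 3 < cot \<phi>"
    | (rim) "p \<in> cup_side \<phi>" "norm (horiz p) = 1" "p $ 3 = cot \<phi>"
    | (lid) "norm (horiz p) < 1" "p $ 3 = cot \<phi>"
    using pS cot_pos unfolding mem_conical_cup cup_side_eq[OF angle] horizontal_disk_eq mem_Collect_eq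
    by (metis less_eq_real_def)
  then show ?thesis
  proof cases
    case side
    define r where "r = p $ 3 / cos \<phi>"
    have r: "0 < r" using side cos_pos by (simp add: r_def)
    obtain \<eta> where \<eta>: "0 < \<eta>" "ball (of_real r) \<eta> \<inter> cball 0 (1 / sin \<phi>) \<subseteq> cup_sector \<phi> - {0}"
      using Arg_near_axis[OF r] by blast
    define C where "C = ball (complex_of_real r) \<eta> \<inter> cball 0 (1 / sin \<phi>)"
    have C: "C \<subseteq> cup_sector \<phi>" "0 \<notin> C" unfolding C_def using \<eta>(2) by blast+
    obtain \<rho> where \<rho>: "0 < \<rho>" "ball p \<rho> \<subseteq> {p'. 0 < Re (horiz p' * cis (- g))} \<inter>
       cup_chart \<phi> g -` ball (of_real r) \<eta>"
      using cup_chart_near[OF side(1,2) \<eta>(1)] unfolding g_def r_def by blast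
    define \<rho>' where "\<rho>' = min \<rho> (cot \<phi> - p $ 3)"
    have \<rho>': "0 < \<rho>'" "\<rho>' \<le> \<rho>" "\<rho>' \<le> cot \<phi> - p $ 3" using \<rho> side by (auto simp: \<rho>'_def)
    have in_side: "p' \<in> cup_side \<phi>" if "p' \<in> S \<inter> ball p \<rho>'" for p'
      using that \<rho>' dist_height_le[of p p'] by (auto simp: S mem_conical_cup horizontal_disk_eq)
    have m: "cup_chart \<phi> g p = of_real r"
      using cup_chart_axis[OF side(1,2)] by (simp add: g_def r_def)
    have st: "straight_at ?F ?q \<gamma> a b t (cup_chart \<phi> g (\<gamma> t))"
    proof (rule straight_at_regular_point[OF t \<rho>'(1)])
      show "convex C" by (simp add: C_def convex_Int)
      show "short_on C ?q" using cup_sector_short C(1) by (rule short_on_subset)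
      show "?q ` C \<subseteq> S" "C \<subseteq> \<Union>?F" using C(1) q_sub(1) sub(1) by blast+
      show "nearly_isometric_at C ?q x" if "x \<in> C" for x
        using that C by (intro nearly_isometric_at_subset[OF cup_sector_nearly_isometric]) auto
      show "continuous_on (S \<inter> ball (\<gamma> t) \<rho>') (cup_chart \<phi> g)"
        by (rule continuous_on_subset[OF continuous_on_cup_chart]) (use \<rho>(2) \<rho>'(2) in \<open>force simp: p_def\<close>)
      show "cup_chart \<phi> g p' \<in> C \<and> ?q (cup_chart \<phi> g p') = p'" if p': "p' \<in> S \<inter> ball (\<gamma> t) \<rho>'" for p'
      proof
        have s: "p' \<in> cup_side \<phi>" using in_side p' by (simp add: p_def)
        have "p' \<in> ball p \<rho>" using p' \<rho>'(2) by (simp add: p_def)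
        then have "cup_chart \<phi> g p' \<in> ball (of_real r) \<eta>" using \<rho>(2) by blast
        then show "cup_chart \<phi> g p' \<in> C"
          using cup_chart(1)[OF s, of g] by (simp add: C_def cup_sector_def)
        show "?q (cup_chart \<phi> g p') = p'" by (rule cup_chart(2)[OF s])
      qed
    qed
    have "r < 1 / sin \<phi>"
      using side(3) sin_pos cos_pos by (simp add: r_def cot_def field_simps)
    then have "norm (complex_of_real r) < 1 / sin \<phi> \<and> \<bar>Arg (of_real r)\<bar> < pi * sin \<phi>"
      using r sector_angle(2) Arg_of_real[of r] by simp
    moreover have "of_real r \<in> \<Union>?F" "?q (of_real r) = p"
      using cup_chart(1,2)[OF side(1), of g] sub(1) unfolding m by blast+
    moreover have "straight_at ?F ?q \<gamma> a b t (of_real r)"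
      using st by (simp only: p_def[symmetric] m)
    ultimately show ?thesis by (intro finish disjI1)
  next
    case rim
    define s where "s = 1 / sin \<phi>"
    have s: "0 < s" using sin_pos by (simp add: s_def)
    have ps: "0 < p $ 3" "p $ 3 / cos \<phi> = s"
      using rim(3) cot_pos cos_pos by (simp_all add: s_def cot_def)
    obtain \<eta> where \<eta>: "0 < \<eta>" "ball (of_real s) \<eta> \<inter> cball 0 s \<subseteq> cup_sector \<phi> - {0}"
      using Arg_near_axis[OF s] unfolding s_def by blast
    define C where "C = ball (complex_of_real s) \<eta> \<inter> cball 0 s"
    have C: "C \<subseteq> cup_sector \<phi>" "0 \<notin> C" unfolding C_def using \<eta>(2) by blast+
    obtain \<rho> where \<rho>: "0 < \<rho>" "ball p \<rho> \<subseteq> {p'. 0 < Re (horiz p' * cis (- g))} \<inter>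
       cup_chart \<phi> g -` ball (of_real s) \<eta>"
      using cup_chart_near[OF rim(1) ps(1) \<eta>(1)] unfolding g_def ps(2) by blast
    have m: "cup_chart \<phi> g p = of_real s"
      using cup_chart_axis[OF rim(1) ps(1)] by (simp add: g_def ps)
    have qm: "\<gamma> t = ?q (of_real s)"
      using cup_chart(2)[OF rim(1), of g] m by (simp add: p_def)
    have sD: "of_real s \<in> cup_lid \<phi>" by (simp add: s_def cup_lid_def dist_norm)
    have "straight_at ?F ?q \<gamma> a b t (of_real s)"
    proof (rule straight_at_rim_point[where C = C and D = "cup_lid \<phi>" and n = 1
          and m = "of_real s" and q = ?q and F = ?F
          and \<rho> = \<rho> and e\<^sub>0 = "min \<eta> pi" and \<kappa> = "cup_chart \<phi> g" and N = "cup_side \<phi> \<inter> ball p \<rho>"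
          and d\<^sub>1 = "\<lambda>\<epsilon>. 0 + of_real s * cis (sin \<phi> * \<epsilon>)"
          and d\<^sub>2 = "\<lambda>\<epsilon>. of_real (s + 1) + (- 1) * cis ((- 1) * \<epsilon>)"])
      show "convex C" by (simp add: C_def convex_Int)
      show "short_on C ?q" using cup_sector_short C(1) by (rule short_on_subset)
      show "?q ` C \<subseteq> S" "C \<subseteq> \<Union>?F" using C(1) q_sub(1) sub(1) by blast+
      show "nearly_isometric_at C ?q x" if "x \<in> C" for x
        using that C by (intro nearly_isometric_at_subset[OF cup_sector_nearly_isometric]) auto
      show "of_real s \<in> C" using s \<eta>(1) by (simp add: C_def)
      show "(x - of_real s) \<bullet> 1 < 0" if x: "x \<in> C" "?q x \<notin> ?q ` cup_lid \<phi>" for x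
      proof -
        have "norm x \<noteq> s"
        proof
          assume "norm x = s"
          then have "?q x \<in> horizontal_disk (cot \<phi>)"
            using x(1) C(1) sin_pos by (auto simp: cup_map_sector[OF subsetD] cup_side_map_def
                horizontal_disk_eq s_def cot_def)
          then show False using x(2) by (simp add: cup_map_image_lid)
        qed
        moreover have "norm x \<le> s" using x by (simp add: C_def)
        ultimately show ?thesis
          using complex_Re_le_cmod[of x] by (simp add: inner_complex_def)
      qed
      show "convex (cup_lid \<phi>)" by (simp add: cup_lid_def)
      show "convex (?q ` cup_lid \<phi>)" by (simp add: cup_map_image_lid convex_horizontal_disk)
      show "(x - of_real s) \<bullet> 1 > 0" if "x \<in> cup_lid \<phi>" "x \<noteq> of_real s" for x
      proof -
        have "Re x \<noteq> s" using cup_lid_beyond(4)[OF that(1)] that(2) by (auto simp: s_def)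
        then show ?thesis using cup_lid_beyond(1)[OF that(1)] by (simp add: inner_complex_def s_def)
      qed
      show "dist (?q x) (?q y) = dist x y" if "x \<in> cup_lid \<phi>" "y \<in> cup_lid \<phi>" for x y
        using that by (rule cup_lid_isometric)
      show "S \<inter> ball (\<gamma> t) \<rho> - ?q ` cup_lid \<phi> \<subseteq> cup_side \<phi> \<inter> ball p \<rho>"
        unfolding cup_map_image_lid S conical_cup_def p_def by blast
      show "\<gamma> t \<in> cup_side \<phi> \<inter> ball p \<rho>"
        using rim(1) \<rho>(1) by (simp add: p_def)
      show "continuous_on (cup_side \<phi> \<inter> ball p \<rho>) (cup_chart \<phi> g)"
        by (rule continuous_on_subset[OF continuous_on_cup_chart]) (use \<rho>(2) in blast)
      show "cup_chart \<phi> g p' \<in> C \<and> ?q (cup_chart \<phi> g p') = p'" if p': "p' \<in> cup_side \<phi> \<inter> ball p \<rho>" for p'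
      proof
        have "cup_chart \<phi> g p' \<in> ball (of_real s) \<eta>" using \<rho>(2) p' by blast
        then show "cup_chart \<phi> g p' \<in> C"
          using cup_chart(1)[of p' g] p' by (simp add: C_def cup_sector_def s_def)
        show "?q (cup_chart \<phi> g p') = p'" using p' by (intro cup_chart(2)) simp
      qed
      show "cup_chart \<phi> g (\<gamma> t) = of_real s" using m by (simp add: p_def)
      show "((\<lambda>\<epsilon>. 0 + of_real s * cis (sin \<phi> * \<epsilon>)) has_vector_derivative \<i> * 1) (at 0)"
        using rim_derivatives(2)[of 0 "of_real s" "sin \<phi>"] sin_pos by (simp add: s_def)
      show "((\<lambda>\<epsilon>. of_real (s + 1) + (- 1) * cis ((- 1) * \<epsilon>)) has_vector_derivative \<i> * 1) (at 0)"
        using rim_derivatives(2)[of "of_real (s + 1)" "- 1" "- 1"] by simp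
      show "0 < min \<eta> pi" using \<eta> by simp
      show "0 + of_real s * cis (sin \<phi> * \<epsilon>) \<in> C \<and> of_real (s + 1) + (- 1) * cis ((- 1) * \<epsilon>) \<in> cup_lid \<phi> \<and>
          ?q (0 + of_real s * cis (sin \<phi> * \<epsilon>)) = ?q (of_real (s + 1) + (- 1) * cis ((- 1) * \<epsilon>))"
        if \<epsilon>: "\<bar>\<epsilon>\<bar> < min \<eta> pi" for \<epsilon>
      proof (intro conjI)
        have arc: "0 + of_real s * cis (sin \<phi> * \<epsilon>) = rcis s (sin \<phi> * \<epsilon>)" by (simp add: rcis_def)
        have "(dist (rcis s 0) (rcis s (sin \<phi> * \<epsilon>)))\<^sup>2 = (2 * s * \<bar>sin (sin \<phi> * \<epsilon> / 2)\<bar>)\<^sup>2"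
          unfolding dist_norm norm_rcis_diff by (simp add: power_mult_distrib power2_eq_square)
        then have "dist (rcis s 0) (rcis s (sin \<phi> * \<epsilon>)) = 2 * s * \<bar>sin (sin \<phi> * \<epsilon> / 2)\<bar>"
          using s by (subst (asm) power2_eq_iff_nonneg) auto
        also have "\<dots> \<le> 2 * s * \<bar>sin \<phi> * \<epsilon> / 2\<bar>"
          using s by (intro mult_left_mono abs_sin_x_le_abs_x) auto
        also have "\<dots> = \<bar>\<epsilon>\<bar>" using sin_pos by (simp add: s_def abs_mult)
        finally have "rcis s (sin \<phi> * \<epsilon>) \<in> ball (of_real s) \<eta>"
          using \<epsilon> by (simp add: rcis_def)
        then show C': "0 + of_real s * cis (sin \<phi> * \<epsilon>) \<in> C"
          unfolding arc using s by (simp add: C_def)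
        have D: "of_real (s + 1) + (- 1) * cis ((- 1) * \<epsilon>) \<in> cup_lid \<phi>"
          by (simp add: cup_lid_def dist_norm s_def)
        then show "of_real (s + 1) + (- 1) * cis ((- 1) * \<epsilon>) \<in> cup_lid \<phi>" .
        have "\<bar>sin \<phi> * \<epsilon>\<bar> < pi"
          using \<epsilon> sin_pos sin_less_1 mult_strict_mono[of "sin \<phi>" 1 "\<bar>\<epsilon>\<bar>" pi] by (simp add: abs_mult)
        then have "?q (rcis s (sin \<phi> * \<epsilon>)) = at_height (rcis (s * sin \<phi>) (sin \<phi> * \<epsilon> / sin \<phi> + g)) (s * cos \<phi>)"
          using C' C(1) s unfolding arc by (subst cup_map_sector) (auto simp: cup_side_map_rcis)
        also have "\<dots> = at_height (cis (\<epsilon> + g)) (cot \<phi>)"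
          using sin_pos by (simp add: s_def cot_def cis_rcis_eq)
        also have "\<dots> = cup_lid_map \<phi> g (of_real (s + 1) + (- 1) * cis ((- 1) * \<epsilon>))"
          by (simp add: cup_lid_map_def s_def cis_cnj cis_mult)
        also have "\<dots> = ?q (of_real (s + 1) + (- 1) * cis ((- 1) * \<epsilon>))"
          using cup_map_lid[OF D] by simp
        finally show "?q (0 + of_real s * cis (sin \<phi> * \<epsilon>)) = ?q (of_real (s + 1) + (- 1) * cis ((- 1) * \<epsilon>))"
          unfolding arc .
      qed
    qed (use t \<rho>(1) qm q_sub sub sD \<open>0 < s\<close> in auto)
    then show ?thesis
      using sD sub(2) qm by (intro finish[of "of_real s"] disjI2) (auto simp only: p_def s_def)
  next
    case lid
    define \<rho> where "\<rho> = (1 - norm (horiz p)) / (1 + tan \<phi>)"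
    have "\<rho> * (1 + tan \<phi>) = 1 - norm (horiz p)"
      using tan_pos by (simp add: \<rho>_def)
    then have \<rho>: "\<rho> > 0" "\<rho> + \<rho> * tan \<phi> = 1 - norm (horiz p)"
      using lid tan_pos by (simp_all add: \<rho>_def distrib_left)
    have in_lid: "p' \<in> horizontal_disk (cot \<phi>)" if p': "p' \<in> S \<inter> ball p \<rho>" for p'
    proof -
      have "norm (horiz p') < norm (horiz p) + \<rho>"
        using p' dist_horiz_le[of p p'] norm_triangle_ineq2[of "horiz p'" "horiz p"]
        by (auto simp: dist_norm[where 'a = complex] norm_minus_commute)
      moreover have "cot \<phi> - \<rho> < p' $ 3"
        using p' dist_height_le[of p p'] lid by auto
      then have "(cot \<phi> - \<rho>) * tan \<phi> < p' $ 3 * tan \<phi>"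
        using tan_pos by (intro mult_strict_right_mono)
      then have "1 - \<rho> * tan \<phi> < p' $ 3 * tan \<phi>"
        using \<open>cot \<phi> * tan \<phi> = 1\<close> by (simp add: left_diff_distrib)
      ultimately have "norm (horiz p') < p' $ 3 * tan \<phi>"
        using \<rho>(2) by linarith
      then show ?thesis
        using p' by (auto simp: S mem_conical_cup cup_side_eq[OF angle])
    qed
    have p_lid: "p \<in> horizontal_disk (cot \<phi>)" using lid by (simp add: horizontal_disk_eq)
    have "straight_at ?F ?q \<gamma> a b t (lid_chart g (\<gamma> t))"
    proof (rule straight_at_regular_point[OF t \<rho>(1) _ _ q_sub(2) _ sub(2)])
      show "convex (cup_lid \<phi>)" by (simp add: cup_lid_def)
      show "short_on (cup_lid \<phi>) ?q"
        by (simp add: short_on_def cup_lid_isometric)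
      show "nearly_isometric_at (cup_lid \<phi>) ?q x" for x
        by (intro nearly_isometric_at_isometry cup_lid_isometric)
      show "continuous_on (S \<inter> ball (\<gamma> t) \<rho>) (lid_chart g)"
        unfolding lid_chart_def by (intro continuous_intros)
      show "lid_chart g p' \<in> cup_lid \<phi> \<and> ?q (lid_chart g p') = p'" if "p' \<in> S \<inter> ball (\<gamma> t) \<rho>" for p'
        using lid_chart[OF in_lid, of p' g] that by (simp add: p_def)
    qed
    moreover have "lid_chart g p \<in> ball (of_real (1 / sin \<phi> + 1)) 1"
      using lid by (simp add: lid_chart_def dist_norm norm_mult)
    ultimately show ?thesis
      using lid_chart[OF p_lid, of g] sub(2) by (intro finish[of "lid_chart g p"]) (auto simp: p_def[symmetric])
  qed
qed

theorem theorem1: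
  fixes S :: "(real^3) set" and A B :: "real^3"
    and \<gamma> :: "real \<Rightarrow> real^3" and a b :: real
  assumes "(\<exists>h>0. S = soup_can h) \<or> (\<exists>\<phi>. 0 < \<phi> \<and> \<phi> < pi / 2 \<and> S = conical_cup \<phi>)"
    and "A \<in> S" and "B \<in> S" and "A \<noteq> B"
    and "minimal_path S \<gamma> a b" and "\<gamma> a = A" and "\<gamma> b = B"
    and "constant_speed \<gamma> a b"
  shows "geodesic S \<gamma> a b"
proof -
  obtain c where c: "0 \<le> c" "\<And>u v. a \<le> u \<Longrightarrow> u \<le> v \<Longrightarrow> v \<le> b \<Longrightarrow> arc_length \<gamma> u v = ennreal (c * (v - u))"
    using assms(8) unfolding constant_speed_def by blast
  interpret shortest_path S \<gamma> a b c
    by (rule shortest_path.intro) (use assms(4-7) c in simp_all)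
  have *: "\<exists>F q m. flat_model S F q \<and> \<Union>F \<inter> q -` {\<gamma> t} = {m} \<and> straight_at F q \<gamma> a b t m"
    if "t \<in> {a<..<b}" for t
    using assms(1)
  proof (elim disjE exE conjE)
    fix h :: real assume "h > 0" "S = soup_can h"
    then show ?thesis using can_geodesic_at that by blast
  next
    fix \<phi> assume "0 < \<phi>" "\<phi> < pi / 2" and S: "S = conical_cup \<phi>"
    then have "cone_angle \<phi>" by (simp add: cone_angle_def)
    then show ?thesis by (rule cup_geodesic_at[OF shortest_path_axioms _ S that])
  qed
  have "path_on S \<gamma> a b"
    using assms(5) unfolding minimal_path_def by (rule conjunct1)
  then show ?thesis
    unfolding geodesic_def straight_at_def[symmetric] by (intro conjI ballI *)
qed

end
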